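(* Let $P(\lambda)=\sum_{i=0}^m\lambda^iA_i$ with $A_i\in\mathbb{C}^{n\times n}$, $A_m\neq 0$, $m\ge 2$, be singular, and let $$L(\lambda)=M_{\tau_1}(Y_1)\,M_{\sigma_1}(X_1)\,(\lambda M^P_\tau-M^P_\sigma)\,M_{\sigma_2}(X_2)\,M_{\tau_2}(Y_2)$$ be an extended generalized Fiedler pencil (EGFP) of $P(\lambda)$. Write $\tau=(\tau_l,-m,\tau_r)$. Let $c_L$ and $i_L$ be, respectively, the total number of consecutions and the total number of inversions of the permutation $(-\mathrm{rev}(\tau_l),\sigma,-\mathrm{rev}(\tau_r))$ of $\{0:m-1\}$. Let $Z(\lambda)$ be an $mn\times p$ matrix polynomial. Then: (a) If $Z(\lambda)$ is a right (resp., left) minimal basis of $L(\lambda)$, then $(e^T_{m-c_0(\sigma,\sigma_2)}\otimes I_n)Z(\lambda)$ (resp., $(e^T_{m-i_0(\sigma_1,\sigma)}\otimes I_n)Z(\lambda)$) is a right (resp., left) minimal basis of $P(\lambda)$. (b) If $\varepsilon_1\le\cdots\le\varepsilon_p$ are the right (resp., left) minimal indices of $L(\lambda)$, then $\varepsilon_1-i_L\le\cdots\le\varepsilon_p-i_L$ (resp., $\varepsilon_1-c_L\le\cdots\le\varepsilon_p-c_L$) are the right (resp., left) minimal indices of $P(\lambda)$.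
   Context: Notation: $\{0:m\}=\{0,1,\dots,m\}$, $-\{0:m\}=\{-m,\dots,-1,-0\}$, where $-0$ is a formal index different from $0$ (the successor of $-1$). $e_j$ is the $j$-th column of $I_m$; $\otimes$ is the Kronecker product. Index tuples: an index tuple is a finite, possibly empty, tuple of indices. $(\alpha,\beta)$ denotes concatenation, $-\alpha$ negates all entries and $\mathrm{rev}(\alpha)$ reverses the order. A subtuple is obtained by deleting some entries. A tuple $(i_1,\dots,i_t)$ satisfies the Successor Infix Property (SIP) if whenever $a<b$ and $i_a=i_b$ there is $c$ with $a<c<b$ and $i_c=i_a+1$ (for tuples from $-\{0:m\}$ this is understood after shifting by $m$, so $-0$ is the successor of $-1$). For $t\in\alpha$, $c_t(\alpha)=p$ (consecutions at $t$) if $(t,t+1,\dots,t+p)$ is a subtuple of $\alpha$ but $(t,\dots,t+p+1)$ is not; $i_t(\alpha)=q$ (inversions at $t$) if $(t+q,\dots,t+1,t)$ is a subtuple of $\alpha$ but $(t+q+1,t+q,\dots,t)$ is not. If $t\notin\alpha$, $c_t(\alpha)=i_t(\alpha)=-1$. For a permutation $\alpha$ of $\{0:m-1\}$, the total number of consecutions (resp., inversions) of $\alpha$ is the number of $j\in\{0,\dots,m-2\}$ such that $j$ occurs before (resp., after) $j+1$ in $\alpha$. Elementary matrices (of size $mn\times mn$): for $X\in\mathbb{C}^{n\times n}$, $M_0(X)=\mathrm{diag}(I_{(m-1)n},X)$, $M_{-m}(X)=\mathrm{diag}(X,I_{(m-1)n})$, and for $i=1,\dots,m-1$ $$M_i(X)=\mathrm{diag}\Big(I_{(m-i-1)n},\begin{bmatrix}X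 & I_n \\ I_n & 0\end{bmatrix},I_{(i-1)n}\Big),\quad M_{-i}(X)=\mathrm{diag}\Big(I_{(m-i-1)n},\begin{bmatrix}0 & I_n \\ I_n & X\end{bmatrix},I_{(i-1)n}\Big).$$ $M_i^P=M_i(-A_i)$ for $0\le i\le m-1$, $M_{-i}^P=M_{-i}(A_i)$ for $1\le i\le m$, $M_{-0}^P=(M_0^P)^{-1}$, $M_m^P=(M_{-m}^P)^{-1}$ (the last two are used only when $A_0$, respectively $A_m$, is invertible; since $P$ is singular here, this forces $0\in\sigma$ and $-m\in\tau$). For a tuple $\mathbf t=(t_1,\dots,t_r)$, $M_{\mathbf t}^P=M_{t_1}^P\cdots M_{t_r}^P$; a matrix assignment for $\mathbf t$ is a tuple $X=(X_1,\dots,X_r)$ of $n\times n$ complex matrices, and $M_{\mathbf t}(X)=M_{t_1}(X_1)\cdots M_{t_r}(X_r)$. Empty products equal $I_{mn}$. An assignment is nonsingular if the matrices assigned to positions occupied by indices $\pm0,\pm m$ are nonsingular. EGFP: let $(\sigma,\omega)$ be a permutation of $\{0:m\}$ and $\tau=-\omega$. Let $\sigma_1,\sigma_2$ be index tuples with indices from $\sigma\setminus\{m-1,m\}$ such that $(\sigma_1,\sigma,\sigma_2)$ satisfies the SIP, and $\tau_1,\tau_2$ index tuples with indices from $\tau\setminus\{-1,-0\}$ such that $(\tau_1,\tau,\tau_2)$ satisfies the SIP. Let $X_1,X_2,Y_1,Y_2$ be arbitrary nonsingular matrix assignments for $\sigma_1,\sigma_2,\tau_1,\tau_2$. Then $M_{\tau_1}(Y_1)M_{\sigma_1}(X_1)(\lambda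 M^P_\tau-M^P_\sigma)M_{\sigma_2}(X_2)M_{\tau_2}(Y_2)$ is an EGFP of $P(\lambda)$. Minimal bases: a square matrix polynomial is singular if its determinant is identically zero. For a rational matrix $G(\lambda)$, $\mathcal N_r(G)=\{x\in\mathbb{C}(\lambda)^n:Gx=0\}$ and $\mathcal N_l(G)=\{y:y^TG=0\}$. A right (left) minimal basis of $G$ is a basis of $\mathcal N_r(G)$ ($\mathcal N_l(G)$) over $\mathbb{C}(\lambda)$ consisting of polynomial vectors, ordered by nondecreasing degree, whose sum of degrees is minimal among all polynomial bases; the degrees are the right (left) minimal indices. A matrix polynomial is called a right (left) minimal basis if its columns form one. *)

theory Defs
  imports
    "HOL-Library.Sublist"
    "HOL-Computational_Algebra.Polynomial_Factorial"
    "Jordan_Normal_Form.Matrix_Kernel"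
    "Jordan_Normal_Form.Gauss_Jordan_Elimination"
begin

section \<open>Index tuples\<close>

text \<open>
  Tuples of nonnegative indices are lists of naturals. The formal indices $-m, \dots, -1, -0$
  get a type of their own, because $-0$ differs from $0$: \<open>Neg i\<close> is the index $-i$.
\<close>

datatype neg_index = Neg (neg_abs: nat)

definition sip :: "nat list \<Rightarrow> bool" where
  "sip \<alpha> \<longleftrightarrow> (\<forall>a b. a < b \<and> b < length \<alpha> \<and> \<alpha> ! a = \<alpha> ! b \<longrightarrow>
                 (\<exists>c. a < c \<and> c < b \<and> \<alpha> ! c = \<alpha> ! a + 1))"

text \<open>For tuples from $-\{0:m\}$ the property is understood after adding $m$ to every entry.\<close>

definition sip_neg :: "nat \<Rightarrow> neg_index list \<Rightarrow> bool" where
  "sip_neg m \<alpha> \<longleftrightarrow> sip (map (\<lambda>t. m - neg_abs t) \<alpha>)"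

definition consecutions :: "nat \<Rightarrow> nat list \<Rightarrow> int" where
  "consecutions t \<alpha> =
     (if t \<in> set \<alpha>
      then int (THE p. subseq [t..<t + p + 1] \<alpha> \<and> \<not> subseq [t..<t + p + 2] \<alpha>)
      else -1)"

definition inversions :: "nat \<Rightarrow> nat list \<Rightarrow> int" where
  "inversions t \<alpha> =
     (if t \<in> set \<alpha>
      then int (THE q. subseq (rev [t..<t + q + 1]) \<alpha> \<and> \<not> subseq (rev [t..<t + q + 2]) \<alpha>)
      else -1)"

definition occurs_before :: "nat \<Rightarrow> nat \<Rightarrow> nat list \<Rightarrow> bool" where
  "occurs_before x y \<alpha> \<longleftrightarrow> (\<exists>a b. a < b \<and> b < length \<alpha> \<and> \<alpha> ! a = x \<and> \<alpha> ! b = y)"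

definition total_consecutions :: "nat \<Rightarrow> nat list \<Rightarrow> nat" where
  "total_consecutions m \<alpha> = card {j. j + 1 < m \<and> occurs_before j (j + 1) \<alpha>}"

definition total_inversions :: "nat \<Rightarrow> nat list \<Rightarrow> nat" where
  "total_inversions m \<alpha> = card {j. j + 1 < m \<and> occurs_before (j + 1) j \<alpha>}"


section \<open>Elementary matrices and Fiedler-type products\<close>

text \<open>
  \<open>elem_mat m n i X\<close> is $M_i(X)$, meaningful for $0 \le i \le m-1$, and
  \<open>elem_mat_neg m n (Neg i) X\<close> is $M_{-i}(X)$, meaningful for $1 \le i \le m$.
\<close>

definition elem_mat :: "nat \<Rightarrow> nat \<Rightarrow> nat \<Rightarrow> complex mat \<Rightarrow> complex mat" where
  "elem_mat m n i X =
     (if i = 0 then diag_block_mat [1\<^sub>m ((m - 1) * n), X]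
      else diag_block_mat
             [1\<^sub>m ((m - i - 1) * n),
              four_block_mat X (1\<^sub>m n) (1\<^sub>m n) (0\<^sub>m n n),
              1\<^sub>m ((i - 1) * n)])"

fun elem_mat_neg :: "nat \<Rightarrow> nat \<Rightarrow> neg_index \<Rightarrow> complex mat \<Rightarrow> complex mat" where
  "elem_mat_neg m n (Neg i) X =
     (if i = m then diag_block_mat [X, 1\<^sub>m ((m - 1) * n)]
      else diag_block_mat
             [1\<^sub>m ((m - i - 1) * n),
              four_block_mat (0\<^sub>m n n) (1\<^sub>m n) (1\<^sub>m n) X,
              1\<^sub>m ((i - 1) * n)])"

definition mat_prod :: "nat \<Rightarrow> complex mat list \<Rightarrow> complex mat" where
  "mat_prod N Ms = foldr (*) Ms (1\<^sub>m N)"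

text \<open>The coefficients of $P$ are given as \<open>A 0, \<dots>, A m\<close>.\<close>

definition fiedler_mat :: "nat \<Rightarrow> nat \<Rightarrow> (nat \<Rightarrow> complex mat) \<Rightarrow> nat \<Rightarrow> complex mat" where
  "fiedler_mat m n A i =
     (if i = m then the (mat_inverse (elem_mat_neg m n (Neg m) (A m)))
      else elem_mat m n i (- A i))"

fun fiedler_mat_neg ::
  "nat \<Rightarrow> nat \<Rightarrow> (nat \<Rightarrow> complex mat) \<Rightarrow> neg_index \<Rightarrow> complex mat" where
  "fiedler_mat_neg m n A (Neg i) =
     (if i = 0 then the (mat_inverse (fiedler_mat m n A 0))
      else elem_mat_neg m n (Neg i) (A i))"

definition fiedler_prod ::
  "nat \<Rightarrow> nat \<Rightarrow> (nat \<Rightarrow> complex mat) \<Rightarrow> nat list \<Rightarrow> complex mat" where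
  "fiedler_prod m n A t = mat_prod (m * n) (map (fiedler_mat m n A) t)"

definition fiedler_prod_neg ::
  "nat \<Rightarrow> nat \<Rightarrow> (nat \<Rightarrow> complex mat) \<Rightarrow> neg_index list \<Rightarrow> complex mat" where
  "fiedler_prod_neg m n A t = mat_prod (m * n) (map (fiedler_mat_neg m n A) t)"

definition elem_prod :: "nat \<Rightarrow> nat \<Rightarrow> nat list \<Rightarrow> complex mat list \<Rightarrow> complex mat" where
  "elem_prod m n t X = mat_prod (m * n) (map2 (elem_mat m n) t X)"

definition elem_prod_neg :: "nat \<Rightarrow> nat \<Rightarrow> neg_index list \<Rightarrow> complex mat list \<Rightarrow> complex mat" where
  "elem_prod_neg m n t X = mat_prod (m * n) (map2 (elem_mat_neg m n) t X)"

definition matrix_assignment :: "nat \<Rightarrow> 'i list \<Rightarrow> complex mat list \<Rightarrow> bool" where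
  "matrix_assignment n t X \<longleftrightarrow> length X = length t \<and> set X \<subseteq> carrier_mat n n"

definition nonsingular_assignment :: "nat \<Rightarrow> nat list \<Rightarrow> complex mat list \<Rightarrow> bool" where
  "nonsingular_assignment m t X \<longleftrightarrow>
     (\<forall>k < length t. t ! k \<in> {0, m} \<longrightarrow> invertible_mat (X ! k))"

definition nonsingular_assignment_neg :: "nat \<Rightarrow> neg_index list \<Rightarrow> complex mat list \<Rightarrow> bool" where
  "nonsingular_assignment_neg m t X \<longleftrightarrow>
     (\<forall>k < length t. t ! k \<in> {Neg 0, Neg m} \<longrightarrow> invertible_mat (X ! k))"


section \<open>Matrix polynomials and extended generalized Fiedler pencils\<close>

definition matrix_poly :: "nat \<Rightarrow> nat \<Rightarrow> (nat \<Rightarrow> complex mat) \<Rightarrow> complex poly mat" where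
  "matrix_poly m n A = mat n n (\<lambda>(r, c). \<Sum>i\<le>m. monom (A i $$ (r, c)) i)"

abbreviation const_mat :: "complex mat \<Rightarrow> complex poly mat" where
  "const_mat \<equiv> map_mat (\<lambda>a. [:a:])"

text \<open>
  The two invertibility conditions say that $M_m^P$ and $M_{-0}^P$, which are inverses of
  elementary matrices, may only be used when they exist.
\<close>

definition is_EGFP ::
  "nat \<Rightarrow> nat \<Rightarrow> (nat \<Rightarrow> complex mat) \<Rightarrow>
   neg_index list \<Rightarrow> nat list \<Rightarrow> neg_index list \<Rightarrow> nat list \<Rightarrow> nat list \<Rightarrow> neg_index list \<Rightarrow>
   complex mat list \<Rightarrow> complex mat list \<Rightarrow> complex mat list \<Rightarrow> complex mat list \<Rightarrow>
   complex poly mat \<Rightarrow> bool" where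
  "is_EGFP m n A \<tau>1 \<sigma>1 \<tau> \<sigma> \<sigma>2 \<tau>2 Y1 X1 X2 Y2 L \<longleftrightarrow>
     (\<exists>\<omega>. distinct (\<sigma> @ \<omega>) \<and> set (\<sigma> @ \<omega>) = {0..m} \<and> \<tau> = map Neg \<omega>) \<and>
     (m \<in> set \<sigma> \<longrightarrow> invertible_mat (A m)) \<and>
     (Neg 0 \<in> set \<tau> \<longrightarrow> invertible_mat (A 0)) \<and>
     set \<sigma>1 \<subseteq> set \<sigma> - {m - 1, m} \<and> set \<sigma>2 \<subseteq> set \<sigma> - {m - 1, m} \<and>
     sip (\<sigma>1 @ \<sigma> @ \<sigma>2) \<and>
     set \<tau>1 \<subseteq> set \<tau> - {Neg 1, Neg 0} \<and> set \<tau>2 \<subseteq> set \<tau> - {Neg 1, Neg 0} \<and>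
     sip_neg m (\<tau>1 @ \<tau> @ \<tau>2) \<and>
     matrix_assignment n \<sigma>1 X1 \<and> nonsingular_assignment m \<sigma>1 X1 \<and>
     matrix_assignment n \<sigma>2 X2 \<and> nonsingular_assignment m \<sigma>2 X2 \<and>
     matrix_assignment n \<tau>1 Y1 \<and> nonsingular_assignment_neg m \<tau>1 Y1 \<and>
     matrix_assignment n \<tau>2 Y2 \<and> nonsingular_assignment_neg m \<tau>2 Y2 \<and>
     L = const_mat (elem_prod_neg m n \<tau>1 Y1) * const_mat (elem_prod m n \<sigma>1 X1) *
         ([:0, 1:] \<cdot>\<^sub>m const_mat (fiedler_prod_neg m n A \<tau>) - const_mat (fiedler_prod m n A \<sigma>)) *
         const_mat (elem_prod m n \<sigma>2 X2) * const_mat (elem_prod_neg m n \<tau>2 Y2)"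

definition kronecker :: "'a :: times mat \<Rightarrow> 'a mat \<Rightarrow> 'a mat" where
  "kronecker A B = mat (dim_row A * dim_row B) (dim_col A * dim_col B)
     (\<lambda>(i, j). A $$ (i div dim_row B, j div dim_col B) * B $$ (i mod dim_row B, j mod dim_col B))"

text \<open>
  The block row selector $e_j^T \otimes I_n$, where $e_j$ is the $j$-th column of $I_m$. Columns
  are counted from $1$, whereas \<^const>\<open>col\<close> counts from $0$.
\<close>

definition block_row_selector :: "nat \<Rightarrow> nat \<Rightarrow> nat \<Rightarrow> complex poly mat" where
  "block_row_selector m n j = kronecker (mat_of_row (col (1\<^sub>m m) (j - 1))) (1\<^sub>m n)"


section \<open>Minimal bases and minimal indices\<close>

text \<open>
  The field $\mathbb{C}(\lambda)$ is \<^typ>\<open>complex poly fract\<close>. The equation $y^T G = 0$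
  is written as $G^T y = 0$.
\<close>

definition right_null :: "complex poly fract mat \<Rightarrow> complex poly fract vec set" where
  "right_null G = mat_kernel G"

definition left_null :: "complex poly fract mat \<Rightarrow> complex poly fract vec set" where
  "left_null G = mat_kernel (transpose_mat G)"

text \<open>\<open>poly_basis k W zs\<close>: the polynomial vectors \<open>zs\<close> form a basis of the subspace
  \<open>W\<close> of $\mathbb{C}(\lambda)^k$.\<close>

definition poly_basis ::
  "nat \<Rightarrow> complex poly fract vec set \<Rightarrow> complex poly vec list \<Rightarrow> bool" where
  "poly_basis k W zs \<longleftrightarrow>
     distinct zs \<and>
     vectorspace.basis class_ring (module_vec TYPE(complex poly fract) k \<lparr>carrier := W\<rparr>)
       (map_vec to_fract ` set zs)"

text \<open>The largest degree of an entry. Members of a basis are nonzero, so that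
  $\deg 0 = 0$ is harmless.\<close>

definition vec_degree :: "complex poly vec \<Rightarrow> nat" where
  "vec_degree v = Max (insert 0 (degree ` set\<^sub>v v))"

definition minimal_basis ::
  "nat \<Rightarrow> complex poly fract vec set \<Rightarrow> complex poly vec list \<Rightarrow> bool" where
  "minimal_basis k W zs \<longleftrightarrow>
     poly_basis k W zs \<and> sorted (map vec_degree zs) \<and>
     (\<forall>ws. poly_basis k W ws \<longrightarrow>
        sum_list (map vec_degree zs) \<le> sum_list (map vec_degree ws))"

definition right_minimal_basis :: "complex poly fract mat \<Rightarrow> complex poly mat \<Rightarrow> bool" where
  "right_minimal_basis G Z \<longleftrightarrow> dim_row Z = dim_col G \<and> minimal_basis (dim_col G) (right_null G) (cols Z)"

definition left_minimal_basis :: "complex poly fract mat \<Rightarrow> complex poly mat \<Rightarrow> bool" where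
  "left_minimal_basis G Z \<longleftrightarrow> dim_row Z = dim_row G \<and> minimal_basis (dim_row G) (left_null G) (cols Z)"

text \<open>Minimal indices are listed as integers, so that shifting them involves no truncated
  subtraction.\<close>

definition right_minimal_indices :: "complex poly fract mat \<Rightarrow> int list \<Rightarrow> bool" where
  "right_minimal_indices G es \<longleftrightarrow>
     (\<exists>Z. right_minimal_basis G Z \<and> es = map (\<lambda>z. int (vec_degree z)) (cols Z))"

definition left_minimal_indices :: "complex poly fract mat \<Rightarrow> int list \<Rightarrow> bool" where
  "left_minimal_indices G es \<longleftrightarrow>
     (\<exists>Z. left_minimal_basis G Z \<and> es = map (\<lambda>z. int (vec_degree z)) (cols Z))"

abbreviation rational_mat :: "complex poly mat \<Rightarrow> complex poly fract mat" where
  "rational_mat \<equiv> map_mat to_fract"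

end

theory Submission
  imports Defs
begin

text \<open>
  Multiplying a pencil by invertible constant matrices does not affect the degrees of its
  polynomial null vectors. All elementary matrices with admissible parameters are invertible, and
  $M^P_{-i}$ is the inverse of $M^P_i$ for $0 < i < m$. As $P$ is singular, $A_0$ is not
  invertible, so that $0 \in \sigma$, and moving the factors of $\tau_l$ and $\tau_r$ across the
  pencil gives $L = U (\lambda M^P_{-m} - M^P_\alpha) V$ with $U$, $V$ constant and invertible
  and $\alpha = (-\mathrm{rev}(\tau_l), \sigma, -\mathrm{rev}(\tau_r))$
  (\<open>fiedler_factorization\<close>). Degrees therefore only have to be studied for this Fiedler pencil.

  Number the blocks of a vector $v$ from $0$ at the bottom to $m-1$ at the top. The factor $M^P_i$
  replaces $(v_i, v_{i-1})$ by $(-A_i v_i + v_{i-1}, v_i)$. When the factors of $M^P_\alpha$ are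
  applied to $v$ one after the other, let $a_i$ and $b_i$ be the contents of the blocks $i$ and
  $i-1$ just before $M^P_i$ acts, with $b_0 = 0$. The equation
  $\lambda M^P_{-m} v = M^P_\alpha v$ then splits into local conditions. If $i$ occurs before
  $i+1$ in $\alpha$, then $a_{i+1} = a_i$, $v_i = b_{i+1}$ and
  $\lambda b_{i+1} = b_i - A_i a_i$; otherwise $a_{i+1} = \lambda a_i$, $v_i = a_i$ and
  $b_{i+1} = b_i - A_i a_i$. With $x = a_0$, and with $p_i$ and $q_i$ the numbers of consecutions
  and inversions below $i$, so that $p_i + q_i = i$, this means
  \[ a_i = \lambda^{q_i} x, \qquad \lambda^{p_i} b_i = -\sum_{j<i} \lambda^j A_j x, \]
  and the condition that remains at the top is $P x = 0$. So $v \mapsto x$ is a bijection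
  between the polynomial null vectors of the Fiedler pencil and those of $P$. The top block
  $\lambda^{q_{m-1}} x$ exceeds $x$ in degree by the total number of inversions of $\alpha$, and
  the formulas show that no other block has a larger degree (\<open>null_vector_shape\<close>,
  \<open>null_vector_degree\<close>, \<open>null_vector_exists\<close>).

  It remains to find $x$ among the blocks of a null vector $z$ of $L$ itself. In $v$ it is the
  block whose number is the last index of the longest initial run $0, 1, 2, \dots$ in $\alpha$.
  The factors of $V$ shift this block: those of $\tau_r$ down to the run of $\sigma$, those of
  $\sigma_2$ up to the run of $(\sigma, \sigma_2)$, and those of $\tau_2$ leave it alone. The SIP
  is what keeps the arbitrary matrices in $\sigma_2$ and $\tau_2$ from interfering
  (\<open>select_elem_prod\<close>, \<open>select_elem_prod_neg\<close>, \<open>select_fiedler_prod_neg\<close>).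

  A linear bijection of null spaces that matches polynomial vectors with polynomial vectors and
  changes all degrees by the same amount carries minimal bases to minimal bases
  (\<open>null_space_transfer\<close>). Transposition reverses every tuple and thereby exchanges
  consecutions with inversions, which turns the statement about left minimal bases into the one
  about right minimal bases (\<open>is_EGFP_transpose\<close>).
\<close>

section \<open>Runs and relative order in index tuples\<close>

text \<open>
  A greedy scan that looks for \<open>g\<close>, then for \<open>g + 1\<close>, and so on, and returns the first index that
  it has not found. Unlike the definition of consecutions by maximal subtuples it is recursive in the
  tuple, which allows inductions that follow a product of elementary matrices factor by factor.
\<close>

fun run :: "nat \<Rightarrow> nat list \<Rightarrow> nat" where
  "run g [] = g"
| "run g (x # xs) = run (if x = g then Suc g else g) xs"

lemma run_append: "run g (xs @ ys) = run (run g xs) ys"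
  by (induction xs arbitrary: g) auto

lemma le_run: "g \<le> run g xs"
  by (induction xs arbitrary: g) (auto intro: Suc_leD)

lemma subseq_upt_iff_le_run:
  assumes "g \<le> h"
  shows "subseq [g..<h] xs \<longleftrightarrow> h \<le> run g xs"
  using assms
proof (induction xs arbitrary: g)
  case (Cons x xs)
  show ?case
  proof (cases "g = h")
    case False
    then have h: "[g..<h] = g # [Suc g..<h]" "Suc g \<le> h"
      using Cons.prems by (auto simp: upt_conv_Cons)
    show ?thesis
    proof (cases "x = g")
      case True
      then show ?thesis using Cons.IH[of "Suc g"] h by simp
    next
      case False
      then show ?thesis using Cons.IH[of g] h Cons.prems by simp
    qed
  qed (simp add: le_run del: run.simps)
qed (auto simp: list_emb_Nil2 dest!: list_emb_Nil2)

lemma run_zero_pos: "0 \<in> set xs \<Longrightarrow> 0 < run 0 xs"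
  using subseq_upt_iff_le_run[of 0 1 xs] by (simp add: subseq_singleton_left)

lemma run_skip: "g \<notin> set xs \<Longrightarrow> run g xs = g"
  by (induction xs) auto

lemma consecutions_zero:
  assumes "0 \<in> set xs"
  shows "consecutions 0 xs = int (run 0 xs - 1)"
proof -
  have "(THE p. subseq [0..<0 + p + 1] xs \<and> \<not> subseq [0..<0 + p + 2] xs) = run 0 xs - 1"
    using run_zero_pos[OF assms] by (subst (1 2) subseq_upt_iff_le_run) (auto intro!: the_equality)
  then show ?thesis using assms by (simp add: consecutions_def)
qed

lemma subseq_rev:
  assumes "subseq xs ys"
  shows "subseq (rev xs) (rev ys)"
  using assms by (induction rule: list_emb.induct) (auto intro: list_emb_append_mono)

lemma subseq_rev_iff: "subseq (rev xs) ys \<longleftrightarrow> subseq xs (rev ys)"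
  using subseq_rev[of xs "rev ys"] subseq_rev[of "rev xs" ys] by auto

lemma inversions_zero: "inversions 0 xs = consecutions 0 (rev xs)"
  unfolding inversions_def consecutions_def by (simp only: subseq_rev_iff set_rev)

text \<open>
  The greedy scan is still waiting for \<open>Suc g\<close> at the end, so that none can occur after the place
  where it found \<open>g\<close>. This is the form in which the SIP can be applied to the last found index.
\<close>

lemma run_zero_split:
  assumes "run 0 xs = Suc g"
  shows "\<exists>ys zs. xs = ys @ g # zs \<and> Suc g \<notin> set zs"
  using assms
proof (induction xs rule: rev_induct)
  case (snoc x xs)
  show ?case
  proof (cases "x = run 0 xs")
    case True
    then have "xs @ [x] = xs @ g # [] \<and> Suc g \<notin> set []" using snoc.prems by (simp add: run_append)
    then show ?thesis by blast
  next
    case False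
    with snoc obtain ys zs where "xs = ys @ g # zs" "Suc g \<notin> set zs" "x \<noteq> Suc g"
      by (auto simp: run_append)
    then have "xs @ [x] = ys @ g # (zs @ [x]) \<and> Suc g \<notin> set (zs @ [x])" by simp
    then show ?thesis by blast
  qed
qed simp

lemma occurs_before_iff:
  "occurs_before x y xs \<longleftrightarrow> (\<exists>ps qs rs. xs = ps @ x # qs @ y # rs)"
proof
  assume "occurs_before x y xs"
  then obtain a b where ab: "a < b" "b < length xs" "xs ! a = x" "xs ! b = y"
    unfolding occurs_before_def by blast
  have "xs = take a xs @ x # drop (Suc a) xs"
    using ab id_take_nth_drop[of a xs] by auto
  moreover have "y \<in> set (drop (Suc a) xs)"
    unfolding in_set_conv_nth using ab by (intro exI[of _ "b - Suc a"]) auto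
  ultimately show "\<exists>ps qs rs. xs = ps @ x # qs @ y # rs"
    by (metis split_list)
next
  assume "\<exists>ps qs rs. xs = ps @ x # qs @ y # rs"
  then obtain ps qs rs where xs: "xs = ps @ x # qs @ y # rs" by blast
  show "occurs_before x y xs" unfolding occurs_before_def xs
    by (intro exI[of _ "length ps"] exI[of _ "Suc (length ps + length qs)"])
      (auto simp: nth_append nth_Cons split: nat.split)
qed

lemma occurs_before_rev: "occurs_before x y (rev xs) \<longleftrightarrow> occurs_before y x xs"
proof -
  have "occurs_before y x (rev zs)" if "occurs_before x y zs" for x y and zs :: "nat list"
    using that unfolding occurs_before_iff by fastforce
  from this[of x y "rev xs"] this[of y x xs] show ?thesis by auto
qed

lemma total_inversions_rev: "total_inversions m (rev xs) = total_consecutions m xs"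
  unfolding total_inversions_def total_consecutions_def occurs_before_rev ..

lemma occurs_before_total:
  assumes "x \<in> set xs" "y \<in> set xs" "x \<noteq> y" "\<not> occurs_before x y xs"
  shows "occurs_before y x xs"
proof -
  obtain ps qs where xs: "xs = ps @ x # qs" using assms by (meson split_list)
  have "y \<notin> set qs"
  proof
    assume "y \<in> set qs"
    then obtain us vs where "qs = us @ y # vs" by (meson split_list)
    with xs assms(4) show False unfolding occurs_before_iff by blast
  qed
  then have "y \<in> set ps" using assms xs by auto
  then obtain us vs where "ps = us @ y # vs" by (meson split_list)
  with xs have "xs = us @ y # vs @ x # qs" by simp
  then show ?thesis unfolding occurs_before_iff by blast
qed

lemma occurs_before_upto_run:
  assumes "Suc j < run 0 xs"
  shows "occurs_before j (Suc j) xs"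
proof -
  have "subseq [0..<Suc (Suc j)] xs" using assms by (subst subseq_upt_iff_le_run) auto
  moreover have "[0..<Suc (Suc j)] = [0..<j] @ [j, Suc j]" by simp
  ultimately have "subseq ([0..<j] @ [j, Suc j]) xs" by simp
  then obtain us vs where "xs = us @ vs" and "subseq [j, Suc j] vs"
    by (auto dest: list_emb_appendD)
  then obtain ps zs where xs: "xs = us @ ps @ j # zs" and "subseq [Suc j] zs"
    by (auto dest: list_emb_ConsD)
  then obtain qs rs where "zs = qs @ Suc j # rs"
    by (metis split_list subseq_singleton_left)
  with xs show ?thesis
    unfolding occurs_before_iff by (metis append.assoc)
qed

lemma not_occurs_before_run:
  assumes "distinct xs" "run 0 xs = Suc g"
  shows "\<not> occurs_before g (Suc g) xs"
proof
  assume "occurs_before g (Suc g) xs"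
  then obtain ps qs rs where 1: "xs = ps @ g # qs @ Suc g # rs" unfolding occurs_before_iff by blast
  obtain ys zs where 2: "xs = ys @ g # zs" "Suc g \<notin> set zs"
    using run_zero_split[OF assms(2)] by blast
  have "zs = qs @ Suc g # rs" using 1 2(1) assms(1)
    by (auto simp: append_eq_append_conv2 append_eq_Cons_conv Cons_eq_append_conv)
  with 2 show False by simp
qed

lemma sip_between:
  assumes "sip (ps @ x # qs @ x # rs)"
  shows "Suc x \<in> set qs"
proof -
  let ?l = "length ps" and ?xs = "ps @ x # qs @ x # rs"
  have "?l < Suc (?l + length qs)" "Suc (?l + length qs) < length ?xs"
    "?xs ! ?l = ?xs ! Suc (?l + length qs)"
    by (auto simp: nth_append nth_Cons split: nat.split)
  then obtain c where c: "?l < c" "c < Suc (?l + length qs)" "?xs ! c = ?xs ! ?l + 1"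
    using assms unfolding sip_def by blast
  then obtain d where d: "c = ?l + Suc d" using less_iff_Suc_add by auto
  then have "?xs ! c = qs ! d" "d < length qs"
    using c(2) by (auto simp: nth_append)
  then show ?thesis using c by (auto simp: in_set_conv_nth nth_append)
qed

text \<open>The SIP only says that something lies between two positions, a symmetric condition.\<close>

lemma sip_rev: "sip (rev xs) \<longleftrightarrow> sip xs"
proof -
  have "sip (rev ys)" if ys: "sip ys" for ys
    unfolding sip_def
  proof (intro allI impI, elim conjE)
    fix a b assume ab: "a < b" "b < length (rev ys)" "rev ys ! a = rev ys ! b"
    let ?r = "\<lambda>i. length ys - Suc i"
    have "?r b < ?r a" "?r a < length ys" "ys ! ?r b = ys ! ?r a"
      using ab by (auto simp: rev_nth)
    then obtain c where "?r b < c" "c < ?r a" "ys ! c = ys ! ?r b + 1"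
      using ys unfolding sip_def by blast
    then show "\<exists>c. a < c \<and> c < b \<and> rev ys ! c = rev ys ! a + 1"
      using ab by (intro exI[of _ "?r c"]) (auto simp: rev_nth)
  qed
  from this[of xs] this[of "rev xs"] show ?thesis by auto
qed

lemma sip_neg_rev: "sip_neg m (rev xs) \<longleftrightarrow> sip_neg m xs"
  unfolding sip_neg_def rev_map[symmetric] sip_rev ..

section \<open>Chains of elementary factors\<close>

text \<open>
  The action of $M_i$ on the family of blocks of a vector: blocks \<open>i\<close> and \<open>i - 1\<close> are combined
  into the new block \<open>i\<close>, and the old block \<open>i\<close> moves down. The value \<open>z\<close> stands for the missing
  block below block \<open>0\<close>. How blocks are combined does not matter for the order in which the
  factors pass them on, hence the arbitrary functions \<open>f i\<close>.
\<close>

definition factor_step :: "'v \<Rightarrow> (nat \<Rightarrow> 'v \<Rightarrow> 'v \<Rightarrow> 'v) \<Rightarrow> nat \<Rightarrow> (nat \<Rightarrow> 'v) \<Rightarrow> nat \<Rightarrow> 'v" where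
  "factor_step z f i u =
     (if i = 0 then u(0 := f 0 (u 0) z) else u(i := f i (u i) (u (i - 1)), i - 1 := u i))"

lemma factor_step_other: "k \<noteq> i \<Longrightarrow> Suc k \<noteq> i \<Longrightarrow> factor_step z f i u k = u k"
  by (auto simp: factor_step_def)

lemma factor_step_below: "factor_step z f (Suc k) u k = u (Suc k)"
  by (auto simp: factor_step_def)

lemma factor_step_same: "factor_step z f i u i = f i (u i) (if i = 0 then z else u (i - 1))"
  by (auto simp: factor_step_def)

lemma foldr_factor_step_other:
  "k \<notin> set xs \<Longrightarrow> Suc k \<notin> set xs \<Longrightarrow> foldr (factor_step z f) xs u k = u k"
  by (induction xs) (auto simp: factor_step_other)

text \<open>
  The local description of \<open>w = foldr (factor_step z f) \<alpha> u\<close> in which \<open>a i\<close> and \<open>b i\<close> are the two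
  values that the factor with index \<open>i\<close> receives. Block \<open>i\<close> is touched by the factors \<open>i\<close> and
  \<open>Suc i\<close> only, so that their relative order decides which of them sees the initial value \<open>u i\<close>
  and which one leaves the final value \<open>w i\<close>.
\<close>

definition flow :: "'v \<Rightarrow> (nat \<Rightarrow> 'v \<Rightarrow> 'v \<Rightarrow> 'v) \<Rightarrow> nat \<Rightarrow> nat list \<Rightarrow>
    (nat \<Rightarrow> 'v) \<Rightarrow> (nat \<Rightarrow> 'v) \<Rightarrow> (nat \<Rightarrow> 'v) \<Rightarrow> (nat \<Rightarrow> 'v) \<Rightarrow> bool" where
  "flow z f m \<alpha> a b u w \<longleftrightarrow>
     b 0 = z \<and>
     (\<forall>i. Suc i < m \<longrightarrow>
        (if occurs_before i (Suc i) \<alpha>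
         then a i = a (Suc i) \<and> b (Suc i) = u i \<and> w i = f i (a i) (b i)
         else a i = u i \<and> b (Suc i) = f i (a i) (b i) \<and> w i = a (Suc i))) \<and>
     a (m - 1) = u (m - 1) \<and> w (m - 1) = f (m - 1) (a (m - 1)) (b (m - 1))"

text \<open>
  The inputs of the factor \<open>i\<close> are read off the state that the factors to its right have produced
  (\<open>foldr\<close> applies the last factor first); factors other than \<open>i\<close> and \<open>Suc i\<close> leave block \<open>i\<close>
  alone.
\<close>

lemma flow_exists:
  fixes \<alpha> :: "nat list" and u :: "nat \<Rightarrow> 'v"
  assumes dist: "distinct \<alpha>" and set: "set \<alpha> = {..<m}" and "0 < m"
  shows "\<exists>a b. flow z f m \<alpha> a b u (foldr (factor_step z f) \<alpha> u)"
proof -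
  let ?F = "foldr (factor_step z f)"
  define after where "after i = tl (dropWhile (\<lambda>x. x \<noteq> i) \<alpha>)" for i
  have after: "after i = ys" if "\<alpha> = xs @ i # ys" for i xs ys
  proof -
    have "dropWhile (\<lambda>x. x \<noteq> i) xs = []" using that dist by auto
    then show ?thesis by (simp add: after_def that)
  qed
  define a where "a i = ?F (after i) u i" for i
  define b where "b i = (if i = 0 then z else ?F (after i) u (i - 1))" for i
  have step: "?F (i # after i) u i = f i (a i) (b i)" for i
    by (simp add: factor_step_same a_def b_def)
  have "flow z f m \<alpha> a b u (?F \<alpha> u)"
    unfolding flow_def
  proof (intro conjI allI impI)
    show "b 0 = z" by (simp add: b_def)
  next
    fix i assume i: "Suc i < m"
    show "if occurs_before i (Suc i) \<alpha>
      then a i = a (Suc i) \<and> b (Suc i) = u i \<and> ?F \<alpha> u i = f i (a i) (b i)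
      else a i = u i \<and> b (Suc i) = f i (a i) (b i) \<and> ?F \<alpha> u i = a (Suc i)"
    proof (cases "occurs_before i (Suc i) \<alpha>")
      case True
      then obtain ps qs rs where \<alpha>: "\<alpha> = ps @ i # qs @ Suc i # rs"
        unfolding occurs_before_iff by blast
      have af: "after i = qs @ Suc i # rs" "after (Suc i) = rs"
        using after[of ps i] after[of "ps @ i # qs" "Suc i"] \<alpha> by auto
      have "b (Suc i) = u i"
        using dist \<alpha> by (auto simp: b_def af intro!: foldr_factor_step_other)
      moreover have "a i = a (Suc i)"
      proof -
        have "a i = ?F qs (?F (Suc i # rs) u) i" by (simp add: a_def af)
        also have "\<dots> = ?F (Suc i # rs) u i"
          using dist \<alpha> by (intro foldr_factor_step_other) auto
        finally show ?thesis by (simp add: factor_step_below a_def af)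
      qed
      moreover have "?F \<alpha> u i = f i (a i) (b i)"
      proof -
        have "?F \<alpha> u i = ?F ps (?F (i # after i) u) i" by (simp add: \<alpha> af)
        also have "\<dots> = ?F (i # after i) u i"
          using dist \<alpha> by (intro foldr_factor_step_other) auto
        finally show ?thesis by (simp only: step)
      qed
      ultimately show ?thesis using True by simp
    next
      case False
      then have "occurs_before (Suc i) i \<alpha>"
        using i set by (intro occurs_before_total) auto
      then obtain ps qs rs where \<alpha>: "\<alpha> = ps @ Suc i # qs @ i # rs"
        unfolding occurs_before_iff by blast
      have af: "after (Suc i) = qs @ i # rs" "after i = rs"
        using after[of ps "Suc i"] after[of "ps @ Suc i # qs" i] \<alpha> by auto
      have "a i = u i"
        using dist \<alpha> by (auto simp: a_def af intro!: foldr_factor_step_other)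
      moreover have "b (Suc i) = f i (a i) (b i)"
      proof -
        have "b (Suc i) = ?F qs (?F (i # after i) u) i" by (simp add: b_def af)
        also have "\<dots> = ?F (i # after i) u i"
          using dist \<alpha> by (intro foldr_factor_step_other) auto
        finally show ?thesis by (simp only: step)
      qed
      moreover have "?F \<alpha> u i = a (Suc i)"
      proof -
        have "?F \<alpha> u i = ?F ps (?F (Suc i # after (Suc i)) u) i" by (simp add: \<alpha> af)
        also have "\<dots> = ?F (Suc i # after (Suc i)) u i"
          using dist \<alpha> by (intro foldr_factor_step_other) auto
        finally show ?thesis by (simp add: factor_step_below a_def)
      qed
      ultimately show ?thesis using False by simp
    qed
  next
    have "m - 1 \<in> set \<alpha>" using set \<open>0 < m\<close> by simp
    then obtain ps qs where \<alpha>: "\<alpha> = ps @ (m - 1) # qs" by (meson split_list)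
    have m: "m \<notin> set \<alpha>" using set by simp
    have af: "after (m - 1) = qs" by (rule after[OF \<alpha>])
    show "a (m - 1) = u (m - 1)"
      unfolding a_def af using dist \<alpha> m \<open>0 < m\<close> by (intro foldr_factor_step_other) auto
    have "?F \<alpha> u (m - 1) = ?F ps (?F ((m - 1) # after (m - 1)) u) (m - 1)"
      unfolding af by (simp add: \<alpha>)
    also have "\<dots> = ?F ((m - 1) # after (m - 1)) u (m - 1)"
      using dist \<alpha> m \<open>0 < m\<close> by (intro foldr_factor_step_other) auto
    finally show "?F \<alpha> u (m - 1) = f (m - 1) (a (m - 1)) (b (m - 1))" by (simp only: step)
  qed
  then show ?thesis by blast
qed

text \<open>
  The local conditions determine everything from \<open>u\<close>: first \<open>a\<close> from the top downwards, then
  \<open>b\<close> from the bottom upwards. Guessing \<open>a\<close> and \<open>b\<close> is therefore enough to compute the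
  product, which is how null vectors are verified below.
\<close>

lemma flow_unique:
  assumes 1: "flow z f m \<alpha> a b u w" and 2: "flow z f m \<alpha> a' b' u w'" and "k < m"
  shows "w k = w' k"
proof -
  have a: "a i = a' i" if "i < m" for i
  proof -
    have "i \<le> m - 1" using that by simp
    then show ?thesis
    proof (induction rule: inc_induct)
      case base
      then show ?case using 1 2 by (simp add: flow_def)
    next
      case (step i)
      then have "Suc i < m" by simp
      with 1 2 step.IH show ?case unfolding flow_def by metis
    qed
  qed
  have b: "b i = b' i" if "i < m" for i
    using that
  proof (induction i)
    case 0
    then show ?case using 1 2 by (simp add: flow_def)
  next
    case (Suc i)
    then show ?case using 1 2 a[of i] unfolding flow_def by (metis Suc_lessD)
  qed
  show ?thesis
  proof (cases "Suc k < m")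
    case True
    then show ?thesis using 1 2 a[of k] a[of "Suc k"] b[of k] \<open>k < m\<close> unfolding flow_def by metis
  next
    case False
    then have "k = m - 1" using \<open>k < m\<close> by simp
    then show ?thesis using 1 2 a[of k] b[of k] \<open>k < m\<close> unfolding flow_def by metis
  qed
qed

section \<open>Elementary matrices acting on blocks\<close>

text \<open>
  Block \<open>k\<close> of a vector counted from the bottom, so that $M_i$ and $M_{-i}$ act on the blocks \<open>i\<close>
  and \<open>i - 1\<close>. With zero blocks outside the range, a statement about all blocks becomes an
  equation between functions.
\<close>

definition blocks :: "nat \<Rightarrow> nat \<Rightarrow> 'a::zero vec \<Rightarrow> nat \<Rightarrow> 'a vec" where
  "blocks m n v k = (if k < m then vec n (\<lambda>r. v $ ((m - Suc k) * n + r)) else 0\<^sub>v n)"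

definition unblocks :: "nat \<Rightarrow> nat \<Rightarrow> (nat \<Rightarrow> 'a vec) \<Rightarrow> 'a vec" where
  "unblocks m n u = vec (m * n) (\<lambda>i. u (m - Suc (i div n)) $ (i mod n))"

lemma blocks_carrier[simp]: "blocks m n v k \<in> carrier_vec n"
  by (simp add: blocks_def)

lemma dim_blocks[simp]: "dim_vec (blocks m n v k) = n"
  by (simp add: blocks_def)

lemma unblocks_carrier[simp]: "unblocks m n u \<in> carrier_vec (m * n)"
  by (simp add: unblocks_def)

lemma block_index_less: "k < m \<Longrightarrow> r < n \<Longrightarrow> (m - Suc k) * n + r < m * (n::nat)"
proof -
  assume "k < m" "r < n"
  then have "(m - Suc k) * n + r < (m - Suc k) * n + n" by simp
  also have "\<dots> = (m - k) * n" using \<open>k < m\<close> by (simp add: Suc_diff_Suc[symmetric] add.commute)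
  also have "\<dots> \<le> m * n" by simp
  finally show ?thesis .
qed

lemma blocks_unblocks:
  assumes "k < m" "u k \<in> carrier_vec n"
  shows "blocks m n (unblocks m n u) k = u k"
proof (rule eq_vecI)
  fix r assume "r < dim_vec (u k)"
  then show "blocks m n (unblocks m n u) k $ r = u k $ r"
    using assms block_index_less[of k m r n] by (simp add: blocks_def unblocks_def)
qed (use assms in \<open>simp add: blocks_def\<close>)

lemma blocks_eqI:
  assumes v: "v \<in> carrier_vec (m * n)" and w: "w \<in> carrier_vec (m * n)"
    and eq: "\<And>k. k < m \<Longrightarrow> blocks m n v k = blocks m n w k"
  shows "v = w"
proof (rule eq_vecI)
  fix i assume "i < dim_vec w"
  then have i: "i < m * n" using w by simp
  then have "0 < n" by (cases n) auto
  have q: "i div n < m" using i by (simp add: less_mult_imp_div_less)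
  then have "v $ ((m - Suc (m - Suc (i div n))) * n + i mod n)
      = w $ ((m - Suc (m - Suc (i div n))) * n + i mod n)"
    using arg_cong[OF eq[of "m - Suc (i div n)"], of "\<lambda>x. x $ (i mod n)"] \<open>0 < n\<close>
    by (simp add: blocks_def)
  moreover have "m - Suc (m - Suc (i div n)) = i div n" using q by simp
  ultimately show "v $ i = w $ i" by simp
qed (use assms in simp)

lemma blocks_smult:
  "v \<in> carrier_vec (m * n) \<Longrightarrow> k < m \<Longrightarrow> blocks m n (c \<cdot>\<^sub>v v) k = c \<cdot>\<^sub>v blocks m n v k"
  for v :: "'a::mult_zero vec"
  by (rule eq_vecI) (auto simp: blocks_def block_index_less)

lemma index_append_four:
  assumes "dim_vec x = a" "dim_vec y = n" "dim_vec y' = n" "j < a + (n + n + dim_vec z)"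
  shows "(x @\<^sub>v (y @\<^sub>v y') @\<^sub>v z) $ j =
    (if j < a then x $ j else if j < a + n then y $ (j - a)
     else if j < a + n + n then y' $ (j - (a + n)) else z $ (j - (a + n + n)))"
  using assms by (auto simp: append_vec_def Let_def add.assoc)

lemma block_arith:
  fixes m n i :: nat
  assumes "0 < i" "i < m"
  shows "(m - Suc (i - 1)) * n = (m - i - 1) * n + n"
    and "(m - i + 1) * n = (m - i - 1) * n + n + n"
    and "m * n = (m - i - 1) * n + (n + n + (i - 1) * n)"
proof -
  obtain e d where "i = Suc e" "m = Suc (i + d)"
    using assms by (metis less_iff_Suc_add gr0_conv_Suc)
  then show "(m - Suc (i - 1)) * n = (m - i - 1) * n + n"
    and "(m - i + 1) * n = (m - i - 1) * n + n + n"
    and "m * n = (m - i - 1) * n + (n + n + (i - 1) * n)"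
    by (simp_all add: algebra_simps Suc_diff_le)
qed

text \<open>
  The vector is cut to fit the diagonal blocks of $M_{\pm i}$. The outer pieces are written as
  sections of \<open>v\<close>, which lets \<open>block_of_four\<close> recognise the unchanged blocks after the two middle
  ones have been replaced.
\<close>

lemma split_four:
  assumes v: "v \<in> carrier_vec (m * n)" and i: "0 < i" "i < m"
  shows "v = vec ((m - i - 1) * n) (\<lambda>j. v $ j) @\<^sub>v (blocks m n v i @\<^sub>v blocks m n v (i - 1)) @\<^sub>v
           vec ((i - 1) * n) (\<lambda>j. v $ ((m - i + 1) * n + j))"
    (is "v = ?x @\<^sub>v (?y @\<^sub>v ?y') @\<^sub>v ?z")
proof (rule eq_vecI)
  note ar = block_arith[OF i]
  show "dim_vec v = dim_vec (?x @\<^sub>v (?y @\<^sub>v ?y') @\<^sub>v ?z)" using v ar(3) by (simp add: blocks_def)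
  fix j assume "j < dim_vec (?x @\<^sub>v (?y @\<^sub>v ?y') @\<^sub>v ?z)"
  moreover have d: "dim_vec ?x = (m - i - 1) * n" "dim_vec ?y = n" "dim_vec ?y' = n"
    "dim_vec ?z = (i - 1) * n"
    by simp_all
  ultimately have j: "j < (m - i - 1) * n + (n + n + (i - 1) * n)" by simp
  have "i - 1 < m" using i by simp
  have "(?x @\<^sub>v (?y @\<^sub>v ?y') @\<^sub>v ?z) $ j =
    (if j < (m - i - 1) * n then ?x $ j
     else if j < (m - i - 1) * n + n then ?y $ (j - (m - i - 1) * n)
     else if j < (m - i - 1) * n + n + n then ?y' $ (j - ((m - i - 1) * n + n))
     else ?z $ (j - ((m - i - 1) * n + n + n)))"
    using j by (intro index_append_four) (simp_all only: d)
  also have "\<dots> = v $ j"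
    using j i \<open>i - 1 < m\<close> unfolding blocks_def ar(1,2) by auto
  finally show "v $ j = (?x @\<^sub>v (?y @\<^sub>v ?y') @\<^sub>v ?z) $ j" ..
qed

lemma block_of_four:
  assumes i: "0 < i" "i < m" and k: "k < m" and v: "v \<in> carrier_vec (m * n)"
    and y: "y \<in> carrier_vec n" "y' \<in> carrier_vec n"
  shows "blocks m n (vec ((m - i - 1) * n) (\<lambda>j. v $ j) @\<^sub>v (y @\<^sub>v y') @\<^sub>v
           vec ((i - 1) * n) (\<lambda>j. v $ ((m - i + 1) * n + j))) k
         = (if k = i then y else if k = i - 1 then y' else blocks m n v k)"
    (is "blocks m n (?x @\<^sub>v _ @\<^sub>v ?z) k = ?r")
proof (rule eq_vecI)
  show "dim_vec (blocks m n (?x @\<^sub>v (y @\<^sub>v y') @\<^sub>v ?z) k) = dim_vec ?r"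
    using y by (simp add: blocks_def)
  fix r assume "r < dim_vec ?r"
  then have r: "r < n" using y by (simp add: blocks_def split: if_splits)
  note ar = block_arith[OF i]
  have d: "dim_vec ?x = (m - i - 1) * n" "dim_vec y = n" "dim_vec y' = n"
    "dim_vec ?z = (i - 1) * n"
    using y by auto
  have lt: "(m - Suc k) * n + r < m * n" by (rule block_index_less[OF k r])
  have "blocks m n (?x @\<^sub>v (y @\<^sub>v y') @\<^sub>v ?z) k $ r
      = (?x @\<^sub>v (y @\<^sub>v y') @\<^sub>v ?z) $ ((m - Suc k) * n + r)" (is "_ = _ $ ?j")
    using k r by (simp add: blocks_def)
  also have "\<dots> =
    (if ?j < (m - i - 1) * n then ?x $ ?j
     else if ?j < (m - i - 1) * n + n then y $ (?j - (m - i - 1) * n)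
     else if ?j < (m - i - 1) * n + n + n then y' $ (?j - ((m - i - 1) * n + n))
     else ?z $ (?j - ((m - i - 1) * n + n + n)))"
    using lt unfolding ar(3) by (intro index_append_four) (simp_all only: d)
  also have "\<dots> = ?r $ r"
  proof -
    consider "k = i" | "k = i - 1" | "i < k" | "Suc k < i" by linarith
    then show ?thesis
    proof cases
      case 1
      then show ?thesis using r by simp
    next
      case 2
      then have "k \<noteq> i" using i by auto
      then show ?thesis using r ar(1) unfolding 2 by simp
    next
      case 3
      have "(m - Suc k) * n + n \<le> (m - i - 1) * n"
      proof -
        have "Suc (m - Suc k) \<le> m - i - 1" using 3 k by simp
        then have "Suc (m - Suc k) * n \<le> (m - i - 1) * n" by (rule mult_le_mono1)
        then show ?thesis by simp
      qed
      then have "?j < (m - i - 1) * n" using r by linarith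
      then show ?thesis using r 3 k by (auto simp: blocks_def)
    next
      case 4
      have ge: "(m - i - 1) * n + n + n \<le> (m - Suc k) * n"
        unfolding ar(2)[symmetric] using 4 i by (intro mult_le_mono1) simp
      have "?j - ((m - i - 1) * n + n + n) < (i - 1) * n"
        using lt ge unfolding ar(3) by linarith
      then show ?thesis using r 4 k ge unfolding ar(2) by (auto simp: blocks_def)
    qed
  qed
  finally show "blocks m n (?x @\<^sub>v (y @\<^sub>v y') @\<^sub>v ?z) k $ r = ?r $ r" .
qed

lemma split_last:
  assumes v: "v \<in> carrier_vec (m * n)" and m: "0 < m"
  shows "v = vec ((m - 1) * n) (\<lambda>j. v $ j) @\<^sub>v blocks m n v 0"
proof -
  have "m * n = (m - 1) * n + n" using m by (cases m) auto
  then show ?thesis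
    using v m by (intro eq_vecI) (auto simp: append_vec_def Let_def blocks_def)
qed

lemma block_of_last:
  assumes v: "v \<in> carrier_vec (m * n)" and y: "y \<in> carrier_vec n" and k: "k < m"
  shows "blocks m n (vec ((m - 1) * n) (\<lambda>j. v $ j) @\<^sub>v y) k = (if k = 0 then y else blocks m n v k)"
proof (rule eq_vecI)
  fix r assume "r < dim_vec (if k = 0 then y else blocks m n v k)"
  then have r: "r < n" using y by (simp split: if_splits)
  have "m * n = (m - 1) * n + n" using k by (cases m) auto
  moreover have "(m - Suc k) * n + r < (m - 1) * n" if "k \<noteq> 0"
    using block_index_less[of "k - 1" "m - 1" r n] that k r by simp
  ultimately show "blocks m n (vec ((m - 1) * n) (\<lambda>j. v $ j) @\<^sub>v y) k $ r
      = (if k = 0 then y else blocks m n v k) $ r"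
    using r k y by (auto simp: append_vec_def Let_def blocks_def)
qed (use y in simp)

lemma split_first:
  assumes v: "v \<in> carrier_vec (m * n)" and m: "0 < m"
  shows "v = blocks m n v (m - 1) @\<^sub>v vec ((m - 1) * n) (\<lambda>j. v $ (n + j))"
proof -
  have "m * n = n + (m - 1) * n" using m by (cases m) auto
  then show ?thesis
    using v m by (intro eq_vecI) (auto simp: append_vec_def Let_def blocks_def)
qed

lemma block_of_first:
  assumes v: "v \<in> carrier_vec (m * n)" and y: "y \<in> carrier_vec n" and k: "k < m"
  shows "blocks m n (y @\<^sub>v vec ((m - 1) * n) (\<lambda>j. v $ (n + j))) k
    = (if k = m - 1 then y else blocks m n v k)"
proof (rule eq_vecI)
  fix r assume "r < dim_vec (if k = m - 1 then y else blocks m n v k)"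
  then have r: "r < n" using y by (simp split: if_splits)
  have mn: "m * n = n + (m - 1) * n" using k by (cases m) auto
  show "blocks m n (y @\<^sub>v vec ((m - 1) * n) (\<lambda>j. v $ (n + j))) k $ r
      = (if k = m - 1 then y else blocks m n v k) $ r"
  proof (cases "k = m - 1")
    case True
    then show ?thesis using r k y by (auto simp: append_vec_def Let_def blocks_def)
  next
    case False
    then have "1 \<le> m - Suc k" using k by simp
    then have "1 * n \<le> (m - Suc k) * n" by (rule mult_le_mono1)
    then have "\<not> (m - Suc k) * n + r < n" by linarith
    then show ?thesis
      using False r k y mn block_index_less[OF k r]
      by (auto simp: append_vec_def Let_def blocks_def)
  qed
qed (use y in simp)

text \<open>
  The literal unfolding of \<open>diag_block_mat\<close> ends in an empty matrix; these forms avoid it.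
\<close>

lemma diag_two: "A \<in> carrier_mat a a \<Longrightarrow> B \<in> carrier_mat b b \<Longrightarrow>
    diag_block_mat [A, B] = four_block_mat A (0\<^sub>m a b) (0\<^sub>m b a) B" for A B :: "'a::zero mat"
  by (simp only: diag_block_mat.simps(2)[of A "[B]"] diag_block_mat_singleton Let_def) auto

lemma diag_two_carrier: "A \<in> carrier_mat a a \<Longrightarrow> B \<in> carrier_mat b b \<Longrightarrow>
    diag_block_mat [A, B] \<in> carrier_mat (a + b) (a + b)" for A B :: "'a::zero mat"
  by (simp only: diag_two) auto

lemma diag_three: "A \<in> carrier_mat a a \<Longrightarrow> B \<in> carrier_mat b b \<Longrightarrow> C \<in> carrier_mat c c \<Longrightarrow>
    diag_block_mat [A, B, C]
      = four_block_mat A (0\<^sub>m a (b + c)) (0\<^sub>m (b + c) a) (diag_block_mat [B, C])"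
  for A B C :: "'a::zero mat"
  using diag_two_carrier[of B b C c]
  by (simp only: diag_block_mat.simps(2)[of A "[B, C]"] Let_def) auto

lemma diag_two_mult_append:
  fixes A B :: "'a::comm_ring_1 mat"
  assumes "A \<in> carrier_mat a a" "B \<in> carrier_mat b b" "x \<in> carrier_vec a" "y \<in> carrier_vec b"
  shows "diag_block_mat [A, B] *\<^sub>v (x @\<^sub>v y) = (A *\<^sub>v x) @\<^sub>v (B *\<^sub>v y)"
  using mult_mat_vec_split[of A a B b x y] assms by (simp only: diag_two)

lemma diag_three_mult_append:
  fixes A B C :: "'a::comm_ring_1 mat"
  assumes "A \<in> carrier_mat a a" "B \<in> carrier_mat b b" "C \<in> carrier_mat c c"
    "x \<in> carrier_vec a" "y \<in> carrier_vec b" "z \<in> carrier_vec c"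
  shows "diag_block_mat [A, B, C] *\<^sub>v (x @\<^sub>v y @\<^sub>v z) = (A *\<^sub>v x) @\<^sub>v (B *\<^sub>v y) @\<^sub>v (C *\<^sub>v z)"
  using assms mult_mat_vec_split[of A a "diag_block_mat [B, C]" "b + c" x "y @\<^sub>v z"]
  by (simp only: diag_three[of A a B b C c] diag_two_mult_append[of B b C c] diag_two_carrier
      append_carrier_vec)

text \<open>
  Elementary matrices are complex but act on complex vectors as well as on polynomial ones.
  Carrying an entrywise map \<open>h\<close> along covers both; blockwise reasoning only needs that it
  preserves \<open>0\<close> and \<open>1\<close>.
\<close>

locale unital_map =
  fixes h :: "complex \<Rightarrow> 'a::comm_ring_1"
  assumes map_0: "h 0 = 0" and map_1: "h 1 = 1"
begin

lemma map_one_mat: "map_mat h (1\<^sub>m k) = 1\<^sub>m k"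
  by (rule eq_matI) (auto simp: map_0 map_1)

lemma map_zero_mat: "map_mat h (0\<^sub>m k l) = 0\<^sub>m k l"
  by (rule eq_matI) (auto simp: map_0)

lemma map_diag_two:
  assumes "A \<in> carrier_mat a a" "B \<in> carrier_mat b b"
  shows "map_mat h (diag_block_mat [A, B]) = diag_block_mat [map_mat h A, map_mat h B]"
  using assms by (simp only: diag_two[of A a B b] diag_two[of "map_mat h A" a "map_mat h B" b]
    map_carrier_mat map_four_block_mat[of A a a _ b _ b] zero_carrier_mat map_zero_mat)

lemma map_diag_three:
  assumes "A \<in> carrier_mat a a" "B \<in> carrier_mat b b" "C \<in> carrier_mat c c"
  shows "map_mat h (diag_block_mat [A, B, C]) = diag_block_mat [map_mat h A, map_mat h B, map_mat h C]"
  using assms diag_two_carrier[of B b C c]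
  by (simp only: diag_three[of A a B b C c] diag_three[of "map_mat h A" a "map_mat h B" b "map_mat h C" c]
    map_carrier_mat map_four_block_mat[of A a a _ "b + c" _ "b + c"] zero_carrier_mat map_zero_mat
    map_diag_two)

lemma middle_mult:
  fixes B11 B12 B21 B22 :: "complex mat"
  assumes v: "v \<in> carrier_vec (m * n)" and i: "0 < i" "i < m" and k: "k < m"
    and B: "B11 \<in> carrier_mat n n" "B12 \<in> carrier_mat n n" "B21 \<in> carrier_mat n n" "B22 \<in> carrier_mat n n"
  shows "blocks m n (map_mat h (diag_block_mat
           [1\<^sub>m ((m - i - 1) * n), four_block_mat B11 B12 B21 B22, 1\<^sub>m ((i - 1) * n)]) *\<^sub>v v) k
    = (if k = i then map_mat h B11 *\<^sub>v blocks m n v i + map_mat h B12 *\<^sub>v blocks m n v (i - 1)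
       else if k = i - 1 then map_mat h B21 *\<^sub>v blocks m n v i + map_mat h B22 *\<^sub>v blocks m n v (i - 1)
       else blocks m n v k)"
proof -
  let ?x = "vec ((m - i - 1) * n) (\<lambda>j. v $ j)" and ?y = "blocks m n v i"
    and ?y' = "blocks m n v (i - 1)" and ?z = "vec ((i - 1) * n) (\<lambda>j. v $ ((m - i + 1) * n + j))"
  let ?B = "four_block_mat (map_mat h B11) (map_mat h B12) (map_mat h B21) (map_mat h B22)"
  let ?D = "diag_block_mat [1\<^sub>m ((m - i - 1) * n), ?B, 1\<^sub>m ((i - 1) * n)]"
  let ?w = "map_mat h B11 *\<^sub>v ?y + map_mat h B12 *\<^sub>v ?y'"
    and ?w' = "map_mat h B21 *\<^sub>v ?y + map_mat h B22 *\<^sub>v ?y'"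
  have D: "map_mat h (diag_block_mat
      [1\<^sub>m ((m - i - 1) * n), four_block_mat B11 B12 B21 B22, 1\<^sub>m ((i - 1) * n)]) = ?D"
    unfolding map_diag_three[OF one_carrier_mat four_block_carrier_mat[OF B(1) B(4)] one_carrier_mat]
      map_one_mat map_four_block_mat[OF B] ..
  have Bc: "?B \<in> carrier_mat (n + n) (n + n)" using B by (intro four_block_carrier_mat) auto
  have "?D *\<^sub>v v = ?D *\<^sub>v (?x @\<^sub>v (?y @\<^sub>v ?y') @\<^sub>v ?z)"
    using split_four[OF v i] by simp
  also have "\<dots> = (1\<^sub>m ((m - i - 1) * n) *\<^sub>v ?x) @\<^sub>v (?B *\<^sub>v (?y @\<^sub>v ?y')) @\<^sub>v (1\<^sub>m ((i - 1) * n) *\<^sub>v ?z)"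
    using Bc by (intro diag_three_mult_append[where b = "n + n"]) auto
  also have "?B *\<^sub>v (?y @\<^sub>v ?y') = ?w @\<^sub>v ?w'"
    using B by (intro four_block_mat_mult_vec) auto
  finally have "?D *\<^sub>v v = ?x @\<^sub>v (?w @\<^sub>v ?w') @\<^sub>v ?z" by simp
  then show ?thesis
    unfolding D using B by (simp only:) (rule block_of_four[OF i k v]; auto)
qed

lemma blocks_elem_mat_mult:
  assumes X: "X \<in> carrier_mat n n" and v: "v \<in> carrier_vec (m * n)" and i: "i < m"
  shows "blocks m n (map_mat h (elem_mat m n i X) *\<^sub>v v)
    = factor_step (0\<^sub>v n) (\<lambda>_ a b. map_mat h X *\<^sub>v a + b) i (blocks m n v)"
proof (rule ext)
  fix k
  consider "m \<le> k" | "i = 0" "k < m" | "0 < i" "k < m" by linarith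
  then show "blocks m n (map_mat h (elem_mat m n i X) *\<^sub>v v) k
    = factor_step (0\<^sub>v n) (\<lambda>_ a b. map_mat h X *\<^sub>v a + b) i (blocks m n v) k"
  proof cases
    case 1
    then show ?thesis using i by (subst factor_step_other) (auto simp: blocks_def)
  next
    case 2
    let ?D = "diag_block_mat [1\<^sub>m ((m - 1) * n), map_mat h X]" and ?x = "vec ((m - 1) * n) (\<lambda>j. v $ j)"
    have D: "map_mat h (elem_mat m n i X) = ?D"
      unfolding elem_mat_def 2(1) if_P[OF refl] map_diag_two[OF one_carrier_mat X] map_one_mat ..
    have "?D *\<^sub>v v = ?D *\<^sub>v (?x @\<^sub>v blocks m n v 0)" using split_last[OF v] i by simp
    also have "\<dots> = ?x @\<^sub>v (map_mat h X *\<^sub>v blocks m n v 0)"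
      using X by (subst diag_two_mult_append[where a = "(m - 1) * n" and b = n]) auto
    finally show ?thesis
      unfolding D using X 2 by (simp only:) (subst block_of_last[OF v]; auto simp: factor_step_def)
  next
    case 3
    then have "elem_mat m n i X = diag_block_mat [1\<^sub>m ((m - i - 1) * n),
        four_block_mat X (1\<^sub>m n) (1\<^sub>m n) (0\<^sub>m n n), 1\<^sub>m ((i - 1) * n)]"
      by (simp add: elem_mat_def)
    then show ?thesis
      using X i v 3 by (simp only:) (subst middle_mult;
          auto simp: map_one_mat map_zero_mat factor_step_def)
  qed
qed

lemma blocks_elem_mat_neg_mult:
  assumes X: "X \<in> carrier_mat n n" and v: "v \<in> carrier_vec (m * n)" and i: "0 < i" "i \<le> m"
    and k: "k < m"
  shows "blocks m n (map_mat h (elem_mat_neg m n (Neg i) X) *\<^sub>v v) k =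
    (if i = m then if k = m - 1 then map_mat h X *\<^sub>v blocks m n v k else blocks m n v k
     else if k = i then blocks m n v (i - 1)
     else if k = i - 1 then blocks m n v i + map_mat h X *\<^sub>v blocks m n v (i - 1)
     else blocks m n v k)"
proof (cases "i = m")
  case True
  let ?D = "diag_block_mat [map_mat h X, 1\<^sub>m ((m - 1) * n)]"
    and ?z = "vec ((m - 1) * n) (\<lambda>j. v $ (n + j))"
  have D: "map_mat h (elem_mat_neg m n (Neg i) X) = ?D"
    unfolding elem_mat_neg.simps True if_P[OF refl] map_diag_two[OF X one_carrier_mat] map_one_mat ..
  have "?D *\<^sub>v v = ?D *\<^sub>v (blocks m n v (m - 1) @\<^sub>v ?z)" using split_first[OF v] i True by simp
  also have "\<dots> = (map_mat h X *\<^sub>v blocks m n v (m - 1)) @\<^sub>v ?z"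
    using X by (subst diag_two_mult_append[where b = "(m - 1) * n" and a = n]) auto
  finally show ?thesis
    unfolding D using X True k by (simp only:) (subst block_of_first[OF v]; auto)
next
  case False
  then have "i < m" using i by simp
  then show ?thesis using X v False k i(1)
    by (simp only: elem_mat_neg.simps if_False) (subst middle_mult;
        auto simp: map_one_mat map_zero_mat)
qed

end

section \<open>Invertible constant factors\<close>

interpretation complex_id: unital_map "\<lambda>x. x"
  by unfold_locales auto

interpretation const_poly: unital_map "\<lambda>a. [:a:]"
  by unfold_locales auto

interpretation const_hom: semiring_hom "\<lambda>a::complex. [:a:]"
  by unfold_locales auto

lemma map_mat_id: "map_mat (\<lambda>x. x) A = A"
  by (rule eq_matI) auto

lemma mat_eqI_mult_vec:
  fixes A B :: "'a::semiring_1 mat"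
  assumes A: "A \<in> carrier_mat k l" and B: "B \<in> carrier_mat k l"
    and eq: "\<And>v. v \<in> carrier_vec l \<Longrightarrow> A *\<^sub>v v = B *\<^sub>v v"
  shows "A = B"
proof (rule eq_matI)
  fix i j assume "i < dim_row B" "j < dim_col B"
  then have "i < k" "j < l" using B by auto
  then show "A $$ (i, j) = B $$ (i, j)"
    using arg_cong[OF eq[of "unit_vec l j"], of "\<lambda>v. v $ i"] A B by (simp add: scalar_prod_right_unit)
qed (use A B in auto)

definition gl_mat :: "nat \<Rightarrow> complex mat set" where
  "gl_mat N = {C \<in> carrier_mat N N. \<exists>D \<in> carrier_mat N N. C * D = 1\<^sub>m N \<and> D * C = 1\<^sub>m N}"

lemma gl_matI:
  "C \<in> carrier_mat N N \<Longrightarrow> D \<in> carrier_mat N N \<Longrightarrow> C * D = 1\<^sub>m N \<Longrightarrow> D * C = 1\<^sub>m N \<Longrightarrow> C \<in> gl_mat N"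
  unfolding gl_mat_def by blast

lemma gl_mat_carrier: "C \<in> gl_mat N \<Longrightarrow> C \<in> carrier_mat N N"
  by (simp add: gl_mat_def)

lemma one_gl_mat: "1\<^sub>m N \<in> gl_mat N"
  by (rule gl_matI[of _ _ "1\<^sub>m N"]) auto

lemma gl_mat_mult:
  assumes "C \<in> gl_mat N" "D \<in> gl_mat N"
  shows "C * D \<in> gl_mat N"
proof -
  obtain C' D' where C: "C \<in> carrier_mat N N" "C' \<in> carrier_mat N N" "C * C' = 1\<^sub>m N" "C' * C = 1\<^sub>m N"
    and D: "D \<in> carrier_mat N N" "D' \<in> carrier_mat N N" "D * D' = 1\<^sub>m N" "D' * D = 1\<^sub>m N"
    using assms unfolding gl_mat_def by blast
  have "(C * D) * (D' * C') = C * (D * (D' * C'))" by (rule assoc_mult_mat) (use C D in auto)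
  also have "D * (D' * C') = (D * D') * C'" by (rule assoc_mult_mat[symmetric]) (use C D in auto)
  finally have 1: "(C * D) * (D' * C') = 1\<^sub>m N" using C D by simp
  have "(D' * C') * (C * D) = D' * (C' * (C * D))" by (rule assoc_mult_mat) (use C D in auto)
  also have "C' * (C * D) = (C' * C) * D" by (rule assoc_mult_mat[symmetric]) (use C D in auto)
  finally have 2: "(D' * C') * (C * D) = 1\<^sub>m N" using C D by simp
  show ?thesis
    by (rule gl_matI[of _ _ "D' * C'", OF _ _ 1 2]) (use C D in auto)
qed

lemma mat_prod_carrier: "set Ms \<subseteq> carrier_mat N N \<Longrightarrow> mat_prod N Ms \<in> carrier_mat N N"
  by (induction Ms) (auto simp: mat_prod_def)

lemma mat_prod_Nil: "mat_prod N [] = 1\<^sub>m N"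
  and mat_prod_Cons: "mat_prod N (M # Ms) = M * mat_prod N Ms"
  by (simp_all add: mat_prod_def)

lemma mat_prod_append:
  assumes "set Ms \<subseteq> carrier_mat N N" "set Ns \<subseteq> carrier_mat N N"
  shows "mat_prod N (Ms @ Ns) = mat_prod N Ms * mat_prod N Ns"
  using assms(1)
proof (induction Ms)
  case Nil
  then show ?case using mat_prod_carrier[OF assms(2)] by (simp add: mat_prod_Nil)
next
  case (Cons M Ms)
  have "M * (mat_prod N Ms * mat_prod N Ns) = M * mat_prod N Ms * mat_prod N Ns"
    by (rule assoc_mult_mat[symmetric])
      (use Cons.prems mat_prod_carrier[OF assms(2)] mat_prod_carrier[of Ms N] in auto)
  then show ?case using Cons by (simp add: mat_prod_Cons)
qed

lemma mat_prod_gl: "set Ms \<subseteq> gl_mat N \<Longrightarrow> mat_prod N Ms \<in> gl_mat N"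
  by (induction Ms) (auto simp: mat_prod_Nil mat_prod_Cons gl_mat_mult one_gl_mat)

text \<open>
  From here on products of elementary matrices are handled through their action on blocks, for
  which the case distinction in the definition is only a hindrance.
\<close>

declare elem_mat_neg.simps [simp del]

lemma elem_mat_carrier:
  assumes "X \<in> carrier_mat n n" "i < m"
  shows "elem_mat m n i X \<in> carrier_mat (m * n) (m * n)"
proof (cases "i = 0")
  case True
  have "(m - 1) * n + n = m * n" using assms by (cases m) auto
  then show ?thesis
    using diag_two_carrier[OF one_carrier_mat[of "(m - 1) * n"] assms(1)] True
    unfolding elem_mat_def by (simp only: if_True refl simp_thms)
next
  case False
  have "diag_block_mat [four_block_mat X (1\<^sub>m n) (1\<^sub>m n) (0\<^sub>m n n), 1\<^sub>m ((i - 1) * n)]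
      \<in> carrier_mat (n + n + (i - 1) * n) (n + n + (i - 1) * n)"
    using assms(1) by (intro diag_two_carrier four_block_carrier_mat) auto
  moreover have "m * n = (m - i - 1) * n + (n + n + (i - 1) * n)"
    using False assms by (intro block_arith) auto
  ultimately show ?thesis
    using False unfolding elem_mat_def
    by (simp only: if_False diag_block_mat.simps(2)[of "1\<^sub>m _"] Let_def) auto
qed

lemma elem_mat_neg_carrier:
  assumes "X \<in> carrier_mat n n" "0 < i" "i \<le> m"
  shows "elem_mat_neg m n (Neg i) X \<in> carrier_mat (m * n) (m * n)"
proof (cases "i = m")
  case True
  have "n + (m - 1) * n = m * n" using assms by (cases m) auto
  then show ?thesis
    using diag_two_carrier[OF assms(1) one_carrier_mat[of "(m - 1) * n"]] True
    unfolding elem_mat_neg.simps by (simp only: if_True refl simp_thms)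
next
  case False
  have "diag_block_mat [four_block_mat (0\<^sub>m n n) (1\<^sub>m n) (1\<^sub>m n) X, 1\<^sub>m ((i - 1) * n)]
      \<in> carrier_mat (n + n + (i - 1) * n) (n + n + (i - 1) * n)"
    using assms(1) by (intro diag_two_carrier four_block_carrier_mat) auto
  moreover have "m * n = (m - i - 1) * n + (n + n + (i - 1) * n)"
    using False assms by (intro block_arith) auto
  ultimately show ?thesis
    using False unfolding elem_mat_neg.simps
    by (simp only: if_False diag_block_mat.simps(2)[of "1\<^sub>m _"] Let_def) auto
qed

lemma blocks_elem_mat_mult:
  assumes "X \<in> carrier_mat n n" "v \<in> carrier_vec (m * n)" "i < m"
  shows "blocks m n (elem_mat m n i X *\<^sub>v v)
    = factor_step (0\<^sub>v n) (\<lambda>_ a b. X *\<^sub>v a + b) i (blocks m n v)"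
  using complex_id.blocks_elem_mat_mult[OF assms] by (simp only: map_mat_id)

lemma blocks_elem_mat_neg_mult:
  assumes "X \<in> carrier_mat n n" "v \<in> carrier_vec (m * n)" "0 < i" "i \<le> m" "k < m"
  shows "blocks m n (elem_mat_neg m n (Neg i) X *\<^sub>v v) k =
    (if i = m then if k = m - 1 then X *\<^sub>v blocks m n v k else blocks m n v k
     else if k = i then blocks m n v (i - 1)
     else if k = i - 1 then blocks m n v i + X *\<^sub>v blocks m n v (i - 1)
     else blocks m n v k)"
  using complex_id.blocks_elem_mat_neg_mult[OF assms] by (simp only: map_mat_id)

lemma mult_idI:
  assumes "A \<in> carrier_mat (m * n) (m * n)" "B \<in> carrier_mat (m * n) (m * n)"
    and "\<And>v k. v \<in> carrier_vec (m * n) \<Longrightarrow> k < m \<Longrightarrow> blocks m n (A *\<^sub>v (B *\<^sub>v v)) k = blocks m n v k"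
  shows "A * B = (1\<^sub>m (m * n) :: complex mat)"
proof (rule mat_eqI_mult_vec)
  fix v :: "complex vec" assume v: "v \<in> carrier_vec (m * n)"
  have "A *\<^sub>v (B *\<^sub>v v) = v"
    by (rule blocks_eqI[of _ m n])
      (use assms(1,2) v assms(3)[OF v] in \<open>simp_all only: mult_mat_vec_carrier\<close>)
  then show "A * B *\<^sub>v v = 1\<^sub>m (m * n) *\<^sub>v v"
    using assoc_mult_mat_vec[OF assms(1,2) v] v by simp
qed (use assms(1,2) in auto)

text \<open>
  The outermost factors $M_0(X)$ and $M_{-m}(X)$ depend multiplicatively on \<open>X\<close>; the others are
  invertible whatever their parameter is.
\<close>

lemma elem_mat_mult_id:
  assumes X: "X \<in> carrier_mat n n" "X' \<in> carrier_mat n n" "X * X' = 1\<^sub>m n" and m: "0 < m"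
  shows "elem_mat m n 0 X * elem_mat m n 0 X' = 1\<^sub>m (m * n)"
    and "elem_mat_neg m n (Neg m) X * elem_mat_neg m n (Neg m) X' = 1\<^sub>m (m * n)"
proof -
  note c = elem_mat_carrier[OF X(1) m] elem_mat_carrier[OF X(2) m]
    elem_mat_neg_carrier[OF X(1) m order_refl] elem_mat_neg_carrier[OF X(2) m order_refl]
  have XX: "X *\<^sub>v (X' *\<^sub>v v) = v" if "v \<in> carrier_vec n" for v
    using that X by (simp flip: assoc_mult_mat_vec[of _ n n _ n])
  show "elem_mat m n 0 X * elem_mat m n 0 X' = 1\<^sub>m (m * n)"
  proof (rule mult_idI[OF c(1,2)])
    fix v :: "complex vec" and k assume v: "v \<in> carrier_vec (m * n)" and k: "k < m"
    show "blocks m n (elem_mat m n 0 X *\<^sub>v (elem_mat m n 0 X' *\<^sub>v v)) k = blocks m n v k"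
      unfolding blocks_elem_mat_mult[OF X(1) mult_mat_vec_carrier[OF c(2) v] m]
        blocks_elem_mat_mult[OF X(2) v m]
      using X by (simp add: factor_step_def XX)
  qed
  show "elem_mat_neg m n (Neg m) X * elem_mat_neg m n (Neg m) X' = 1\<^sub>m (m * n)"
  proof (rule mult_idI[OF c(3,4)])
    fix v :: "complex vec" and k assume v: "v \<in> carrier_vec (m * n)" and k: "k < m"
    show "blocks m n (elem_mat_neg m n (Neg m) X *\<^sub>v (elem_mat_neg m n (Neg m) X' *\<^sub>v v)) k
        = blocks m n v k"
      unfolding blocks_elem_mat_neg_mult[OF X(1) mult_mat_vec_carrier[OF c(4) v] m order_refl k]
        blocks_elem_mat_neg_mult[OF X(2) v m order_refl k]
      by (simp add: XX)
  qed
qed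

lemma uminus_mult_mat_vec:
  fixes X :: "'a::comm_ring_1 mat"
  assumes "X \<in> carrier_mat n n" "v \<in> carrier_vec n"
  shows "- X *\<^sub>v v = - (X *\<^sub>v v)"
  using assms by (intro eq_vecI) (auto simp: row_uminus)

lemma elem_mat_neg_inverse:
  assumes X: "X \<in> carrier_mat n n" and i: "0 < i" "i < m"
  shows "elem_mat m n i (- X) * elem_mat_neg m n (Neg i) X = 1\<^sub>m (m * n)"
    and "elem_mat_neg m n (Neg i) X * elem_mat m n i (- X) = 1\<^sub>m (m * n)"
proof -
  have X': "- X \<in> carrier_mat n n" using X by simp
  have i': "i \<le> m" "i \<noteq> m" "i - 1 < m" "i \<noteq> i - 1" using i by simp_all
  note c = elem_mat_carrier[OF X' i(2)] elem_mat_neg_carrier[OF X i(1) i'(1)]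
  have XX: "- (X *\<^sub>v v) + (w + X *\<^sub>v v) = w" "- (X *\<^sub>v v) + w + X *\<^sub>v v = w"
    if "v \<in> carrier_vec n" "w \<in> carrier_vec n" for v w
    using that X by (auto intro!: eq_vecI)
  show "elem_mat m n i (- X) * elem_mat_neg m n (Neg i) X = 1\<^sub>m (m * n)"
  proof (rule mult_idI[OF c])
    fix v :: "complex vec" and k assume v: "v \<in> carrier_vec (m * n)" and k: "k < m"
    note b = blocks_elem_mat_neg_mult[OF X v i(1) i'(1)]
    show "blocks m n (elem_mat m n i (- X) *\<^sub>v (elem_mat_neg m n (Neg i) X *\<^sub>v v)) k = blocks m n v k"
      unfolding blocks_elem_mat_mult[OF X' mult_mat_vec_carrier[OF c(2) v] i(2)]
      using i i' k by (simp add: factor_step_def b uminus_mult_mat_vec[OF X] XX)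
  qed
  show "elem_mat_neg m n (Neg i) X * elem_mat m n i (- X) = 1\<^sub>m (m * n)"
  proof (rule mult_idI[OF c(2,1)])
    fix v :: "complex vec" and k assume v: "v \<in> carrier_vec (m * n)" and k: "k < m"
    show "blocks m n (elem_mat_neg m n (Neg i) X *\<^sub>v (elem_mat m n i (- X) *\<^sub>v v)) k = blocks m n v k"
      unfolding blocks_elem_mat_neg_mult[OF X mult_mat_vec_carrier[OF c(1) v] i(1) i'(1) k]
        blocks_elem_mat_mult[OF X' v i(2)]
      using i i' k by (simp add: factor_step_def uminus_mult_mat_vec[OF X] XX)
  qed
qed

lemma invertible_matE:
  assumes "invertible_mat X" "X \<in> carrier_mat n n"
  obtains X' where "X' \<in> carrier_mat n n" "X * X' = 1\<^sub>m n" "X' * X = 1\<^sub>m n"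
proof -
  obtain X' where 1: "X * X' = 1\<^sub>m (dim_row X)" "X' * X = 1\<^sub>m (dim_row X')"
    using assms(1) unfolding invertible_mat_def inverts_mat_def by blast
  have "dim_col X' = n" using arg_cong[OF 1(1), of dim_col] assms by simp
  moreover have "dim_row X' = n" using arg_cong[OF 1(2), of dim_col] assms by simp
  ultimately show ?thesis using that[of X'] 1 assms by auto
qed

lemma elem_mat_gl:
  assumes X: "X \<in> carrier_mat n n" and i: "i < m" and inv: "i = 0 \<Longrightarrow> invertible_mat X"
  shows "elem_mat m n i X \<in> gl_mat (m * n)"
proof (cases "i = 0")
  case True
  obtain X' where X': "X' \<in> carrier_mat n n" "X * X' = 1\<^sub>m n" "X' * X = 1\<^sub>m n"
    by (rule invertible_matE[OF inv[OF True] X])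
  have "0 < m" using i by simp
  then show ?thesis
    unfolding True
    using gl_matI[OF elem_mat_carrier[OF X] elem_mat_carrier[OF X'(1)]
        elem_mat_mult_id(1)[OF X X'(1,2)] elem_mat_mult_id(1)[OF X'(1) X X'(3)]] by blast
next
  case False
  have "- (- X) = X" using X by (intro eq_matI) auto
  then show ?thesis
    using gl_matI[OF elem_mat_carrier[OF X i] elem_mat_neg_carrier[of "- X" n i m]]
      elem_mat_neg_inverse[of "- X" n i m] X i False by simp
qed

lemma elem_mat_neg_gl:
  assumes X: "X \<in> carrier_mat n n" and i: "0 < i" "i \<le> m" and inv: "i = m \<Longrightarrow> invertible_mat X"
  shows "elem_mat_neg m n (Neg i) X \<in> gl_mat (m * n)"
proof (cases "i = m")
  case True
  obtain X' where X': "X' \<in> carrier_mat n n" "X * X' = 1\<^sub>m n" "X' * X = 1\<^sub>m n"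
    by (rule invertible_matE[OF inv[OF True] X])
  have "0 < m" using i by simp
  then show ?thesis
    unfolding True
    using gl_matI[OF elem_mat_neg_carrier[OF X] elem_mat_neg_carrier[OF X'(1)]
        elem_mat_mult_id(2)[OF X X'(1,2)] elem_mat_mult_id(2)[OF X'(1) X X'(3)]] by blast
next
  case False
  then show ?thesis
    using gl_matI[OF elem_mat_neg_carrier[OF X i] elem_mat_carrier[of "- X" n i m]]
      elem_mat_neg_inverse[of X n i m] X i by simp
qed

section \<open>Transfer of minimal bases between null spaces\<close>

interpretation to_fract_hom: inj_comm_ring_hom "to_fract :: 'a::idom \<Rightarrow> 'a fract"
  by unfold_locales auto

lemma (in linear_map) inverse_image_basis:
  assumes inj: "inj_on T (carrier V)" and surj: "T ` carrier V = carrier W"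
    and fd: "V.fin_dim" and B: "W.basis B"
  shows "V.basis (inv_into (carrier V) T ` B)"
proof -
  let ?g = "inv_into (carrier V) T"
  have g: "?g w \<in> carrier V" "T (?g w) = w" if "w \<in> carrier W" for w
    using that surj inv_into_into[of w T] f_inv_into_f[of w T] by auto
  have eq: "x = y" if "T x = T y" "x \<in> carrier V" "y \<in> carrier V" for x y
    using inj that by (simp add: inj_on_def)
  have "?g \<in> LinearCombinations.module_hom K W V"
    unfolding LinearCombinations.module_hom_def
  proof (intro CollectI conjI allI impI funcsetI; (elim conjE)?)
    fix w assume "w \<in> carrier W" then show "?g w \<in> carrier V" by (rule g)
  next
    fix x y assume "x \<in> carrier W" "y \<in> carrier W"
    then show "?g (x \<oplus>\<^bsub>W\<^esub> y) = ?g x \<oplus>\<^bsub>V\<^esub> ?g y"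
      using g by (intro eq) auto
  next
    fix r x assume "r \<in> carrier K" "x \<in> carrier W"
    then show "?g (r \<odot>\<^bsub>W\<^esub> x) = r \<odot>\<^bsub>V\<^esub> ?g x"
      using g by (intro eq) auto
  qed
  then interpret g: linear_map K W V ?g
    by unfold_locales
  show ?thesis
  proof (rule g.linear_inj_image_is_basis[OF _ _ B])
    show "inj_on ?g (carrier W)" by (metis g(2) inj_onI)
    show "?g ` carrier W = carrier V" using inj surj by (metis inv_into_image_cancel order_refl)
    show "W.fin_dim" by (rule surj_fin_dim[OF fd surj])
  qed
qed

text \<open>
  Scaling reduces a statement about null vectors over the field of fractions to the same
  statement about polynomial null vectors.
\<close>

lemma clear_denominators:
  fixes w :: "complex poly fract vec"
  assumes w: "w \<in> carrier_vec N"
  obtains q z where "q \<noteq> 0" "z \<in> carrier_vec N" "to_fract q \<cdot>\<^sub>v w = map_vec to_fract z"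
proof -
  have "\<exists>a b. b \<noteq> 0 \<and> w $ i = to_fract a / to_fract b" for i
    by (cases "w $ i") (auto simp: Fract_conv_to_fract)
  then obtain a b where ab: "\<And>i. b i \<noteq> 0" "\<And>i. w $ i = to_fract (a i) / to_fract (b i)"
    by metis
  let ?q = "\<Prod>i<N. b i"
  let ?z = "vec N (\<lambda>i. a i * (\<Prod>j\<in>{..<N} - {i}. b j))"
  have "to_fract ?q \<cdot>\<^sub>v w = map_vec to_fract ?z"
  proof (rule eq_vecI)
    fix i assume "i < dim_vec (map_vec to_fract ?z)"
    then have i: "i < N" by simp
    have "?q = b i * (\<Prod>j\<in>{..<N} - {i}. b j)" using i by (intro prod.remove) auto
    then have "to_fract ?q = to_fract (b i) * to_fract (\<Prod>j\<in>{..<N} - {i}. b j)"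
      by (simp only: to_fract_hom.hom_mult)
    then show "(to_fract ?q \<cdot>\<^sub>v w) $ i = map_vec to_fract ?z $ i"
      using i w ab(1)[of i] by (simp add: ab(2) to_fract_hom.hom_mult)
  qed (use w in auto)
  moreover have "?q \<noteq> 0" using ab(1) by simp
  ultimately show ?thesis by (intro that[of ?q ?z]) auto
qed

text \<open>
  \<open>S\<close> identifies the polynomial null vectors of \<open>L\<close> with those of \<open>P\<close> and lowers every degree by
  \<open>d\<close>. Stating the hypotheses for polynomial vectors keeps the field of fractions out of all
  later computations. As bases of one space have equally many members, the degree sums of all
  polynomial bases drop by the same amount, and minimality is preserved.
\<close>

locale null_space_transfer =
  fixes L P S :: "complex poly mat" and q N k' k d :: nat
  assumes L: "L \<in> carrier_mat q N" and P: "P \<in> carrier_mat k' k" and S: "S \<in> carrier_mat k N"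
    and into: "\<And>z. z \<in> carrier_vec N \<Longrightarrow> L *\<^sub>v z = 0\<^sub>v q \<Longrightarrow> P *\<^sub>v (S *\<^sub>v z) = 0\<^sub>v k'"
    and inj: "\<And>z. z \<in> carrier_vec N \<Longrightarrow> L *\<^sub>v z = 0\<^sub>v q \<Longrightarrow> S *\<^sub>v z = 0\<^sub>v k \<Longrightarrow> z = 0\<^sub>v N"
    and surj: "\<And>x. x \<in> carrier_vec k \<Longrightarrow> P *\<^sub>v x = 0\<^sub>v k' \<Longrightarrow>
                 \<exists>z \<in> carrier_vec N. L *\<^sub>v z = 0\<^sub>v q \<and> S *\<^sub>v z = x"
    and deg: "\<And>z. z \<in> carrier_vec N \<Longrightarrow> L *\<^sub>v z = 0\<^sub>v q \<Longrightarrow> z \<noteq> 0\<^sub>v N \<Longrightarrow>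
                 vec_degree z = vec_degree (S *\<^sub>v z) + d"
begin

abbreviation "W \<equiv> right_null (rational_mat L)"
abbreviation "W' \<equiv> right_null (rational_mat P)"
abbreviation "T \<equiv> (\<lambda>w. rational_mat S *\<^sub>v w)"
abbreviation "V1 \<equiv> module_vec TYPE(complex poly fract) N\<lparr>carrier := W\<rparr>"
abbreviation "V2 \<equiv> module_vec TYPE(complex poly fract) k\<lparr>carrier := W'\<rparr>"

lemma carriers: "rational_mat L \<in> carrier_mat q N" "rational_mat P \<in> carrier_mat k' k"
  "rational_mat S \<in> carrier_mat k N"
  using L P S by auto

sublocale K1: kernel q N "rational_mat L"
  by unfold_locales (rule carriers)

sublocale K2: kernel k' k "rational_mat P"
  by unfold_locales (rule carriers)

lemma W_iff: "w \<in> W \<longleftrightarrow> w \<in> carrier_vec N \<and> rational_mat L *\<^sub>v w = 0\<^sub>v q"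
  using mat_kernel[OF carriers(1)] by (simp add: right_null_def)

lemma W'_iff: "w \<in> W' \<longleftrightarrow> w \<in> carrier_vec k \<and> rational_mat P *\<^sub>v w = 0\<^sub>v k'"
  using mat_kernel[OF carriers(2)] by (simp add: right_null_def)

lemma poly_W_iff: "map_vec to_fract z \<in> W \<longleftrightarrow> z \<in> carrier_vec N \<and> L *\<^sub>v z = 0\<^sub>v q"
proof (cases "z \<in> carrier_vec N")
  case True
  then show ?thesis
    by (simp add: W_iff to_fract_hom.mult_mat_vec_hom[OF L True, symmetric])
qed (simp add: W_iff)

lemma poly_W'_iff: "map_vec to_fract x \<in> W' \<longleftrightarrow> x \<in> carrier_vec k \<and> P *\<^sub>v x = 0\<^sub>v k'"
proof (cases "x \<in> carrier_vec k")
  case True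
  then show ?thesis
    by (simp add: W'_iff to_fract_hom.mult_mat_vec_hom[OF P True, symmetric])
qed (simp add: W'_iff)

lemma T_poly: "z \<in> carrier_vec N \<Longrightarrow> T (map_vec to_fract z) = map_vec to_fract (S *\<^sub>v z)"
  using to_fract_hom.mult_mat_vec_hom[OF S] by simp

lemma smult_mem: "w \<in> W \<Longrightarrow> c \<cdot>\<^sub>v w \<in> W" "w' \<in> W' \<Longrightarrow> c \<cdot>\<^sub>v w' \<in> W'"
  using mat_kernel_smult[OF carriers(1)] mat_kernel_smult[OF carriers(2)] by (auto simp: right_null_def)

lemma T_smult: "w \<in> carrier_vec N \<Longrightarrow> T (c \<cdot>\<^sub>v w) = c \<cdot>\<^sub>v T w"
  using mult_mat_vec[OF carriers(3)] by simp

lemma unscale: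
  fixes v w :: "complex poly fract vec"
  assumes "c \<noteq> 0" "c \<cdot>\<^sub>v v = w" shows "v = inverse c \<cdot>\<^sub>v w"
  using assms by (auto simp: smult_smult_assoc)

lemma T_into:
  assumes w: "w \<in> W"
  shows "T w \<in> W'"
proof -
  have wc: "w \<in> carrier_vec N" using w by (simp add: W_iff)
  obtain c z where c: "c \<noteq> 0" "z \<in> carrier_vec N" "to_fract c \<cdot>\<^sub>v w = map_vec to_fract z"
    using clear_denominators[OF wc] .
  then have "map_vec to_fract z \<in> W" using smult_mem(1)[OF w] by metis
  then have "map_vec to_fract (S *\<^sub>v z) \<in> W'"
    using into c(2) S by (simp add: poly_W_iff poly_W'_iff)
  then have "to_fract c \<cdot>\<^sub>v T w \<in> W'"
    using T_poly[OF c(2)] c(3) T_smult[OF wc] by metis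
  moreover have "T w = inverse (to_fract c) \<cdot>\<^sub>v (to_fract c \<cdot>\<^sub>v T w)"
    using c(1) by (intro unscale) auto
  ultimately show ?thesis using smult_mem(2) by metis
qed

lemma T_inj: "inj_on T W"
proof (rule inj_onI)
  fix v w assume vw: "v \<in> W" "w \<in> W" "T v = T w"
  let ?u = "v - w"
  have uc: "?u \<in> carrier_vec N" "v \<in> carrier_vec N" "w \<in> carrier_vec N" using vw by (auto simp: W_iff)
  have u: "?u \<in> W" using vw mult_minus_distrib_mat_vec[OF carriers(1)] by (auto simp: W_iff)
  have "T ?u = T v - T w" using mult_minus_distrib_mat_vec[OF carriers(3)] uc by auto
  then have Tu: "T ?u = 0\<^sub>v k" using vw(3) carriers(3) by auto
  obtain c z where c: "c \<noteq> 0" "z \<in> carrier_vec N" "to_fract c \<cdot>\<^sub>v ?u = map_vec to_fract z"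
    using clear_denominators[OF uc(1)] .
  then have z: "L *\<^sub>v z = 0\<^sub>v q" using smult_mem(1)[OF u] poly_W_iff by metis
  have "map_vec to_fract (S *\<^sub>v z) = to_fract c \<cdot>\<^sub>v T ?u"
    using T_poly[OF c(2)] c(3) T_smult[OF uc(1)] by metis
  then have "S *\<^sub>v z = 0\<^sub>v k"
    unfolding Tu by simp
  then have "z = 0\<^sub>v N" using inj z c(2) by blast
  then have "?u = 0\<^sub>v N" using unscale[OF _ c(3)] c(1) by auto
  then have "(v - w) $ i = 0" if "i < N" for i using that by simp
  then show "v = w" using uc by (intro eq_vecI) auto
qed

lemma T_surj: "T ` W = W'"
proof
  show "T ` W \<subseteq> W'" using T_into by auto
  show "W' \<subseteq> T ` W"
  proof
    fix y assume y: "y \<in> W'"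
    then have yc: "y \<in> carrier_vec k" by (simp add: W'_iff)
    obtain c x where c: "c \<noteq> 0" "x \<in> carrier_vec k" "to_fract c \<cdot>\<^sub>v y = map_vec to_fract x"
      using clear_denominators[OF yc] .
    then have "P *\<^sub>v x = 0\<^sub>v k'" using smult_mem(2)[OF y] poly_W'_iff by metis
    then obtain z where z: "z \<in> carrier_vec N" "L *\<^sub>v z = 0\<^sub>v q" "S *\<^sub>v z = x"
      using surj c(2) by blast
    let ?w = "inverse (to_fract c) \<cdot>\<^sub>v map_vec to_fract z"
    have "map_vec to_fract z \<in> W" using z by (simp add: poly_W_iff)
    then have "?w \<in> W" by (rule smult_mem)
    moreover have "T ?w = y"
      using T_smult[of "map_vec to_fract z"] T_poly[OF z(1)] z(1,3) unscale[OF _ c(3)] c(1) by simp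
    ultimately show "y \<in> T ` W" by blast
  qed
qed

lemma T_linear: "linear_map class_ring V1 V2 T"
proof -
  have v1: "vectorspace class_ring V1" using K1.Ker.vectorspace_axioms by (simp add: right_null_def)
  have v2: "vectorspace class_ring V2" using K2.Ker.vectorspace_axioms by (simp add: right_null_def)
  have "T \<in> LinearCombinations.module_hom class_ring V1 V2"
    unfolding LinearCombinations.module_hom_def
    using T_into T_smult mult_add_distrib_mat_vec[OF carriers(3)]
    by (auto simp: module_vec_simps W_iff)
  then show ?thesis
    using v1 v2 by (auto intro!: linear_map.intro mod_hom.intro mod_hom_axioms.intro
        simp: vectorspace_def)
qed

sublocale T: linear_map class_ring V1 V2 T
  by (rule T_linear)

lemma V1_fin_dim: "T.V.fin_dim"
proof -
  obtain B where B: "finite B" "T.V.basis B"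
    using kernel_basis_exists[OF carriers(1)] by (auto simp: right_null_def)
  then show ?thesis
    unfolding T.V.fin_dim_def T.V.basis_def by auto
qed

lemma poly_basis_mem:
  assumes zs: "poly_basis N W zs" and z: "z \<in> set zs"
  shows "z \<in> carrier_vec N" "L *\<^sub>v z = 0\<^sub>v q" "z \<noteq> 0\<^sub>v N"
proof -
  have B: "T.V.basis (map_vec to_fract ` set zs)" using zs by (simp add: poly_basis_def)
  then have "map_vec to_fract z \<in> W" using z by (auto simp: T.V.basis_def)
  then show "z \<in> carrier_vec N" "L *\<^sub>v z = 0\<^sub>v q" by (simp_all add: poly_W_iff)
  have "\<zero>\<^bsub>V1\<^esub> \<notin> map_vec to_fract ` set zs"
  proof (rule T.V.module.zero_nin_lin_indpt)
    have "(1 :: complex poly fract) \<in> carrier class_ring" "(1 :: complex poly fract) \<noteq> \<zero>\<^bsub>class_ring\<^esub>"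
      by (simp_all add: class_ring_simps)
    then show "carrier class_ring \<noteq> {\<zero>\<^bsub>class_ring\<^esub> :: complex poly fract}" by blast
  qed (use B in \<open>auto simp: T.V.basis_def\<close>)
  then have "0\<^sub>v N \<notin> (map_vec to_fract ` set zs :: complex poly fract vec set)"
    by (simp add: module_vec_simps)
  with imageI[OF z, of "map_vec to_fract :: _ \<Rightarrow> complex poly fract vec"]
  have "map_vec to_fract z \<noteq> (0\<^sub>v N :: complex poly fract vec)" by metis
  then show "z \<noteq> 0\<^sub>v N" by (simp add: to_fract_hom.vec_hom_zero_iff)
qed

lemma poly_inj: "map_vec to_fract x = map_vec to_fract y \<Longrightarrow> x = y" for x y :: "complex poly vec"
  by (rule to_fract_hom.vec_hom_inj)

lemma poly_basis_image:
  assumes zs: "poly_basis N W zs"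
  shows "poly_basis k W' (map ((*\<^sub>v) S) zs)"
proof -
  have im: "map_vec to_fract ` set (map ((*\<^sub>v) S) zs) = T ` (map_vec to_fract ` set zs)"
    using poly_basis_mem(1)[OF zs] T_poly by (force simp: image_image)
  have "T.W.basis (T ` (map_vec to_fract ` set zs))"
    using zs T_inj T_surj V1_fin_dim
    by (intro T.linear_inj_image_is_basis) (auto simp: poly_basis_def)
  moreover have "inj_on ((*\<^sub>v) S) (set zs)"
  proof (rule inj_onI)
    fix x y assume xy: "x \<in> set zs" "y \<in> set zs" "S *\<^sub>v x = S *\<^sub>v y"
    note m = poly_basis_mem[OF zs xy(1)] poly_basis_mem[OF zs xy(2)]
    have "T (map_vec to_fract x) = T (map_vec to_fract y)" using xy m T_poly by simp
    then have "map_vec to_fract x = map_vec to_fract y"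
      by (rule inj_onD[OF T_inj]) (use m in \<open>simp_all add: poly_W_iff\<close>)
    then show "x = y" by (rule poly_inj)
  qed
  ultimately show ?thesis
    using zs im by (simp add: poly_basis_def distinct_map)
qed

definition "lift x = (SOME z. z \<in> carrier_vec N \<and> L *\<^sub>v z = 0\<^sub>v q \<and> S *\<^sub>v z = x)"

lemma lift:
  assumes "map_vec to_fract x \<in> W'"
  shows "lift x \<in> carrier_vec N" "L *\<^sub>v lift x = 0\<^sub>v q" "S *\<^sub>v lift x = x"
proof -
  have "\<exists>z. z \<in> carrier_vec N \<and> L *\<^sub>v z = 0\<^sub>v q \<and> S *\<^sub>v z = x"
    using surj assms by (auto simp: poly_W'_iff)
  from someI_ex[OF this] show "lift x \<in> carrier_vec N" "L *\<^sub>v lift x = 0\<^sub>v q" "S *\<^sub>v lift x = x"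
    by (simp_all add: lift_def)
qed

lemma poly_basis_lift:
  assumes ws: "poly_basis k W' ws"
  shows "poly_basis N W (map lift ws)" "x \<in> set ws \<Longrightarrow> map_vec to_fract x \<in> W'"
proof -
  have B: "T.W.basis (map_vec to_fract ` set ws)" using ws by (simp add: poly_basis_def)
  then show mem: "map_vec to_fract x \<in> W'" if "x \<in> set ws" for x
    using that by (auto simp: T.W.basis_def)
  have "inv_into W T (map_vec to_fract x) = map_vec to_fract (lift x)" if "x \<in> set ws" for x
    using lift[OF mem[OF that]] T_poly[of "lift x"] T_inj
    by (intro inv_into_f_eq) (auto simp: poly_W_iff)
  then have im: "map_vec to_fract ` set (map lift ws) = inv_into W T ` (map_vec to_fract ` set ws)"
    by (force simp: image_image)
  have "T.V.basis (inv_into (carrier V1) T ` (map_vec to_fract ` set ws))"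
    using B T_inj T_surj V1_fin_dim by (intro T.inverse_image_basis) auto
  moreover have "inj_on lift (set ws)"
    using lift(3) mem by (metis inj_onI)
  ultimately show "poly_basis N W (map lift ws)"
    using ws im by (simp add: poly_basis_def distinct_map)
qed

lemma poly_basis_length:
  assumes "poly_basis N W zs"
  shows "length zs = T.V.dim"
proof -
  have "length zs = card (map_vec to_fract ` set zs :: complex poly fract vec set)"
    using assms poly_inj by (subst card_image) (auto simp: poly_basis_def distinct_card inj_on_def)
  also have "\<dots> = T.V.dim"
    using assms by (intro T.V.dim_basis[symmetric]) (auto simp: poly_basis_def)
  finally show ?thesis .
qed

lemma image_degrees:
  assumes zs: "poly_basis N W zs"
  shows "map vec_degree zs = map (\<lambda>x. vec_degree x + d) (map ((*\<^sub>v) S) zs)"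
  using poly_basis_mem[OF zs] deg by auto

lemma sum_list_shift: "sum_list (map (\<lambda>x. f x + d) xs) = sum_list (map f xs) + length xs * d"
  for f :: "'a \<Rightarrow> nat"
  by (induction xs) auto

lemma minimal_basis_image:
  assumes zs: "minimal_basis N W zs"
  shows "minimal_basis k W' (map ((*\<^sub>v) S) zs)"
  unfolding minimal_basis_def
proof (intro conjI allI impI)
  have pb: "poly_basis N W zs" using zs by (simp add: minimal_basis_def)
  then show "poly_basis k W' (map ((*\<^sub>v) S) zs)" by (rule poly_basis_image)
  have "sorted (map vec_degree zs)" using zs by (simp add: minimal_basis_def)
  then show "sorted (map vec_degree (map ((*\<^sub>v) S) zs))"
    unfolding image_degrees[OF pb] by (simp add: sorted_map)
  fix ws assume ws: "poly_basis k W' ws"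
  have pl: "poly_basis N W (map lift ws)" by (rule poly_basis_lift[OF ws])
  have *: "map ((*\<^sub>v) S) (map lift ws) = ws"
    using lift(3) poly_basis_lift(2)[OF ws] by (auto intro!: map_idI)
  have len: "length ws = length zs" using poly_basis_length[OF pl] poly_basis_length[OF pb] by simp
  have "sum_list (map vec_degree zs) \<le> sum_list (map vec_degree (map lift ws))"
    using zs pl unfolding minimal_basis_def by blast
  then show "sum_list (map vec_degree (map ((*\<^sub>v) S) zs)) \<le> sum_list (map vec_degree ws)"
    unfolding image_degrees[OF pb] image_degrees[OF pl] * by (simp add: sum_list_shift len del: map_map)
qed

lemma cols_mult: "Z \<in> carrier_mat N p \<Longrightarrow> cols (S * Z) = map ((*\<^sub>v) S) (cols Z)"
  using S by (simp add: cols_def mult_mat_vec_def)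

theorem right_minimal_basis_image:
  assumes Z: "right_minimal_basis (rational_mat L) Z"
  shows "right_minimal_basis (rational_mat P) (S * Z)"
    and "map vec_degree (cols Z) = map (\<lambda>x. vec_degree x + d) (cols (S * Z))"
proof -
  have mb: "minimal_basis N W (cols Z)" and Zc: "Z \<in> carrier_mat N (dim_col Z)"
    using Z L unfolding right_minimal_basis_def by auto
  then show "right_minimal_basis (rational_mat P) (S * Z)"
    using minimal_basis_image[OF mb] S P cols_mult[OF Zc] by (simp add: right_minimal_basis_def)
  show "map vec_degree (cols Z) = map (\<lambda>x. vec_degree x + d) (cols (S * Z))"
    using mb unfolding cols_mult[OF Zc] by (intro image_degrees) (simp add: minimal_basis_def)
qed

end

section \<open>Degrees of polynomial vectors\<close>

abbreviation indet :: "complex poly" where "indet \<equiv> [:0, 1:]"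

lemma vec_degree_le_iff: "vec_degree v \<le> d \<longleftrightarrow> (\<forall>i < dim_vec v. degree (v $ i) \<le> d)"
proof -
  have "finite (set\<^sub>v v)" "set\<^sub>v v = (\<lambda>i. v $ i) ` {..<dim_vec v}" by (auto simp: vec_set_def)
  then show ?thesis by (auto simp: vec_degree_def)
qed

lemma degree_le_vec_degree: "i < dim_vec v \<Longrightarrow> degree (v $ i) \<le> vec_degree v"
  using vec_degree_le_iff[of v "vec_degree v"] by simp

text \<open>
  A nonzero vector has a nonzero entry of maximal degree. The nonvanishing has content when all
  degrees are \<open>0\<close>, because the zero polynomial also has degree \<open>0\<close>.
\<close>

lemma vec_degree_attained:
  assumes "v \<in> carrier_vec n" "v \<noteq> 0\<^sub>v n"
  obtains i where "i < n" "v $ i \<noteq> 0" "degree (v $ i) = vec_degree v"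
proof (cases "vec_degree v = 0")
  case True
  obtain i where "i < n" "v $ i \<noteq> 0" using assms by (auto simp: vec_eq_iff)
  then show ?thesis using that[of i] True degree_le_vec_degree[of i v] assms(1) by simp
next
  case False
  have "\<not> vec_degree v \<le> vec_degree v - 1" using False by simp
  then obtain i where i: "i < n" "vec_degree v - 1 < degree (v $ i)"
    using assms(1) unfolding vec_degree_le_iff by (auto simp: not_le)
  then have "degree (v $ i) = vec_degree v" using degree_le_vec_degree[of i v] assms(1) by simp
  moreover from this have "v $ i \<noteq> 0" using False by auto
  ultimately show ?thesis using that[of i] i by blast
qed

lemma degree_indet_power_mult: "p \<noteq> 0 \<Longrightarrow> degree (indet ^ e * p) = e + degree p"
  by (simp add: degree_mult_eq degree_power_eq)

lemma vec_degree_indet_power: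
  assumes "x \<in> carrier_vec n" "x \<noteq> 0\<^sub>v n"
  shows "vec_degree (indet ^ e \<cdot>\<^sub>v x) = vec_degree x + e"
proof (rule antisym)
  show "vec_degree (indet ^ e \<cdot>\<^sub>v x) \<le> vec_degree x + e"
    unfolding vec_degree_le_iff
  proof (intro allI impI)
    fix i assume "i < dim_vec (indet ^ e \<cdot>\<^sub>v x)"
    then show "degree ((indet ^ e \<cdot>\<^sub>v x) $ i) \<le> vec_degree x + e"
      using degree_le_vec_degree[of i x] degree_indet_power_mult[of "x $ i" e]
      by (cases "x $ i = 0") auto
  qed
  obtain i where "i < n" "x $ i \<noteq> 0" "degree (x $ i) = vec_degree x"
    using vec_degree_attained[OF assms] .
  then show "vec_degree x + e \<le> vec_degree (indet ^ e \<cdot>\<^sub>v x)"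
    using degree_le_vec_degree[of i "indet ^ e \<cdot>\<^sub>v x"] degree_indet_power_mult[of "x $ i" e] assms(1)
    by simp
qed

lemma vec_degree_const_mat_mult:
  assumes "C \<in> carrier_mat k l" "v \<in> carrier_vec l"
  shows "vec_degree (const_mat C *\<^sub>v v) \<le> vec_degree v"
  unfolding vec_degree_le_iff
proof (intro allI impI)
  fix i assume "i < dim_vec (const_mat C *\<^sub>v v)"
  then have "(const_mat C *\<^sub>v v) $ i = (\<Sum>j<l. [:C $$ (i, j):] * v $ j)"
    using assms by (simp add: scalar_prod_def atLeast0LessThan)
  also have "degree \<dots> \<le> vec_degree v"
    using assms by (intro degree_sum_le)
      (auto intro!: order_trans[OF degree_smult_le] degree_le_vec_degree)
  finally show "degree ((const_mat C *\<^sub>v v) $ i) \<le> vec_degree v" .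
qed

lemma vec_degree_blocks_le:
  assumes v: "v \<in> carrier_vec (m * n)"
  shows "vec_degree v \<le> d \<longleftrightarrow> (\<forall>k<m. vec_degree (blocks m n v k) \<le> d)"
proof
  assume "vec_degree v \<le> d"
  then show "\<forall>k<m. vec_degree (blocks m n v k) \<le> d"
    using v block_index_less unfolding vec_degree_le_iff by (auto simp: blocks_def)
next
  assume *: "\<forall>k<m. vec_degree (blocks m n v k) \<le> d"
  show "vec_degree v \<le> d"
    unfolding vec_degree_le_iff
  proof (intro allI impI)
    fix i assume "i < dim_vec v"
    then have i: "i < m * n" using v by simp
    then have n: "0 < n" by (cases n) auto
    let ?k = "m - Suc (i div n)"
    have q: "i div n < m" using i by (simp add: less_mult_imp_div_less)
    then have "m - Suc ?k = i div n" "?k < m" by simp_all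
    then have "blocks m n v ?k $ (i mod n) = v $ i" using n by (simp add: blocks_def)
    then show "degree (v $ i) \<le> d"
      using * \<open>?k < m\<close> n unfolding vec_degree_le_iff by (metis dim_blocks mod_less_divisor)
  qed
qed

section \<open>The null space of a Fiedler pencil\<close>

lemma const_mat_mult_vec:
  assumes "M \<in> carrier_mat k l" "N \<in> carrier_mat l l'" "v \<in> carrier_vec l'"
  shows "const_mat (M * N) *\<^sub>v v = const_mat M *\<^sub>v (const_mat N *\<^sub>v v)"
  using assms by (simp add: const_hom.mat_hom_mult assoc_mult_mat_vec[of _ k l _ l'])

lemma const_one_mult_vec: "v \<in> carrier_vec k \<Longrightarrow> const_mat (1\<^sub>m k) *\<^sub>v v = v"
  by (simp add: const_poly.map_one_mat)

lemma fiedler_mat_below: "i < m \<Longrightarrow> fiedler_mat m n A i = elem_mat m n i (- A i)"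
  by (simp add: fiedler_mat_def)

lemma fiedler_mat_neg_pos: "0 < i \<Longrightarrow> fiedler_mat_neg m n A (Neg i) = elem_mat_neg m n (Neg i) (A i)"
  by simp

lemma fiedler_prod_carrier:
  assumes "\<And>i. i \<le> m \<Longrightarrow> A i \<in> carrier_mat n n" "set t \<subseteq> {..<m}"
  shows "fiedler_prod m n A t \<in> carrier_mat (m * n) (m * n)"
  unfolding fiedler_prod_def
proof (rule mat_prod_carrier)
  show "set (map (fiedler_mat m n A) t) \<subseteq> carrier_mat (m * n) (m * n)"
  proof
    fix M assume "M \<in> set (map (fiedler_mat m n A) t)"
    then obtain i where i: "i \<in> set t" "M = fiedler_mat m n A i" by auto
    then have im: "i < m" using assms(2) by auto
    then have "- A i \<in> carrier_mat n n" using assms(1)[of i] by simp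
    then show "M \<in> carrier_mat (m * n) (m * n)"
      using i(2) elem_mat_carrier im by (simp add: fiedler_mat_below)
  qed
qed

lemma blocks_fiedler_prod:
  assumes A: "\<And>i. i \<le> m \<Longrightarrow> A i \<in> carrier_mat n n" and t: "set t \<subseteq> {..<m}"
    and v: "v \<in> carrier_vec (m * n)"
  shows "blocks m n (const_mat (fiedler_prod m n A t) *\<^sub>v v)
    = foldr (factor_step (0\<^sub>v n) (\<lambda>i a b. const_mat (- A i) *\<^sub>v a + b)) t (blocks m n v)"
  using t
proof (induction t)
  case Nil
  then show ?case using v by (simp add: fiedler_prod_def mat_prod_Nil const_one_mult_vec)
next
  case (Cons i t)
  then have i: "i < m" and Ai: "- A i \<in> carrier_mat n n" and t: "set t \<subseteq> {..<m}" using A by auto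
  note c = fiedler_prod_carrier[of m A n t, OF A t]
  have "const_mat (fiedler_prod m n A (i # t)) *\<^sub>v v
      = const_mat (elem_mat m n i (- A i)) *\<^sub>v (const_mat (fiedler_prod m n A t) *\<^sub>v v)"
    using const_mat_mult_vec[OF elem_mat_carrier[OF Ai i] c v] i
    by (simp add: fiedler_prod_def mat_prod_Cons fiedler_mat_below)
  moreover have cv: "const_mat (fiedler_prod m n A t) *\<^sub>v v \<in> carrier_vec (m * n)"
    using c v by simp
  moreover have "factor_step (0\<^sub>v n) (\<lambda>_ a b. const_mat (- A i) *\<^sub>v a + b) i u
      = factor_step (0\<^sub>v n) (\<lambda>i a b. const_mat (- A i) *\<^sub>v a + b) i u" for u
    by (cases "i = 0") (auto simp: factor_step_def)
  ultimately show ?case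
    using Cons.IH[OF t] by (simp add: const_poly.blocks_elem_mat_mult[OF Ai cv i])
qed

lemma matrix_poly_mult:
  assumes A: "\<And>i. i \<le> m \<Longrightarrow> A i \<in> carrier_mat n n" and x: "x \<in> carrier_vec n" and r: "r < n"
  shows "(matrix_poly m n A *\<^sub>v x) $ r = (\<Sum>j\<le>m. indet ^ j * (const_mat (A j) *\<^sub>v x) $ r)"
proof -
  have mon: "monom a j = indet ^ j * [:a:]" for a :: complex and j
    by (simp add: monom_altdef)
  have "(matrix_poly m n A *\<^sub>v x) $ r = (\<Sum>s<n. (\<Sum>j\<le>m. monom (A j $$ (r, s)) j) * x $ s)"
    using x r by (simp add: matrix_poly_def scalar_prod_def atLeast0LessThan)
  also have "\<dots> = (\<Sum>j\<le>m. \<Sum>s<n. indet ^ j * ([:A j $$ (r, s):] * x $ s))"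
    unfolding sum_distrib_right by (subst sum.swap) (simp only: mon mult.assoc)
  also have "\<dots> = (\<Sum>j\<le>m. indet ^ j * (const_mat (A j) *\<^sub>v x) $ r)"
  proof (rule sum.cong[OF refl])
    fix j assume "j \<in> {..m}"
    then have "A j \<in> carrier_mat n n" using A by simp
    then have "(const_mat (A j) *\<^sub>v x) $ r = (\<Sum>s<n. [:A j $$ (r, s):] * x $ s)"
      using x r by (simp add: scalar_prod_def atLeast0LessThan)
    then show "(\<Sum>s<n. indet ^ j * ([:A j $$ (r, s):] * x $ s)) = indet ^ j * (const_mat (A j) *\<^sub>v x) $ r"
      by (simp only: sum_distrib_left)
  qed
  finally show ?thesis .
qed

lemma smult_mat_mult_vec:
  fixes c :: "'a::comm_ring_1"
  assumes "M \<in> carrier_mat k l" "v \<in> carrier_vec l"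
  shows "(c \<cdot>\<^sub>m M) *\<^sub>v v = c \<cdot>\<^sub>v (M *\<^sub>v v)"
  using assms by (intro eq_vecI) auto

lemma minus_vec_eq_zero_iff:
  fixes x y :: "'a::ab_group_add vec"
  assumes "x \<in> carrier_vec k" "y \<in> carrier_vec k"
  shows "x - y = 0\<^sub>v k \<longleftrightarrow> x = y"
  using assms by (auto simp: vec_eq_iff)

locale fiedler_kernel =
  fixes m n :: nat and A :: "nat \<Rightarrow> complex mat" and \<alpha> :: "nat list"
  assumes m: "0 < m" and A: "\<And>i. i \<le> m \<Longrightarrow> A i \<in> carrier_mat n n"
    and dist: "distinct \<alpha>" and set_\<alpha>: "set \<alpha> = {..<m}"
begin

abbreviation "asc i \<equiv> occurs_before i (Suc i) \<alpha>"
definition "cons_below i = card {j. j < i \<and> asc j}"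
definition "inv_below i = card {j. j < i \<and> \<not> asc j}"
abbreviation "f \<equiv> (\<lambda>i a b. const_mat (- A i) *\<^sub>v a + b)"
abbreviation "M\<alpha> \<equiv> const_mat (fiedler_prod m n A \<alpha>)"
abbreviation "D \<equiv> const_mat (elem_mat_neg m n (Neg m) (A m))"
abbreviation "coef x j r \<equiv> (const_mat (A j) *\<^sub>v x) $ r"

lemma A_below: "i < m \<Longrightarrow> A i \<in> carrier_mat n n"
  by (rule A) simp

lemma cons_below_Suc: "cons_below (Suc i) = (if asc i then Suc (cons_below i) else cons_below i)"
proof -
  have "{j. j < Suc i \<and> asc j} = (if asc i then insert i {j. j < i \<and> asc j} else {j. j < i \<and> asc j})"
    by (auto simp: less_Suc_eq)
  then show ?thesis by (simp add: cons_below_def)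
qed

lemma inv_below_Suc: "inv_below (Suc i) = (if asc i then inv_below i else Suc (inv_below i))"
proof -
  have "{j. j < Suc i \<and> \<not> asc j}
      = (if asc i then {j. j < i \<and> \<not> asc j} else insert i {j. j < i \<and> \<not> asc j})"
    by (auto simp: less_Suc_eq)
  then show ?thesis by (simp add: inv_below_def)
qed

lemma cons_below_0: "cons_below 0 = 0" and inv_below_0: "inv_below 0 = 0"
  by (simp_all add: cons_below_def inv_below_def)

lemma cons_plus_inv: "cons_below i + inv_below i = i"
  by (induction i) (auto simp: cons_below_0 inv_below_0 cons_below_Suc inv_below_Suc)

lemma inv_below_mono: "i \<le> j \<Longrightarrow> inv_below i \<le> inv_below j"
  by (induction rule: dec_induct) (auto simp: inv_below_Suc)

text \<open>
  In a permutation \<open>i\<close> and \<open>Suc i\<close> occur in exactly one of the two orders.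
\<close>

lemma total_inversions_eq: "total_inversions m \<alpha> = inv_below (m - 1)"
proof -
  have "{j. j + 1 < m \<and> occurs_before (j + 1) j \<alpha>} = {j. j < m - 1 \<and> \<not> asc j}"
  proof (intro Collect_cong conj_cong)
    fix j
    show "j + 1 < m \<longleftrightarrow> j < m - 1" by auto
    assume j: "j < m - 1"
    show "occurs_before (j + 1) j \<alpha> \<longleftrightarrow> \<not> asc j"
    proof
      assume "\<not> asc j"
      then show "occurs_before (j + 1) j \<alpha>" using occurs_before_total[of j \<alpha> "j + 1"] j set_\<alpha> by simp
    next
      assume "occurs_before (j + 1) j \<alpha>"
      then obtain ps qs rs where 1: "\<alpha> = ps @ Suc j # qs @ j # rs" unfolding occurs_before_iff by auto
      show "\<not> asc j"
      proof
        assume "asc j"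
        then obtain ps' qs' rs' where 2: "\<alpha> = ps' @ j # qs' @ Suc j # rs'" unfolding occurs_before_iff by auto
        have "ps @ Suc j # (qs @ j # rs) = (ps' @ j # qs') @ Suc j # rs'" using 1 2 by simp
        moreover have "Suc j \<notin> set ps" using dist unfolding 1 by simp
        moreover have "Suc j \<notin> set (ps' @ j # qs')" "Suc j \<notin> set rs'"
          using dist unfolding 2 by auto
        ultimately have "ps = ps' @ j # qs'" by (metis append_Cons_eq_iff)
        then show False using dist unfolding 1 by auto
      qed
    qed
  qed
  then show ?thesis by (simp add: total_inversions_def inv_below_def)
qed

lemma D_mult:
  assumes "v \<in> carrier_vec (m * n)" "k < m"
  shows "blocks m n (D *\<^sub>v v) k = (if k = m - 1 then const_mat (A m) *\<^sub>v blocks m n v k else blocks m n v k)"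
  using const_poly.blocks_elem_mat_neg_mult[OF A[OF order_refl] assms(1) m order_refl assms(2)] by simp

lemma D_carrier: "D \<in> carrier_mat (m * n) (m * n)"
  using elem_mat_neg_carrier[OF A[OF order_refl] m order_refl] by simp

lemma M\<alpha>_carrier: "M\<alpha> \<in> carrier_mat (m * n) (m * n)"
  using fiedler_prod_carrier[of m A n \<alpha>] A set_\<alpha> by simp

definition pencil where "pencil = indet \<cdot>\<^sub>m D - M\<alpha>"

lemma pencil_carrier: "pencil \<in> carrier_mat (m * n) (m * n)"
  using M\<alpha>_carrier by (simp add: pencil_def minus_carrier_mat)

lemma pencil_null_iff:
  assumes v: "v \<in> carrier_vec (m * n)"
  shows "pencil *\<^sub>v v = 0\<^sub>v (m * n) \<longleftrightarrow>
    (\<forall>k<m. blocks m n (M\<alpha> *\<^sub>v v) k = indet \<cdot>\<^sub>v blocks m n (D *\<^sub>v v) k)"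
proof -
  have Mv: "M\<alpha> *\<^sub>v v \<in> carrier_vec (m * n)" and Dv: "D *\<^sub>v v \<in> carrier_vec (m * n)"
    using M\<alpha>_carrier D_carrier v by auto
  have "pencil *\<^sub>v v = indet \<cdot>\<^sub>v (D *\<^sub>v v) - M\<alpha> *\<^sub>v v"
    unfolding pencil_def using M\<alpha>_carrier D_carrier v
    by (subst minus_mult_distrib_mat_vec[of _ "m * n" "m * n"])
      (simp_all add: smult_mat_mult_vec[of _ "m * n" "m * n"])
  also have "\<dots> = 0\<^sub>v (m * n) \<longleftrightarrow> M\<alpha> *\<^sub>v v = indet \<cdot>\<^sub>v (D *\<^sub>v v)"
    using Mv Dv by (subst minus_vec_eq_zero_iff) auto
  also have "\<dots> \<longleftrightarrow> (\<forall>k<m. blocks m n (M\<alpha> *\<^sub>v v) k = blocks m n (indet \<cdot>\<^sub>v (D *\<^sub>v v)) k)"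
    using Mv Dv blocks_eqI[OF Mv, of "indet \<cdot>\<^sub>v (D *\<^sub>v v)"] by auto
  finally show ?thesis using Dv by (simp add: blocks_smult)
qed

lemma flow_blocks:
  assumes v: "v \<in> carrier_vec (m * n)"
  obtains a b where "flow (0\<^sub>v n) f m \<alpha> a b (blocks m n v) (blocks m n (M\<alpha> *\<^sub>v v))"
  using flow_exists[OF dist set_\<alpha> m, of "0\<^sub>v n" f "blocks m n v"]
    blocks_fiedler_prod[of m A n \<alpha> v] A set_\<alpha> v by auto

lemma run_le: "run 0 \<alpha> - 1 < m" "0 < run 0 \<alpha>"
proof -
  show "0 < run 0 \<alpha>" using run_zero_pos[of \<alpha>] set_\<alpha> m by simp
  then have "run 0 \<alpha> = Suc (run 0 \<alpha> - 1)" by simp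
  from run_zero_split[OF this] have "run 0 \<alpha> - 1 \<in> set \<alpha>" by (metis in_set_conv_decomp)
  then show "run 0 \<alpha> - 1 < m" using set_\<alpha> by simp
qed

text \<open>
  All indices of the initial run of \<open>\<alpha>\<close> except the last are consecutions and pass the first input
  on; at the last one it is an initial block. So the vector \<open>a 0\<close>, from which everything else is
  computed, is a block of the given vector.
\<close>

lemma flow_first:
  assumes fl: "flow z g m \<alpha> a b u w"
  shows "a 0 = u (run 0 \<alpha> - 1)"
proof -
  let ?p = "run 0 \<alpha> - 1"
  have "a 0 = a j" if "j \<le> ?p" for j
    using that
  proof (induction j)
    case (Suc j)
    then have "asc j" by (intro occurs_before_upto_run) simp
    then have "a j = a (Suc j)" using fl Suc.prems run_le unfolding flow_def by auto
    then show ?case using Suc by simp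
  qed simp
  then have "a 0 = a ?p" by simp
  also have "a ?p = u ?p"
  proof (cases "Suc ?p < m")
    case True
    have "\<not> asc ?p" using not_occurs_before_run[OF dist, of ?p] run_le(2) by simp
    then show ?thesis using fl True unfolding flow_def by auto
  next
    case False
    then have "?p = m - 1" using run_le by simp
    then show ?thesis using fl unfolding flow_def by auto
  qed
  finally show ?thesis .
qed

lemma f_index:
  assumes "i < m" "a \<in> carrier_vec n" "b \<in> carrier_vec n" "r < n"
  shows "(const_mat (- A i) *\<^sub>v a + b) $ r = b $ r - (const_mat (A i) *\<^sub>v a) $ r"
proof -
  have "const_mat (- A i) = - const_mat (A i)"
    using A_below[OF assms(1)] by (intro eq_matI) auto
  then show ?thesis
    using uminus_mult_mat_vec[of "const_mat (A i)" n a] assms A_below[OF assms(1)] by simp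
qed

lemma coef_smult:
  assumes "j \<le> m" "x \<in> carrier_vec n" "r < n"
  shows "(const_mat (A j) *\<^sub>v (c \<cdot>\<^sub>v x)) $ r = c * coef x j r"
  using A[OF assms(1)] assms(2,3) by (simp add: mult_mat_vec[of _ n n])

text \<open>
  The explicit form of a null vector \<open>v\<close> that belongs to the null vector \<open>x\<close> of \<open>P\<close>. The lower
  inputs \<open>b k\<close> are given with the power of the indeterminate multiplied out, which avoids a
  division; the last condition says that \<open>P\<close> annihilates \<open>x\<close>.
\<close>

definition null_shape :: "complex poly vec \<Rightarrow> complex poly vec \<Rightarrow> (nat \<Rightarrow> complex poly vec) \<Rightarrow> bool" where
  "null_shape v x b \<longleftrightarrow>
     (\<forall>k<m. b k \<in> carrier_vec n) \<and>
     (\<forall>k<m. blocks m n v k =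
        (if Suc k < m \<and> asc k then b (Suc k) else indet ^ inv_below k \<cdot>\<^sub>v x)) \<and>
     (\<forall>k<m. \<forall>r<n. indet ^ cons_below k * b k $ r = - (\<Sum>j<k. indet ^ j * coef x j r)) \<and>
     (\<forall>r<n. (\<Sum>j\<le>m. indet ^ j * coef x j r) = 0)"

text \<open>
  Both recursions are solved upwards: an inversion contributes a factor \<open>indet\<close> to the upper input,
  a consecution one to the equation of the lower input, and as every index is one or the other,
  the two powers at index \<open>i\<close> always multiply to \<open>indet ^ i\<close>. At the top the
  accumulated sum closes up to \<open>P\<close>.
\<close>

lemma null_vector_shape:
  assumes v: "v \<in> carrier_vec (m * n)" and null: "pencil *\<^sub>v v = 0\<^sub>v (m * n)"
  obtains b where "null_shape v (blocks m n v (run 0 \<alpha> - 1)) b"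
proof -
  define x where "x = blocks m n v (run 0 \<alpha> - 1)"
  let ?u = "blocks m n v" and ?w = "blocks m n (M\<alpha> *\<^sub>v v)"
  have xc: "x \<in> carrier_vec n" by (simp add: x_def)
  obtain a b where fl: "flow (0\<^sub>v n) f m \<alpha> a b ?u ?w" using flow_blocks[OF v] .
  have w: "?w k = indet \<cdot>\<^sub>v (if k = m - 1 then const_mat (A m) *\<^sub>v ?u k else ?u k)" if "k < m" for k
    using null that unfolding pencil_null_iff[OF v] by (simp add: D_mult[OF v])
  have b0: "b 0 = 0\<^sub>v n" using fl by (simp add: flow_def)
  have up: "a i = a (Suc i)" "b (Suc i) = ?u i" "?w i = f i (a i) (b i)" if "Suc i < m" "asc i" for i
    using fl that unfolding flow_def by auto
  have down: "a i = ?u i" "b (Suc i) = f i (a i) (b i)" "?w i = a (Suc i)" if "Suc i < m" "\<not> asc i" for i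
    using fl that unfolding flow_def by auto
  have top: "a (m - 1) = ?u (m - 1)" "?w (m - 1) = f (m - 1) (a (m - 1)) (b (m - 1))"
    using fl unfolding flow_def by auto
  have a: "a i = indet ^ inv_below i \<cdot>\<^sub>v x" if "i < m" for i
    using that
  proof (induction i)
    case 0
    then show ?case using flow_first[OF fl] by (simp add: x_def inv_below_0)
  next
    case (Suc i)
    then have IH: "a i = indet ^ inv_below i \<cdot>\<^sub>v x" by simp
    show ?case
    proof (cases "asc i")
      case True
      then show ?thesis using up(1)[OF Suc.prems] IH by (simp add: inv_below_Suc)
    next
      case False
      then have "a (Suc i) = indet \<cdot>\<^sub>v a i"
        using down[OF Suc.prems] w[of i] Suc.prems by (simp split: if_splits)
      then show ?thesis using IH False by (simp add: inv_below_Suc smult_smult_assoc)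
    qed
  qed
  have ac: "a i \<in> carrier_vec n" if "i < m" for i using a[OF that] xc by simp
  have bc: "b i \<in> carrier_vec n" if "i < m" for i
    using that
  proof (induction i)
    case (Suc i)
    then have "b i \<in> carrier_vec n" "a i \<in> carrier_vec n" "A i \<in> carrier_mat n n"
      using ac A_below by auto
    then show ?case
      using up(2)[OF Suc.prems] down(2)[OF Suc.prems] by (cases "asc i") auto
  qed (simp add: b0)
  have out: "f i (a i) (b i) $ r = b i $ r - indet ^ inv_below i * coef x i r"
    if "i < m" "r < n" for i r
    using f_index[OF that(1) ac[OF that(1)] bc[OF that(1)] that(2)] coef_smult[OF _ xc that(2)]
      that(1) a[OF that(1)] by simp
  have ci: "indet ^ cons_below i * indet ^ inv_below i = indet ^ i" for i
    by (simp only: power_add[symmetric] cons_plus_inv)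
  have sums: "indet ^ cons_below i * b i $ r = - (\<Sum>j<i. indet ^ j * coef x j r)"
    if "i < m" "r < n" for i r
    using that(1)
  proof (induction i)
    case 0
    then show ?case using b0 that by simp
  next
    case (Suc i)
    then have i: "i < m" by simp
    have "indet ^ cons_below (Suc i) * b (Suc i) $ r = indet ^ cons_below i * f i (a i) (b i) $ r"
    proof (cases "asc i")
      case True
      then have "f i (a i) (b i) = indet \<cdot>\<^sub>v b (Suc i)" 
        using up[OF Suc.prems] w[OF i] Suc.prems by (simp split: if_splits)
      then show ?thesis using True that bc[OF Suc.prems] by (simp add: cons_below_Suc)
    next
      case False
      then show ?thesis using down(2)[OF Suc.prems] by (simp add: cons_below_Suc)
    qed
    also have "\<dots> = indet ^ cons_below i * b i $ r - (indet ^ cons_below i * indet ^ inv_below i) * coef x i r"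
      unfolding out[OF i that(2)] by (simp only: right_diff_distrib mult.assoc)
    also have "\<dots> = - (\<Sum>j<Suc i. indet ^ j * coef x j r)"
      unfolding ci Suc.IH[OF i] by simp
    finally show ?case .
  qed
  have total: "(\<Sum>j\<le>m. indet ^ j * coef x j r) = 0" if r: "r < n" for r
  proof -
    let ?i = "m - 1"
    have i: "?i < m" "Suc ?i = m" using m by auto
    have "indet \<cdot>\<^sub>v (const_mat (A m) *\<^sub>v a ?i) = f ?i (a ?i) (b ?i)"
      using w[OF i(1)] top by simp
    then have "(indet \<cdot>\<^sub>v (const_mat (A m) *\<^sub>v a ?i)) $ r = f ?i (a ?i) (b ?i) $ r" by simp
    then have "indet * (indet ^ inv_below ?i * coef x m r) = b ?i $ r - indet ^ inv_below ?i * coef x ?i r"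
      unfolding out[OF i(1) r] using A[OF order_refl] r coef_smult[OF order_refl xc r] a[OF i(1)]
      by simp
    then have "indet ^ cons_below ?i * (indet * (indet ^ inv_below ?i * coef x m r))
      = indet ^ cons_below ?i * (b ?i $ r - indet ^ inv_below ?i * coef x ?i r)" by simp
    then have "indet * (indet ^ cons_below ?i * indet ^ inv_below ?i) * coef x m r
      = indet ^ cons_below ?i * b ?i $ r - (indet ^ cons_below ?i * indet ^ inv_below ?i) * coef x ?i r"
      by (simp only: right_diff_distrib mult_ac)
    then have "indet ^ Suc ?i * coef x m r + indet ^ ?i * coef x ?i r + (\<Sum>j<?i. indet ^ j * coef x j r) = 0"
      unfolding ci sums[OF i(1) r] by (simp only: power_Suc) (simp add: algebra_simps)
    moreover have "sum g {..m} = sum g {..<?i} + g ?i + g m" for g :: "nat \<Rightarrow> complex poly"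
      using m by (cases m) (simp_all flip: lessThan_Suc_atMost)
    ultimately show ?thesis unfolding i(2) by (simp add: add_ac)
  qed
  have "?u k = (if Suc k < m \<and> asc k then b (Suc k) else indet ^ inv_below k \<cdot>\<^sub>v x)" if k: "k < m" for k
  proof (cases "Suc k < m")
    case True
    then show ?thesis using up(2)[of k] down(1)[of k] a[OF k] by simp
  next
    case False
    then have "k = m - 1" using k by simp
    then show ?thesis using False top(1) a[OF k] by simp
  qed
  then have "null_shape v x b"
    using bc sums total by (simp add: null_shape_def)
  then show ?thesis using that by (simp add: x_def)
qed

lemma null_vector_block:
  assumes "v \<in> carrier_vec (m * n)" "pencil *\<^sub>v v = 0\<^sub>v (m * n)"
  shows "matrix_poly m n A *\<^sub>v blocks m n v (run 0 \<alpha> - 1) = 0\<^sub>v n"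
proof -
  obtain b where "null_shape v (blocks m n v (run 0 \<alpha> - 1)) b"
    by (rule null_vector_shape[OF assms])
  then have "(\<Sum>j\<le>m. indet ^ j * coef (blocks m n v (run 0 \<alpha> - 1)) j r) = 0" if "r < n" for r
    using that by (simp add: null_shape_def)
  then show ?thesis
    using matrix_poly_mult[of m A n "blocks m n v (run 0 \<alpha> - 1)"] A
    by (intro eq_vecI) (auto simp: matrix_poly_def)
qed

lemma null_vector_zero:
  assumes v: "v \<in> carrier_vec (m * n)" and null: "pencil *\<^sub>v v = 0\<^sub>v (m * n)"
    and x: "blocks m n v (run 0 \<alpha> - 1) = 0\<^sub>v n"
  shows "v = 0\<^sub>v (m * n)"
proof (rule blocks_eqI[OF v])
  fix k assume k: "k < m"
  obtain b where "null_shape v (0\<^sub>v n) b"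
    using null_vector_shape[OF v null] unfolding x by blast
  then have b: "\<And>k. k < m \<Longrightarrow> b k \<in> carrier_vec n"
    "\<And>k. k < m \<Longrightarrow> blocks m n v k =
        (if Suc k < m \<and> asc k then b (Suc k) else indet ^ inv_below k \<cdot>\<^sub>v 0\<^sub>v n)"
    "\<And>k r. k < m \<Longrightarrow> r < n \<Longrightarrow> indet ^ cons_below k * b k $ r = - (\<Sum>j<k. indet ^ j * coef (0\<^sub>v n) j r)"
    unfolding null_shape_def by blast+
  have "coef (0\<^sub>v n) j r = 0" if "j < m" "r < n" for j r
    using A_below[OF that(1)] that by simp
  then have "b k = 0\<^sub>v n" if "k < m" for k
    using b(1,3)[OF that] that by (intro eq_vecI) auto
  then have "blocks m n v k = 0\<^sub>v n"
    using b(2)[OF k] by (cases "Suc k < m \<and> asc k") auto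
  also have "0\<^sub>v n = blocks m n (0\<^sub>v (m * n)) k"
    using k block_index_less[OF k] by (intro eq_vecI) (auto simp: blocks_def)
  finally show "blocks m n v k = blocks m n (0\<^sub>v (m * n)) k" .
qed simp

text \<open>
  The block \<open>indet ^ inv_below k \<cdot>\<^sub>v x\<close> has degree \<open>vec_degree x + inv_below k\<close>, which is largest at
  the top. A lower input \<open>b (Suc k)\<close> that appears as a block is, up to a power of the
  indeterminate with exponent \<open>cons_below k + 1\<close>, a sum of degree at most \<open>k + vec_degree x\<close>, and
  \<open>k - cons_below k = inv_below k\<close>.
\<close>

lemma null_vector_degree:
  assumes v: "v \<in> carrier_vec (m * n)" and null: "pencil *\<^sub>v v = 0\<^sub>v (m * n)" and nz: "v \<noteq> 0\<^sub>v (m * n)"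
  shows "vec_degree v = vec_degree (blocks m n v (run 0 \<alpha> - 1)) + total_inversions m \<alpha>"
proof -
  define x where "x = blocks m n v (run 0 \<alpha> - 1)"
  have xc: "x \<in> carrier_vec n" and x0: "x \<noteq> 0\<^sub>v n"
    using null_vector_zero[OF v null] nz by (auto simp: x_def)
  obtain b where "null_shape v x b"
    using null_vector_shape[OF v null] unfolding x_def by blast
  then have b: "\<And>k. k < m \<Longrightarrow> b k \<in> carrier_vec n"
    "\<And>k. k < m \<Longrightarrow> blocks m n v k =
        (if Suc k < m \<and> asc k then b (Suc k) else indet ^ inv_below k \<cdot>\<^sub>v x)"
    "\<And>k r. k < m \<Longrightarrow> r < n \<Longrightarrow> indet ^ cons_below k * b k $ r = - (\<Sum>j<k. indet ^ j * coef x j r)"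
    unfolding null_shape_def by blast+
  have cdeg: "degree (coef x j r) \<le> vec_degree x" if "j < m" "r < n" for j r
  proof -
    have "degree (coef x j r) \<le> vec_degree (const_mat (A j) *\<^sub>v x)"
      using A_below[OF that(1)] that by (intro degree_le_vec_degree) simp
    also have "\<dots> \<le> vec_degree x" using A_below[OF that(1)] xc by (rule vec_degree_const_mat_mult)
    finally show ?thesis .
  qed
  have bdeg: "degree (b (Suc k) $ r) \<le> vec_degree x + inv_below k" if k: "Suc k < m" "asc k" and r: "r < n" for k r
  proof (cases "b (Suc k) $ r = 0")
    case False
    have "cons_below (Suc k) + degree (b (Suc k) $ r) = degree (indet ^ cons_below (Suc k) * b (Suc k) $ r)"
      using degree_indet_power_mult[OF False] by simp
    also have "\<dots> = degree (\<Sum>j<Suc k. indet ^ j * coef x j r)"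
      by (simp only: b(3)[OF k(1) r] degree_minus)
    also have "\<dots> \<le> k + vec_degree x"
    proof (rule degree_sum_le)
      fix j assume "j \<in> {..<Suc k}"
      then have j: "j \<le> k" "j < m" using k by auto
      have "degree (indet ^ j * coef x j r) \<le> j + degree (coef x j r)"
        using degree_indet_power_mult[of "coef x j r" j] by (cases "coef x j r = 0") auto
      then show "degree (indet ^ j * coef x j r) \<le> k + vec_degree x"
        using cdeg[OF j(2) r] j(1) by linarith
    qed simp
    finally show ?thesis using cons_plus_inv[of k] k(2) by (simp add: cons_below_Suc)
  qed simp
  have top: "vec_degree (blocks m n v (m - 1)) = vec_degree x + inv_below (m - 1)"
    using b(2)[of "m - 1"] m vec_degree_indet_power[OF xc x0] by simp
  have "vec_degree v = vec_degree x + inv_below (m - 1)"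
  proof (rule antisym)
    show "vec_degree v \<le> vec_degree x + inv_below (m - 1)"
      unfolding vec_degree_blocks_le[OF v]
    proof (intro allI impI)
      fix k assume k: "k < m"
      have mono: "inv_below k \<le> inv_below (m - 1)" using k by (intro inv_below_mono) simp
      show "vec_degree (blocks m n v k) \<le> vec_degree x + inv_below (m - 1)"
      proof (cases "Suc k < m \<and> asc k")
        case True
        then have "vec_degree (blocks m n v k) \<le> vec_degree x + inv_below k"
          using b(1)[of "Suc k"] b(2)[OF k] bdeg[of k] by (auto simp: vec_degree_le_iff)
        then show ?thesis using mono by simp
      next
        case False
        then show ?thesis
          using b(2)[OF k] vec_degree_indet_power[OF xc x0] mono by auto
      qed
    qed
    show "vec_degree x + inv_below (m - 1) \<le> vec_degree v"
      using vec_degree_blocks_le[OF v, of "vec_degree v"] m unfolding top[symmetric] by simp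
  qed
  then show ?thesis by (simp add: x_def total_inversions_eq)
qed

text \<open>
  For a null vector \<open>x\<close> of \<open>P\<close> the sum of the terms with \<open>j < i\<close> is the negative of the sum of those
  with \<open>i \<le> j\<close>, and the latter is visibly divisible by \<open>indet ^ cons_below i\<close>. This shows that the
  lower inputs are polynomial.
\<close>

lemma null_vector_exists:
  assumes x: "x \<in> carrier_vec n" and Px: "matrix_poly m n A *\<^sub>v x = 0\<^sub>v n"
  obtains v where "v \<in> carrier_vec (m * n)" "pencil *\<^sub>v v = 0\<^sub>v (m * n)" "blocks m n v (run 0 \<alpha> - 1) = x"
proof -
  define a where "a i = indet ^ inv_below i \<cdot>\<^sub>v x" for i
  define b where "b i = vec n (\<lambda>r. \<Sum>j\<in>{i..m}. indet ^ (j - cons_below i) * coef x j r)" for i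
  define u where "u i = (if Suc i < m \<and> asc i then b (Suc i) else a i)" for i
  define w where "w i = (if Suc i < m \<and> \<not> asc i then a (Suc i) else f i (a i) (b i))" for i
  define v where "v = unblocks m n u"
  have ac: "a i \<in> carrier_vec n" for i using x by (simp add: a_def)
  have bc: "b i \<in> carrier_vec n" for i by (simp add: b_def)
  have v: "v \<in> carrier_vec (m * n)" by (simp add: v_def)
  have bv: "blocks m n v k = u k" if "k < m" for k
    unfolding v_def by (rule blocks_unblocks[OF that]) (simp add: u_def ac bc)
  have b0: "b 0 = 0\<^sub>v n"
  proof (rule eq_vecI)
    fix r assume "r < dim_vec (0\<^sub>v n :: complex poly vec)"
    then have r: "r < n" by simp
    then have "(\<Sum>j\<le>m. indet ^ j * coef x j r) = 0"
      using matrix_poly_mult[of m A n x r] A x Px by simp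
    then show "b 0 $ r = 0\<^sub>v n $ r" using r by (simp add: b_def cons_below_0 atMost_atLeast0)
  qed (simp add: b_def)
  have out: "f i (a i) (b i) $ r = (\<Sum>j\<in>{Suc i..m}. indet ^ (j - cons_below i) * coef x j r)"
    if i: "i < m" and r: "r < n" for i r
  proof -
    have "i - cons_below i = inv_below i" using cons_plus_inv[of i] by linarith
    moreover have "b i $ r = indet ^ (i - cons_below i) * coef x i r
        + (\<Sum>j\<in>{Suc i..m}. indet ^ (j - cons_below i) * coef x j r)"
      using i r by (simp add: b_def sum.atLeast_Suc_atMost)
    ultimately show ?thesis
      using f_index[OF i ac bc r] coef_smult[OF _ x r, of i] i by (simp add: a_def)
  qed
  have le: "cons_below i \<le> i" for i using cons_plus_inv[of i] by linarith
  have step: "f i (a i) (b i) = (if asc i then indet \<cdot>\<^sub>v b (Suc i) else b (Suc i))" if i: "i < m" for i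
  proof (rule eq_vecI)
    fix r assume "r < dim_vec (if asc i then indet \<cdot>\<^sub>v b (Suc i) else b (Suc i))"
    then have r: "r < n" by (simp add: b_def split: if_splits)
    have "indet ^ (j - cons_below i) = indet * indet ^ (j - Suc (cons_below i))" if "j \<in> {Suc i..m}" for j
    proof -
      have "j - cons_below i = Suc (j - Suc (cons_below i))" using that le[of i] by auto
      then show ?thesis by (simp only: power_Suc)
    qed
    then have "(\<Sum>j\<in>{Suc i..m}. indet ^ (j - cons_below i) * coef x j r)
        = indet * (\<Sum>j\<in>{Suc i..m}. indet ^ (j - Suc (cons_below i)) * coef x j r)"
      unfolding sum_distrib_left by (intro sum.cong) (simp_all only: mult.assoc)
    then show "f i (a i) (b i) $ r = (if asc i then indet \<cdot>\<^sub>v b (Suc i) else b (Suc i)) $ r"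
      unfolding out[OF i r] using r by (simp add: b_def cons_below_Suc)
  qed (use bc[of i] ac[of i] A_below[OF i] in \<open>simp add: b_def\<close>)
  have "flow (0\<^sub>v n) f m \<alpha> a b u w"
    unfolding flow_def
  proof (intro conjI allI impI)
    fix i assume i: "Suc i < m"
    show "if asc i then a i = a (Suc i) \<and> b (Suc i) = u i \<and> w i = f i (a i) (b i)
      else a i = u i \<and> b (Suc i) = f i (a i) (b i) \<and> w i = a (Suc i)"
      using i step[of i] by (auto simp: u_def w_def a_def inv_below_Suc)
  qed (use m b0 in \<open>auto simp: u_def w_def\<close>)
  then have fl: "flow (0\<^sub>v n) f m \<alpha> a b (blocks m n v) w"
    using bv m unfolding flow_def by simp
  obtain a' b' where fl': "flow (0\<^sub>v n) f m \<alpha> a' b' (blocks m n v) (blocks m n (M\<alpha> *\<^sub>v v))"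
    using flow_blocks[OF v] .
  have "pencil *\<^sub>v v = 0\<^sub>v (m * n)"
    unfolding pencil_null_iff[OF v]
  proof (intro allI impI)
    fix k assume k: "k < m"
    have "blocks m n (M\<alpha> *\<^sub>v v) k = w k" by (rule flow_unique[OF fl' fl k])
    also have "\<dots> = indet \<cdot>\<^sub>v blocks m n (D *\<^sub>v v) k"
    proof (cases "k = m - 1")
      case True
      then have "w k = f k (a k) (b k)" using m by (simp add: w_def)
      also have "\<dots> = indet \<cdot>\<^sub>v (const_mat (A m) *\<^sub>v a k)"
      proof (rule eq_vecI)
        fix r assume "r < dim_vec (indet \<cdot>\<^sub>v (const_mat (A m) *\<^sub>v a k))"
        then have r: "r < n" using A[OF order_refl] by simp
        have "m - cons_below k = Suc (inv_below k)" using cons_plus_inv[of k] True m by linarith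
        moreover have "{Suc k..m} = {m}" using True m by auto
        ultimately show "f k (a k) (b k) $ r = (indet \<cdot>\<^sub>v (const_mat (A m) *\<^sub>v a k)) $ r"
          unfolding out[OF k r] using coef_smult[OF order_refl x r] A[OF order_refl] r
          by (simp add: a_def mult.assoc)
      qed (use A[OF order_refl] bc[of k] in simp)
      also have "a k = blocks m n v k" using True m bv[OF k] by (simp add: u_def)
      finally show ?thesis unfolding D_mult[OF v k] using True by simp
    next
      case False
      then have "Suc k < m" using k by simp
      then show ?thesis
        using False step[OF k] bv[OF k]
        by (auto simp: D_mult[OF v k] u_def w_def a_def inv_below_Suc smult_smult_assoc)
    qed
    finally show "blocks m n (M\<alpha> *\<^sub>v v) k = indet \<cdot>\<^sub>v blocks m n (D *\<^sub>v v) k" .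
  qed
  moreover have "blocks m n v (run 0 \<alpha> - 1) = x"
    using flow_first[OF fl] by (simp add: a_def inv_below_0)
  ultimately show ?thesis using that v by blast
qed

end

section \<open>Reduction of an EGFP to a Fiedler pencil\<close>

lemma fiedler_mat_carrier:
  assumes "\<And>i. i \<le> m \<Longrightarrow> A i \<in> carrier_mat n n" "i < m"
  shows "fiedler_mat m n A i \<in> carrier_mat (m * n) (m * n)"
  using assms(1)[of i] assms(2) elem_mat_carrier[of "- A i" n i m] by (simp add: fiedler_mat_below)

lemma fiedler_mat_neg_carrier:
  assumes "\<And>i. i \<le> m \<Longrightarrow> A i \<in> carrier_mat n n" "0 < i" "i \<le> m"
  shows "fiedler_mat_neg m n A (Neg i) \<in> carrier_mat (m * n) (m * n)"
  using assms(1)[of i] assms(2,3) elem_mat_neg_carrier[of "A i" n i m] by (simp add: fiedler_mat_neg_pos)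

lemma fiedler_prod_append:
  assumes "\<And>i. i \<le> m \<Longrightarrow> A i \<in> carrier_mat n n" "set s \<subseteq> {..<m}" "set t \<subseteq> {..<m}"
  shows "fiedler_prod m n A (s @ t) = fiedler_prod m n A s * fiedler_prod m n A t"
proof -
  have "set (map (fiedler_mat m n A) u) \<subseteq> carrier_mat (m * n) (m * n)" if "set u \<subseteq> {..<m}" for u
    using that fiedler_mat_carrier[of m A n] assms(1) by auto
  then show ?thesis using assms(2,3) by (simp add: fiedler_prod_def mat_prod_append)
qed

lemma fiedler_prod_single:
  assumes "\<And>i. i \<le> m \<Longrightarrow> A i \<in> carrier_mat n n" "i < m"
  shows "fiedler_prod m n A [i] = elem_mat m n i (- A i)"
  using fiedler_mat_carrier[of m A n i] assms
  by (simp add: fiedler_prod_def mat_prod_Cons mat_prod_Nil fiedler_mat_below)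

lemma fiedler_neg_carriers:
  assumes "\<And>i. i \<le> m \<Longrightarrow> A i \<in> carrier_mat n n" "set s \<subseteq> {0<..m}"
  shows "set (map (fiedler_mat_neg m n A) (map Neg s)) \<subseteq> carrier_mat (m * n) (m * n)"
proof
  fix M assume "M \<in> set (map (fiedler_mat_neg m n A) (map Neg s))"
  then obtain i where "i \<in> set s" "M = fiedler_mat_neg m n A (Neg i)" by auto
  then show "M \<in> carrier_mat (m * n) (m * n)"
    using fiedler_mat_neg_carrier[of m A n i] assms by auto
qed

lemma fiedler_prod_neg_append:
  assumes A: "\<And>i. i \<le> m \<Longrightarrow> A i \<in> carrier_mat n n" and "set s \<subseteq> {0<..m}" "set t \<subseteq> {0<..m}"
  shows "fiedler_prod_neg m n A (map Neg (s @ t))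
    = fiedler_prod_neg m n A (map Neg s) * fiedler_prod_neg m n A (map Neg t)"
  using fiedler_neg_carriers[of m A n s] fiedler_neg_carriers[of m A n t] assms
  by (simp only: fiedler_prod_neg_def map_append mat_prod_append)

lemma fiedler_prod_neg_carrier:
  assumes "\<And>i. i \<le> m \<Longrightarrow> A i \<in> carrier_mat n n" "set s \<subseteq> {0<..m}"
  shows "fiedler_prod_neg m n A (map Neg s) \<in> carrier_mat (m * n) (m * n)"
  unfolding fiedler_prod_neg_def using assms by (intro mat_prod_carrier fiedler_neg_carriers)

lemma fiedler_prod_neg_single:
  assumes "\<And>i. i \<le> m \<Longrightarrow> A i \<in> carrier_mat n n" "0 < i" "i \<le> m"
  shows "fiedler_prod_neg m n A (map Neg [i]) = elem_mat_neg m n (Neg i) (A i)"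
  using fiedler_mat_neg_carrier[of m A n i] assms
  by (simp add: fiedler_prod_neg_def mat_prod_Cons mat_prod_Nil fiedler_mat_neg_pos)

lemma sandwich:
  fixes B C D E :: "complex mat"
  assumes "B \<in> carrier_mat N N" "C \<in> carrier_mat N N" "D \<in> carrier_mat N N" "E \<in> carrier_mat N N"
    and "C * D = 1\<^sub>m N" "B * E = 1\<^sub>m N"
  shows "(B * C) * (D * E) = 1\<^sub>m N"
proof -
  have "(B * C) * (D * E) = B * (C * (D * E))" by (rule assoc_mult_mat) (use assms in auto)
  also have "C * (D * E) = (C * D) * E" by (rule assoc_mult_mat[symmetric]) (use assms in auto)
  finally show ?thesis using assms by simp
qed

lemma fiedler_prod_neg_inverse:
  assumes A: "\<And>i. i \<le> m \<Longrightarrow> A i \<in> carrier_mat n n" and s: "set s \<subseteq> {0<..<m}"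
  shows "fiedler_prod m n A (rev s) * fiedler_prod_neg m n A (map Neg s) = 1\<^sub>m (m * n) \<and>
    fiedler_prod_neg m n A (map Neg s) * fiedler_prod m n A (rev s) = 1\<^sub>m (m * n)"
  using s
proof (induction s)
  case Nil
  then show ?case by (simp add: fiedler_prod_def fiedler_prod_neg_def mat_prod_Nil)
next
  case (Cons i s)
  then have i: "0 < i" "i < m" "i \<le> m" and s: "set s \<subseteq> {0<..<m}" "set s \<subseteq> {0<..m}" "set (rev s) \<subseteq> {..<m}"
    by auto
  have Ai: "A i \<in> carrier_mat n n" "- A i \<in> carrier_mat n n" using A[OF i(3)] by auto
  have 1: "fiedler_prod m n A (rev (i # s)) = fiedler_prod m n A (rev s) * elem_mat m n i (- A i)"
    using fiedler_prod_append[of m A n "rev s" "[i]", OF A s(3)] fiedler_prod_single[of m A n i, OF A i(2)] i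
    by simp
  have 2: "fiedler_prod_neg m n A (map Neg (i # s))
      = elem_mat_neg m n (Neg i) (A i) * fiedler_prod_neg m n A (map Neg s)"
    using fiedler_prod_neg_append[of m A n "[i]" s, OF A _ s(2)] fiedler_prod_neg_single[of m A n i, OF A i(1,3)] i
    by simp
  note c = elem_mat_carrier[OF Ai(2) i(2)] elem_mat_neg_carrier[OF Ai(1) i(1,3)]
    fiedler_prod_carrier[of m A n "rev s", OF A s(3)] fiedler_prod_neg_carrier[of m A n s, OF A s(2)]
  note inv = elem_mat_neg_inverse[OF Ai(1) i(1,2)]
  show ?case
    unfolding 1 2 using Cons.IH[OF s(1)] sandwich[OF c(3,1,2,4) inv(1)] sandwich[OF c(2,4,3,1) _ inv(2)]
    by blast
qed

lemma fiedler_prod_neg_gl: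
  assumes A: "\<And>i. i \<le> m \<Longrightarrow> A i \<in> carrier_mat n n" and s: "set s \<subseteq> {0<..<m}"
  shows "fiedler_prod_neg m n A (map Neg s) \<in> gl_mat (m * n)"
proof (rule gl_matI)
  have 1: "set s \<subseteq> {0<..m}" "set (rev s) \<subseteq> {..<m}" using s by auto
  show "fiedler_prod_neg m n A (map Neg s) \<in> carrier_mat (m * n) (m * n)"
    by (rule fiedler_prod_neg_carrier[of m A n s, OF A 1(1)])
  show "fiedler_prod m n A (rev s) \<in> carrier_mat (m * n) (m * n)"
    by (rule fiedler_prod_carrier[of m A n "rev s", OF A 1(2)])
qed (use fiedler_prod_neg_inverse[of m A n s, OF A s] in auto)

lemma elem_prod_gl:
  assumes t: "set t \<subseteq> {..<m}" and X: "matrix_assignment n t X" and ns: "nonsingular_assignment m t X"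
  shows "elem_prod m n t X \<in> gl_mat (m * n)"
  unfolding elem_prod_def
proof (rule mat_prod_gl, rule subsetI)
  fix M assume "M \<in> set (map2 (elem_mat m n) t X)"
  then obtain k where k: "k < length t" "M = elem_mat m n (t ! k) (X ! k)"
    using X unfolding matrix_assignment_def by (auto simp: in_set_conv_nth)
  have "X ! k \<in> carrier_mat n n" using X k(1) unfolding matrix_assignment_def by auto
  moreover have "t ! k < m" using subsetD[OF t nth_mem[OF k(1)]] by simp
  moreover have "t ! k = 0 \<Longrightarrow> invertible_mat (X ! k)" using ns k(1) unfolding nonsingular_assignment_def by auto
  ultimately show "M \<in> gl_mat (m * n)" unfolding k(2) by (rule elem_mat_gl)
qed

lemma elem_prod_neg_gl:
  assumes t: "set t \<subseteq> Neg ` {0<..m}" and X: "matrix_assignment n t X"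
    and ns: "nonsingular_assignment_neg m t X"
  shows "elem_prod_neg m n t X \<in> gl_mat (m * n)"
  unfolding elem_prod_neg_def
proof (rule mat_prod_gl, rule subsetI)
  fix M assume "M \<in> set (map2 (elem_mat_neg m n) t X)"
  then obtain k where k: "k < length t" "M = elem_mat_neg m n (t ! k) (X ! k)"
    using X unfolding matrix_assignment_def by (auto simp: in_set_conv_nth)
  have Xk: "X ! k \<in> carrier_mat n n" using X k(1) unfolding matrix_assignment_def by auto
  have "t ! k \<in> Neg ` {0<..m}" by (rule subsetD[OF t nth_mem[OF k(1)]])
  then obtain i where i: "t ! k = Neg i" "0 < i" "i \<le> m" by auto
  have "i = m \<Longrightarrow> invertible_mat (X ! k)" using ns k(1) i unfolding nonsingular_assignment_neg_def by auto
  then show "M \<in> gl_mat (m * n)" unfolding k(2) i(1) using elem_mat_neg_gl[OF Xk i(2,3)] by blast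
qed

lemma matrix_assignment_ConsE:
  assumes "matrix_assignment n (x # t) X"
  obtains Y Ys where "X = Y # Ys" "Y \<in> carrier_mat n n" "matrix_assignment n t Ys"
  using assms unfolding matrix_assignment_def by (cases X) auto

lemma elem_prod_carrier:
  assumes "set t \<subseteq> {..<m}" "matrix_assignment n t X"
  shows "elem_prod m n t X \<in> carrier_mat (m * n) (m * n)"
  using assms
proof (induction t arbitrary: X)
  case (Cons x t)
  obtain Y Ys where X: "X = Y # Ys" "Y \<in> carrier_mat n n" "matrix_assignment n t Ys"
    using Cons.prems(2) by (rule matrix_assignment_ConsE)
  have "elem_mat m n x Y \<in> carrier_mat (m * n) (m * n)"
    using elem_mat_carrier[OF X(2)] Cons.prems(1) by simp
  then show ?case
    using mult_carrier_mat[OF _ Cons.IH[OF _ X(3)]] Cons.prems(1) X(1)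
    by (simp add: elem_prod_def mat_prod_Cons)
qed (simp add: elem_prod_def mat_prod_Nil)

lemma elem_prod_neg_carrier:
  assumes "set t \<subseteq> Neg ` {0<..m}" "matrix_assignment n t X"
  shows "elem_prod_neg m n t X \<in> carrier_mat (m * n) (m * n)"
  using assms
proof (induction t arbitrary: X)
  case (Cons x t)
  obtain Y Ys where X: "X = Y # Ys" "Y \<in> carrier_mat n n" "matrix_assignment n t Ys"
    using Cons.prems(2) by (rule matrix_assignment_ConsE)
  have "elem_mat_neg m n x Y \<in> carrier_mat (m * n) (m * n)"
    using elem_mat_neg_carrier[OF X(2)] Cons.prems(1) by auto
  then show ?case
    using mult_carrier_mat[OF _ Cons.IH[OF _ X(3)]] Cons.prems(1) X(1)
    by (simp add: elem_prod_neg_def mat_prod_Cons)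
qed (simp add: elem_prod_neg_def mat_prod_Nil)

text \<open>
  A factor $M_i(X)$ moves block \<open>i\<close> down to \<open>i - 1\<close>, so that the block selected after multiplication
  comes from one further up, exactly as the greedy scan advances. Only a repetition of the
  index that was found last would bring the arbitrary matrix \<open>X\<close> into play. The SIP demands its
  successor in between, but the scan would have advanced at this successor.
\<close>

lemma select_elem_prod:
  assumes "sip (\<rho> @ \<pi> @ t)" "0 < run 0 \<pi>" "set t \<subseteq> {..<m}" "matrix_assignment n t X"
    and v: "v \<in> carrier_vec (m * n)"
  shows "blocks m n (const_mat (elem_prod m n t X) *\<^sub>v v) (run 0 \<pi> - 1) = blocks m n v (run 0 (\<pi> @ t) - 1)"
  using assms(1-4)
proof (induction t arbitrary: \<pi> X)
  case Nil
  then show ?case using v by (simp add: elem_prod_def mat_prod_Nil const_one_mult_vec)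
next
  case (Cons x t)
  obtain Y Ys where X: "X = Y # Ys" "Y \<in> carrier_mat n n" "matrix_assignment n t Ys"
    using Cons.prems(4) by (rule matrix_assignment_ConsE)
  have x: "x < m" and t: "set t \<subseteq> {..<m}" using Cons.prems(3) by auto
  let ?u = "const_mat (elem_prod m n t Ys) *\<^sub>v v"
  note c = elem_prod_carrier[OF t X(3)]
  have u: "?u \<in> carrier_vec (m * n)" using c v by simp
  have "const_mat (elem_prod m n (x # t) X) *\<^sub>v v = const_mat (elem_mat m n x Y) *\<^sub>v ?u"
    using const_mat_mult_vec[OF elem_mat_carrier[OF X(2) x] c v] X(1)
    by (simp add: elem_prod_def mat_prod_Cons)
  then have step: "blocks m n (const_mat (elem_prod m n (x # t) X) *\<^sub>v v)
      = factor_step (0\<^sub>v n) (\<lambda>_ a b. const_mat Y *\<^sub>v a + b) x (blocks m n ?u)"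
    by (simp only: const_poly.blocks_elem_mat_mult[OF X(2) u x])
  have "sip (\<rho> @ (\<pi> @ [x]) @ t)" using Cons.prems(1) by simp
  then have IH: "0 < run 0 (\<pi> @ [x]) \<Longrightarrow> blocks m n ?u (run 0 (\<pi> @ [x]) - 1) = blocks m n v (run 0 ((\<pi> @ [x]) @ t) - 1)"
    using Cons.IH[of "\<pi> @ [x]" Ys] t X(3) by blast
  obtain k where k: "run 0 \<pi> = Suc k" using Cons.prems(2) gr0_conv_Suc by auto
  show ?case
  proof (cases "x = Suc k")
    case True
    then have "run 0 (\<pi> @ [x]) = Suc (Suc k)" using k by (simp add: run_append)
    moreover have "blocks m n (const_mat (elem_prod m n (x # t) X) *\<^sub>v v) k = blocks m n ?u (Suc k)"
      unfolding step by (simp only: True factor_step_below)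
    ultimately show ?thesis using IH k by simp
  next
    case False
    then have r: "run 0 (\<pi> @ [x]) = Suc k" using k by (simp add: run_append)
    have "x \<noteq> k"
    proof
      assume xk: "x = k"
      obtain ys zs where "\<pi> = ys @ k # zs" "Suc k \<notin> set zs" using run_zero_split[OF k] by blast
      with sip_between[of "\<rho> @ ys" k zs t] Cons.prems(1) xk show False by simp
    qed
    then have "blocks m n (const_mat (elem_prod m n (x # t) X) *\<^sub>v v) k = blocks m n ?u k"
      unfolding step using False by (intro factor_step_other) auto
    then show ?thesis using IH r k by simp
  qed
qed

lemma select_elem_prod_neg:
  assumes "set t \<subseteq> Neg ` {0<..m}" "Neg k \<notin> set t" "Neg (Suc k) \<notin> set t" "matrix_assignment n t X"
    and v: "v \<in> carrier_vec (m * n)" and k: "k < m"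
  shows "blocks m n (const_mat (elem_prod_neg m n t X) *\<^sub>v v) k = blocks m n v k"
  using assms(1-4)
proof (induction t arbitrary: X)
  case Nil
  then show ?case using v by (simp add: elem_prod_neg_def mat_prod_Nil const_one_mult_vec)
next
  case (Cons x t)
  obtain Y Ys where X: "X = Y # Ys" "Y \<in> carrier_mat n n" "matrix_assignment n t Ys"
    using Cons.prems(4) by (rule matrix_assignment_ConsE)
  have t: "set t \<subseteq> Neg ` {0<..m}" using Cons.prems(1) by simp
  obtain i where i: "x = Neg i" "0 < i" "i \<le> m" using Cons.prems(1) by auto
  let ?u = "const_mat (elem_prod_neg m n t Ys) *\<^sub>v v"
  note c = elem_prod_neg_carrier[OF t X(3)]
  have u: "?u \<in> carrier_vec (m * n)" using c v by simp
  have step: "const_mat (elem_prod_neg m n (x # t) X) *\<^sub>v v = const_mat (elem_mat_neg m n (Neg i) Y) *\<^sub>v ?u"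
    using const_mat_mult_vec[OF elem_mat_neg_carrier[OF X(2) i(2,3)] c v] X(1) i(1)
    by (simp add: elem_prod_neg_def mat_prod_Cons)
  have "k \<noteq> i" "Suc k \<noteq> i" using Cons.prems(2,3) i(1) by auto
  then have "blocks m n (const_mat (elem_prod_neg m n (x # t) X) *\<^sub>v v) k = blocks m n ?u k"
    unfolding step const_poly.blocks_elem_mat_neg_mult[OF X(2) u i(2,3) k] using k by auto
  then show ?case using Cons.IH[OF t _ _ X(3)] Cons.prems(2,3) by simp
qed

text \<open>
  The inverses $M_{-i}$ undo the shift: read backwards, the tuple takes the selected block down
  through the indices by which the scan of \<open>s\<close> went up.
\<close>

lemma select_fiedler_prod_neg:
  assumes A: "\<And>i. i \<le> m \<Longrightarrow> A i \<in> carrier_mat n n"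
    and "distinct s" "set s \<subseteq> {0<..<m}" "k \<notin> set s" "k < m" "w \<in> carrier_vec (m * n)"
  shows "blocks m n (const_mat (fiedler_prod_neg m n A (map Neg (rev s))) *\<^sub>v w) (run (Suc k) s - 1)
    = blocks m n w k"
  using assms(2-)
proof (induction s arbitrary: k w)
  case Nil
  then show ?case by (simp add: fiedler_prod_neg_def mat_prod_Nil const_one_mult_vec)
next
  case (Cons x s)
  have x: "0 < x" "x < m" "x \<le> m" and s: "distinct s" "set s \<subseteq> {0<..<m}" "set (rev s) \<subseteq> {0<..m}" "x \<notin> set s" "k \<notin> set s"
    using Cons.prems by auto
  let ?u = "const_mat (elem_mat_neg m n (Neg x) (A x)) *\<^sub>v w"
  note Ax = A[OF x(3)]
  note c = elem_mat_neg_carrier[OF Ax x(1,3)] fiedler_prod_neg_carrier[of m A n "rev s", OF A s(3)]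
  have u: "?u \<in> carrier_vec (m * n)" using c Cons.prems(5) by simp
  have "fiedler_prod_neg m n A (map Neg (rev (x # s)))
      = fiedler_prod_neg m n A (map Neg (rev s)) * elem_mat_neg m n (Neg x) (A x)"
    using fiedler_prod_neg_append[of m A n "rev s" "[x]", OF A s(3)]
      fiedler_prod_neg_single[of m A n x, OF A x(1,3)] x by simp
  then have step: "const_mat (fiedler_prod_neg m n A (map Neg (rev (x # s)))) *\<^sub>v w
      = const_mat (fiedler_prod_neg m n A (map Neg (rev s))) *\<^sub>v ?u"
    using const_mat_mult_vec[OF c(2,1) Cons.prems(5)] by simp
  note b = const_poly.blocks_elem_mat_neg_mult[OF Ax Cons.prems(5) x(1,3)]
  show ?case
  proof (cases "x = Suc k")
    case True
    have "run (Suc k) (x # s) = run (Suc x) s" using True by simp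
    then have "blocks m n (const_mat (fiedler_prod_neg m n A (map Neg (rev (x # s)))) *\<^sub>v w) (run (Suc k) (x # s) - 1)
        = blocks m n ?u x"
      unfolding step using Cons.IH[OF s(1,2,4) x(2) u] by simp
    also have "\<dots> = blocks m n w k" using b[OF x(2)] x True by simp
    finally show ?thesis .
  next
    case False
    then have "run (Suc k) (x # s) = run (Suc k) s" by simp
    then have "blocks m n (const_mat (fiedler_prod_neg m n A (map Neg (rev (x # s)))) *\<^sub>v w) (run (Suc k) (x # s) - 1)
        = blocks m n ?u k"
      unfolding step using Cons.IH[OF s(1,2,5) Cons.prems(4) u] by simp
    also have "\<dots> = blocks m n w k" using b[OF Cons.prems(4)] x False Cons.prems(3) by auto
    finally show ?thesis .
  qed
qed

lemma block_row_selector_carrier: "block_row_selector m n j \<in> carrier_mat n (m * n)"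
  by (simp add: block_row_selector_def kronecker_def mat_of_row_def)

lemma block_row_selector_mult:
  assumes z: "z \<in> carrier_vec (m * n)" and k: "k < m"
  shows "block_row_selector m n (m - k) *\<^sub>v z = blocks m n z k"
proof (rule eq_vecI)
  fix r assume "r < dim_vec (blocks m n z k)"
  then have r: "r < n" by simp
  let ?j = "(m - Suc k) * n + r"
  have entry: "block_row_selector m n (m - k) $$ (r, j) = (if j = ?j then 1 else 0)" if j: "j < m * n" for j
  proof -
    have q: "j div n < m" using j by (simp add: less_mult_imp_div_less)
    have n: "0 < n" using r by simp
    have "j = ?j \<longleftrightarrow> j div n = m - Suc k \<and> j mod n = r"
    proof
      assume "j = ?j"
      then show "j div n = m - Suc k \<and> j mod n = r" using r by simp
    next
      assume "j div n = m - Suc k \<and> j mod n = r"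
      then show "j = ?j" by (metis div_mult_mod_eq)
    qed
    then show ?thesis
      using j q r n k by (auto simp: block_row_selector_def kronecker_def mat_of_row_def)
  qed
  have "(block_row_selector m n (m - k) *\<^sub>v z) $ r = (\<Sum>j<m * n. (if j = ?j then 1 else 0) * z $ j)"
    using block_row_selector_carrier[of m n "m - k"] z r entry
    by (simp add: scalar_prod_def atLeast0LessThan)
  also have "\<dots> = (\<Sum>j<m * n. if j = ?j then z $ j else 0)" by (intro sum.cong) auto
  also have "\<dots> = z $ ?j" using block_index_less[OF k r] by simp
  finally show "(block_row_selector m n (m - k) *\<^sub>v z) $ r = blocks m n z k $ r"
    using k r by (simp add: blocks_def)
qed (use block_row_selector_carrier[of m n "m - k"] in simp)

text \<open>
  Evaluation of the determinant at \<open>0\<close>. For a singular polynomial this excludes the index $-0$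
  from \<open>\<tau>\<close>.
\<close>

lemma det_matrix_poly_nonzero:
  assumes A0: "A 0 \<in> carrier_mat n n" and inv: "invertible_mat (A 0)"
  shows "det (matrix_poly m n A) \<noteq> 0"
proof -
  interpret ev: comm_ring_hom "\<lambda>p. poly p (0 :: complex)" by unfold_locales auto
  have "map_mat (\<lambda>p. poly p 0) (matrix_poly m n A) = A 0"
  proof (rule eq_matI)
    fix i j assume "i < dim_row (A 0)" "j < dim_col (A 0)"
    then have "i < n" "j < n" using A0 by auto
    have "(\<Sum>k\<le>m. poly (monom (A k $$ (i, j)) k) 0) = (\<Sum>k\<le>m. if k = 0 then A 0 $$ (i, j) else 0)"
      by (intro sum.cong) (auto simp: poly_monom)
    then show "map_mat (\<lambda>p. poly p 0) (matrix_poly m n A) $$ (i, j) = A 0 $$ (i, j)"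
      using \<open>i < n\<close> \<open>j < n\<close> by (simp add: matrix_poly_def poly_sum)
  qed (use A0 in \<open>auto simp: matrix_poly_def\<close>)
  then have "det (A 0) = poly (det (matrix_poly m n A)) 0" using ev.hom_det[of "matrix_poly m n A"] by simp
  moreover obtain B where "B \<in> carrier_mat n n" "A 0 * B = 1\<^sub>m n"
    by (rule invertible_matE[OF inv A0])
  then have "det (A 0) * det B = 1" using det_mult[OF A0, of B] by simp
  ultimately show ?thesis by (metis mult_zero_left poly_0 zero_neq_one)
qed

lemma const_mat_gl_inverse:
  assumes "C \<in> gl_mat N"
  shows "\<exists>C' \<in> carrier_mat N N. \<forall>v \<in> carrier_vec N.
    const_mat C' *\<^sub>v (const_mat C *\<^sub>v v) = v \<and> const_mat C *\<^sub>v (const_mat C' *\<^sub>v v) = v"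
proof -
  obtain C' where C': "C \<in> carrier_mat N N" "C' \<in> carrier_mat N N" "C * C' = 1\<^sub>m N" "C' * C = 1\<^sub>m N"
    using assms unfolding gl_mat_def by blast
  show ?thesis
  proof (intro bexI[OF _ C'(2)] ballI conjI)
    fix v :: "complex poly vec" assume v: "v \<in> carrier_vec N"
    show "const_mat C' *\<^sub>v (const_mat C *\<^sub>v v) = v"
      using const_mat_mult_vec[OF C'(2,1) v] const_one_mult_vec[OF v] C'(4) by simp
    show "const_mat C *\<^sub>v (const_mat C' *\<^sub>v v) = v"
      using const_mat_mult_vec[OF C'(1,2) v] const_one_mult_vec[OF v] C'(3) by simp
  qed
qed

lemma vec_degree_const_gl:
  assumes "C \<in> gl_mat N" "v \<in> carrier_vec N"
  shows "vec_degree (const_mat C *\<^sub>v v) = vec_degree v"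
proof (rule antisym)
  have C: "C \<in> carrier_mat N N" using gl_mat_carrier assms(1) .
  show "vec_degree (const_mat C *\<^sub>v v) \<le> vec_degree v" by (rule vec_degree_const_mat_mult[OF C assms(2)])
  obtain C' where C': "C' \<in> carrier_mat N N" "const_mat C' *\<^sub>v (const_mat C *\<^sub>v v) = v"
    using const_mat_gl_inverse[OF assms(1)] assms(2) by blast
  have "const_mat C *\<^sub>v v \<in> carrier_vec N" using C assms(2) by simp
  then show "vec_degree v \<le> vec_degree (const_mat C *\<^sub>v v)"
    using vec_degree_const_mat_mult[OF C'(1)] C'(2) by metis
qed

lemma mult_mat_smult_vec:
  fixes c :: "'a::comm_ring_1"
  assumes "M \<in> carrier_mat k l" "v \<in> carrier_vec l"
  shows "M *\<^sub>v (c \<cdot>\<^sub>v v) = c \<cdot>\<^sub>v (M *\<^sub>v v)"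
  using assms by (intro eq_vecI) auto

lemma mult_vec_zero_right: "C \<in> carrier_mat k l \<Longrightarrow> C *\<^sub>v 0\<^sub>v l = 0\<^sub>v k"
  for C :: "'a::semiring_1 mat"
  by (intro eq_vecI) auto

lemma transfer_equivalent_pencil:
  fixes F :: "complex poly mat"
  assumes F: "F \<in> carrier_mat N N" and U: "U \<in> gl_mat N" and V: "V \<in> gl_mat N"
    and L: "L \<in> carrier_mat N N" and P: "P \<in> carrier_mat n n" and S: "S \<in> carrier_mat n N"
    and LF: "\<And>z. z \<in> carrier_vec N \<Longrightarrow> L *\<^sub>v z = const_mat U *\<^sub>v (F *\<^sub>v (const_mat V *\<^sub>v z))"
    and SB: "\<And>z. z \<in> carrier_vec N \<Longrightarrow> S *\<^sub>v z = B (const_mat V *\<^sub>v z)"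
    and into: "\<And>v. v \<in> carrier_vec N \<Longrightarrow> F *\<^sub>v v = 0\<^sub>v N \<Longrightarrow> P *\<^sub>v B v = 0\<^sub>v n"
    and inj: "\<And>v. v \<in> carrier_vec N \<Longrightarrow> F *\<^sub>v v = 0\<^sub>v N \<Longrightarrow> B v = 0\<^sub>v n \<Longrightarrow> v = 0\<^sub>v N"
    and surj: "\<And>x. x \<in> carrier_vec n \<Longrightarrow> P *\<^sub>v x = 0\<^sub>v n \<Longrightarrow>
                 \<exists>v \<in> carrier_vec N. F *\<^sub>v v = 0\<^sub>v N \<and> B v = x"
    and deg: "\<And>v. v \<in> carrier_vec N \<Longrightarrow> F *\<^sub>v v = 0\<^sub>v N \<Longrightarrow> v \<noteq> 0\<^sub>v N \<Longrightarrow>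
                 vec_degree v = vec_degree (B v) + d"
  shows "null_space_transfer L P S N N n n d"
proof -
  obtain U' where U': "U' \<in> carrier_mat N N"
    "\<And>v. v \<in> carrier_vec N \<Longrightarrow> const_mat U' *\<^sub>v (const_mat U *\<^sub>v v) = v"
    using const_mat_gl_inverse[OF U] by blast
  obtain V' where V': "V' \<in> carrier_mat N N"
    "\<And>v. v \<in> carrier_vec N \<Longrightarrow> const_mat V' *\<^sub>v (const_mat V *\<^sub>v v) = v"
    "\<And>v. v \<in> carrier_vec N \<Longrightarrow> const_mat V *\<^sub>v (const_mat V' *\<^sub>v v) = v"
    using const_mat_gl_inverse[OF V] by blast
  have c: "const_mat U \<in> carrier_mat N N" "const_mat V \<in> carrier_mat N N"
    "const_mat U' \<in> carrier_mat N N" "const_mat V' \<in> carrier_mat N N"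
    using gl_mat_carrier[OF U] gl_mat_carrier[OF V] U'(1) V'(1) by auto
  have Vc: "const_mat V *\<^sub>v z \<in> carrier_vec N" if "z \<in> carrier_vec N" for z
    using c(2) that by simp
  have null: "F *\<^sub>v (const_mat V *\<^sub>v z) = 0\<^sub>v N" if z: "z \<in> carrier_vec N" "L *\<^sub>v z = 0\<^sub>v N" for z
  proof -
    have Fc: "F *\<^sub>v (const_mat V *\<^sub>v z) \<in> carrier_vec N" using F Vc[OF z(1)] by simp
    have "const_mat U *\<^sub>v (F *\<^sub>v (const_mat V *\<^sub>v z)) = 0\<^sub>v N" using LF[OF z(1)] z(2) by simp
    then show ?thesis using U'(2)[OF Fc] mult_vec_zero_right[OF c(3)] by simp
  qed
  show ?thesis
  proof (unfold_locales, fact L, fact P, fact S)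
    fix z assume z: "z \<in> carrier_vec N" "L *\<^sub>v z = 0\<^sub>v N"
    show "P *\<^sub>v (S *\<^sub>v z) = 0\<^sub>v n"
      unfolding SB[OF z(1)] by (rule into[OF Vc[OF z(1)] null[OF z]])
    have zero: "z = 0\<^sub>v N" if "const_mat V *\<^sub>v z = 0\<^sub>v N"
      using V'(2)[OF z(1)] mult_vec_zero_right[OF c(4)] unfolding that by simp
    show "z = 0\<^sub>v N" if "S *\<^sub>v z = 0\<^sub>v n"
      using inj[OF Vc[OF z(1)] null[OF z]] that unfolding SB[OF z(1)] by (intro zero) simp
    show "vec_degree z = vec_degree (S *\<^sub>v z) + d" if "z \<noteq> 0\<^sub>v N"
      using deg[OF Vc[OF z(1)] null[OF z]] zero that vec_degree_const_gl[OF V z(1)]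
      unfolding SB[OF z(1)] by auto
  next
    fix x :: "complex poly vec" assume x: "x \<in> carrier_vec n" "P *\<^sub>v x = 0\<^sub>v n"
    then obtain v where v: "v \<in> carrier_vec N" "F *\<^sub>v v = 0\<^sub>v N" "B v = x" using surj by blast
    have zc: "const_mat V' *\<^sub>v v \<in> carrier_vec N" using c(4) v(1) by simp
    show "\<exists>z\<in>carrier_vec N. L *\<^sub>v z = 0\<^sub>v N \<and> S *\<^sub>v z = x"
      using LF[OF zc] SB[OF zc] v V'(3)[OF v(1)] mult_vec_zero_right[OF c(1)] zc
      by (intro bexI[of _ "const_mat V' *\<^sub>v v"]) simp_all
  qed
qed

text \<open>
  The factors to the left and right of $M^P_{-m}$ in $M^P_\tau$ are pulled out of the pencil.
  In the other term they are compensated by their inverses, which have the positive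
  indices in reversed order and extend \<open>s\<close> to the permutation \<open>rev l @ s @ rev r\<close>.
\<close>

lemma fiedler_factorization:
  assumes A: "\<And>i. i \<le> m \<Longrightarrow> A i \<in> carrier_mat n n" and m: "0 < m"
    and l: "set l \<subseteq> {0<..<m}" and r: "set r \<subseteq> {0<..<m}" and s: "set s \<subseteq> {..<m}"
    and w: "w \<in> carrier_vec (m * n)"
  defines "Tl \<equiv> fiedler_prod_neg m n A (map Neg l)" and "Tr \<equiv> fiedler_prod_neg m n A (map Neg r)"
  shows "(indet \<cdot>\<^sub>m const_mat (fiedler_prod_neg m n A (map Neg (l @ m # r))) - const_mat (fiedler_prod m n A s)) *\<^sub>v w
    = const_mat Tl *\<^sub>v ((indet \<cdot>\<^sub>m const_mat (elem_mat_neg m n (Neg m) (A m))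
        - const_mat (fiedler_prod m n A (rev l @ s @ rev r))) *\<^sub>v (const_mat Tr *\<^sub>v w))"
proof -
  let ?N = "m * n" and ?D = "elem_mat_neg m n (Neg m) (A m)"
  let ?M = "fiedler_prod m n A (rev l @ s @ rev r)" and ?S = "fiedler_prod m n A s"
  let ?T = "fiedler_prod_neg m n A (map Neg (l @ m # r))"
  let ?l = "fiedler_prod m n A (rev l)" and ?r = "fiedler_prod m n A (rev r)"
  let ?v = "const_mat Tr *\<^sub>v w"
  have sets: "set l \<subseteq> {0<..m}" "set r \<subseteq> {0<..m}" "set [m] \<subseteq> {0<..m}" "set ([m] @ r) \<subseteq> {0<..m}"
    "set (rev l) \<subseteq> {..<m}" "set (rev r) \<subseteq> {..<m}" "set (s @ rev r) \<subseteq> {..<m}"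
    "set (rev l @ s @ rev r) \<subseteq> {..<m}" "set (l @ m # r) \<subseteq> {0<..m}"
    using l r s m by auto
  have c: "Tl \<in> carrier_mat ?N ?N" "Tr \<in> carrier_mat ?N ?N" "?D \<in> carrier_mat ?N ?N"
    "?M \<in> carrier_mat ?N ?N" "?S \<in> carrier_mat ?N ?N" "?T \<in> carrier_mat ?N ?N"
    "?l \<in> carrier_mat ?N ?N" "?r \<in> carrier_mat ?N ?N"
    unfolding Tl_def Tr_def
    using fiedler_prod_neg_carrier[of m A n, OF A] fiedler_prod_carrier[of m A n, OF A]
      elem_mat_neg_carrier[OF A[OF order_refl] m order_refl] sets s by blast+
  have T: "?T = Tl * (?D * Tr)"
    using fiedler_prod_neg_append[of m A n l "[m] @ r", OF A sets(1,4)]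
      fiedler_prod_neg_append[of m A n "[m]" r, OF A sets(3,2)]
      fiedler_prod_neg_single[of m A n m, OF A m order_refl] unfolding Tl_def Tr_def by simp
  have M: "?M = ?l * (?S * ?r)"
    using fiedler_prod_append[of m A n "rev l" "s @ rev r", OF A sets(5,7)]
      fiedler_prod_append[of m A n s "rev r", OF A s sets(6)] by simp
  have v: "?v \<in> carrier_vec ?N" using c(2) w by simp
  have "const_mat ?T *\<^sub>v w = const_mat Tl *\<^sub>v (const_mat ?D *\<^sub>v ?v)"
    unfolding T using const_mat_mult_vec[OF c(1) mult_carrier_mat[OF c(3,2)] w] const_mat_mult_vec[OF c(3,2) w]
    by simp
  moreover have "const_mat ?S *\<^sub>v w = const_mat Tl *\<^sub>v (const_mat ?M *\<^sub>v ?v)"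
  proof -
    have rw: "const_mat ?r *\<^sub>v ?v = w"
      using const_mat_mult_vec[OF c(8,2) w] fiedler_prod_neg_inverse[of m A n r, OF A r] const_one_mult_vec[OF w]
      unfolding Tr_def by simp
    have Sw: "const_mat ?S *\<^sub>v w \<in> carrier_vec ?N" using c(5) w by simp
    have "const_mat ?M *\<^sub>v ?v = const_mat ?l *\<^sub>v (const_mat ?S *\<^sub>v w)"
      unfolding M using const_mat_mult_vec[OF c(7) mult_carrier_mat[OF c(5,8)] v] const_mat_mult_vec[OF c(5,8) v] rw
      by simp
    then have "const_mat Tl *\<^sub>v (const_mat ?M *\<^sub>v ?v) = const_mat (Tl * ?l) *\<^sub>v (const_mat ?S *\<^sub>v w)"
      using const_mat_mult_vec[OF c(1,7) Sw] by simp
    then show ?thesis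
      using fiedler_prod_neg_inverse[of m A n l, OF A l] const_one_mult_vec[OF Sw] unfolding Tl_def by simp
  qed
  moreover have split: "(indet \<cdot>\<^sub>m const_mat X - const_mat Y) *\<^sub>v u = indet \<cdot>\<^sub>v (const_mat X *\<^sub>v u) - const_mat Y *\<^sub>v u"
    if "X \<in> carrier_mat ?N ?N" "Y \<in> carrier_mat ?N ?N" "u \<in> carrier_vec ?N" for X Y u
    using that by (subst minus_mult_distrib_mat_vec[of _ ?N ?N]) (simp_all add: smult_mat_mult_vec[of _ ?N ?N])
  moreover have "const_mat Tl *\<^sub>v (indet \<cdot>\<^sub>v x - y) = indet \<cdot>\<^sub>v (const_mat Tl *\<^sub>v x) - const_mat Tl *\<^sub>v y"
    if "x \<in> carrier_vec ?N" "y \<in> carrier_vec ?N" for x y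
  proof -
    have cTl: "const_mat Tl \<in> carrier_mat ?N ?N" using c(1) by simp
    show ?thesis
      using mult_minus_distrib_mat_vec[OF cTl, of "indet \<cdot>\<^sub>v x" y] mult_mat_smult_vec[OF cTl that(1), of indet] that
      by simp
  qed
  moreover have "const_mat ?D *\<^sub>v ?v \<in> carrier_vec ?N" "const_mat ?M *\<^sub>v ?v \<in> carrier_vec ?N"
    using c v by auto
  ultimately show ?thesis
    using split[OF c(6,5) w] split[OF c(3,4) v] by simp
qed

lemma egfp_index_ranges:
  assumes egfp: "is_EGFP m n A \<tau>1 \<sigma>1 \<tau> \<sigma> \<sigma>2 \<tau>2 Y1 X1 X2 Y2 L"
    and m\<tau>: "Neg m \<in> set \<tau>" and z\<tau>: "Neg 0 \<notin> set \<tau>"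
  obtains \<omega> where "distinct (\<sigma> @ \<omega>)" "set (\<sigma> @ \<omega>) = {0..m}" "\<tau> = map Neg \<omega>"
    "set \<omega> \<subseteq> {0<..m}" "set \<sigma> \<subseteq> {..<m}" "set \<sigma>1 \<subseteq> {..<m}" "set \<sigma>2 \<subseteq> {..<m}"
    "set \<tau>1 \<subseteq> Neg ` {0<..m}" "set \<tau>2 \<subseteq> Neg ` {0<..m}"
proof -
  obtain \<omega> where \<omega>: "distinct (\<sigma> @ \<omega>)" "set (\<sigma> @ \<omega>) = {0..m}" "\<tau> = map Neg \<omega>"
    using egfp unfolding is_EGFP_def by blast
  have e: "set \<sigma>1 \<subseteq> set \<sigma>" "set \<sigma>2 \<subseteq> set \<sigma>" "set \<tau>1 \<subseteq> set \<tau>" "set \<tau>2 \<subseteq> set \<tau>"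
    using egfp unfolding is_EGFP_def by blast+
  have "0 \<notin> set \<omega>" "m \<in> set \<omega>" using m\<tau> z\<tau> unfolding \<omega>(3) by auto
  then have \<omega>_range: "set \<omega> \<subseteq> {0<..m}" and m\<sigma>: "m \<notin> set \<sigma>"
    using \<omega>(1,2) by (auto intro!: Nat.gr0I)
  have s: "set \<sigma> \<subseteq> {..<m}"
  proof
    fix i assume i: "i \<in> set \<sigma>"
    then have "i \<in> {0..m}" unfolding \<omega>(2)[symmetric] by simp
    moreover have "i \<noteq> m" using i m\<sigma> by auto
    ultimately show "i \<in> {..<m}" by simp
  qed
  have "set \<tau>1 \<subseteq> Neg ` {0<..m}" "set \<tau>2 \<subseteq> Neg ` {0<..m}"
    using e(3,4) image_mono[OF \<omega>_range, of Neg] unfolding \<omega>(3) set_map by blast+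
  then show ?thesis
    using that[OF \<omega> \<omega>_range s] e(1,2) s by blast
qed

theorem egfp_null_space_transfer:
  assumes m: "m \<ge> 2" and A: "\<And>i. i \<le> m \<Longrightarrow> A i \<in> carrier_mat n n"
    and P: "det (matrix_poly m n A) = 0"
    and egfp: "is_EGFP m n A \<tau>1 \<sigma>1 \<tau> \<sigma> \<sigma>2 \<tau>2 Y1 X1 X2 Y2 L"
    and \<tau>: "\<tau> = \<tau>l @ [Neg m] @ \<tau>r"
  shows "null_space_transfer L (matrix_poly m n A)
    (block_row_selector m n (nat (int m - consecutions 0 (\<sigma> @ \<sigma>2)))) (m * n) (m * n) n n
    (total_inversions m (map neg_abs (rev \<tau>l) @ \<sigma> @ map neg_abs (rev \<tau>r)))"
proof -
  let ?N = "m * n"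
  have e: "Neg 0 \<in> set \<tau> \<Longrightarrow> invertible_mat (A 0)"
    "set \<sigma>1 \<subseteq> set \<sigma> - {m - 1, m}" "set \<sigma>2 \<subseteq> set \<sigma> - {m - 1, m}" "sip (\<sigma>1 @ \<sigma> @ \<sigma>2)"
    "set \<tau>1 \<subseteq> set \<tau> - {Neg 1, Neg 0}" "set \<tau>2 \<subseteq> set \<tau> - {Neg 1, Neg 0}" "sip_neg m (\<tau>1 @ \<tau> @ \<tau>2)"
    using egfp unfolding is_EGFP_def by blast+
  have X1: "matrix_assignment n \<sigma>1 X1" "nonsingular_assignment m \<sigma>1 X1"
    and X2: "matrix_assignment n \<sigma>2 X2" "nonsingular_assignment m \<sigma>2 X2"
    and Y1: "matrix_assignment n \<tau>1 Y1" "nonsingular_assignment_neg m \<tau>1 Y1"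
    and Y2: "matrix_assignment n \<tau>2 Y2" "nonsingular_assignment_neg m \<tau>2 Y2"
    using egfp unfolding is_EGFP_def by blast+
  have L: "L = const_mat (elem_prod_neg m n \<tau>1 Y1) * const_mat (elem_prod m n \<sigma>1 X1) *
         (indet \<cdot>\<^sub>m const_mat (fiedler_prod_neg m n A \<tau>) - const_mat (fiedler_prod m n A \<sigma>)) *
         const_mat (elem_prod m n \<sigma>2 X2) * const_mat (elem_prod_neg m n \<tau>2 Y2)"
    using egfp unfolding is_EGFP_def by blast
  have "Neg 0 \<notin> set \<tau>" using e(1) det_matrix_poly_nonzero[of A n m] A[of 0] P by auto
  moreover have "Neg m \<in> set \<tau>" using \<tau> by simp
  ultimately obtain \<omega> where \<omega>: "distinct (\<sigma> @ \<omega>)" "set (\<sigma> @ \<omega>) = {0..m}" "\<tau> = map Neg \<omega>"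
    and \<omega>_range: "set \<omega> \<subseteq> {0<..m}" and s: "set \<sigma> \<subseteq> {..<m}"
    and sub: "set \<sigma>1 \<subseteq> {..<m}" "set \<sigma>2 \<subseteq> {..<m}"
    and subn: "set \<tau>1 \<subseteq> Neg ` {0<..m}" "set \<tau>2 \<subseteq> Neg ` {0<..m}"
    using egfp_index_ranges[OF egfp] by blast
  obtain \<omega>l \<omega>r where \<omega>lr: "\<omega> = \<omega>l @ m # \<omega>r" "\<tau>l = map Neg \<omega>l" "\<tau>r = map Neg \<omega>r"
    using \<tau> \<omega>(3) by (auto simp: map_eq_append_conv map_eq_Cons_conv append_eq_map_conv Cons_eq_map_conv)
  have abs: "map neg_abs (rev \<tau>l) = rev \<omega>l" "map neg_abs (rev \<tau>r) = rev \<omega>r"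
    unfolding \<omega>lr by (simp_all add: rev_map comp_def)
  have l: "set \<omega>l \<subseteq> {0<..<m}" and r: "set \<omega>r \<subseteq> {0<..<m}"
    using \<omega>_range \<omega>(1) unfolding \<omega>lr(1) by (force simp: le_less)+
  have 0: "0 \<in> set \<sigma>"
  proof -
    have "0 \<in> set (\<sigma> @ \<omega>)" unfolding \<omega>(2) by simp
    then show ?thesis using \<omega>_range by auto
  qed
  let ?\<alpha> = "rev \<omega>l @ \<sigma> @ rev \<omega>r"
  have "set ?\<alpha> = {..<m}"
  proof -
    have "set ?\<alpha> = set (\<sigma> @ \<omega>) - {m}" using \<omega>(1) unfolding \<omega>lr(1) by auto
    also have "\<dots> = {..<m}" unfolding \<omega>(2) by auto
    finally show ?thesis .
  qed
  moreover have "distinct ?\<alpha>" using \<omega>(1) unfolding \<omega>lr(1) by auto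
  ultimately interpret K: fiedler_kernel m n A ?\<alpha>
    by unfold_locales (use m A in auto)
  let ?Tl = "fiedler_prod_neg m n A (map Neg \<omega>l)" and ?Tr = "fiedler_prod_neg m n A (map Neg \<omega>r)"
  note gl = elem_prod_neg_gl[OF subn(1) Y1] elem_prod_gl[OF sub(1) X1] elem_prod_gl[OF sub(2) X2]
    elem_prod_neg_gl[OF subn(2) Y2] fiedler_prod_neg_gl[of m A n \<omega>l, OF A l] fiedler_prod_neg_gl[of m A n \<omega>r, OF A r]
  define U where "U = elem_prod_neg m n \<tau>1 Y1 * (elem_prod m n \<sigma>1 X1 * ?Tl)"
  define V where "V = ?Tr * (elem_prod m n \<sigma>2 X2 * elem_prod_neg m n \<tau>2 Y2)"
  have U: "U \<in> gl_mat ?N" unfolding U_def by (intro gl_mat_mult gl)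
  have V: "V \<in> gl_mat ?N" unfolding V_def by (intro gl_mat_mult gl)
  note c = gl[THEN gl_mat_carrier]
  let ?G = "indet \<cdot>\<^sub>m const_mat (fiedler_prod_neg m n A \<tau>) - const_mat (fiedler_prod m n A \<sigma>)"
  have G: "?G \<in> carrier_mat ?N ?N"
    using fiedler_prod_carrier[of m A n \<sigma>, OF A s] by (simp add: minus_carrier_mat)
  have cc: "const_mat (elem_prod_neg m n \<tau>1 Y1) \<in> carrier_mat ?N ?N" "const_mat (elem_prod m n \<sigma>1 X1) \<in> carrier_mat ?N ?N"
    "const_mat (elem_prod m n \<sigma>2 X2) \<in> carrier_mat ?N ?N" "const_mat (elem_prod_neg m n \<tau>2 Y2) \<in> carrier_mat ?N ?N"
    using c by auto
  let ?z1 = "\<lambda>z. const_mat (elem_prod_neg m n \<tau>2 Y2) *\<^sub>v z"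
  let ?z2 = "\<lambda>z. const_mat (elem_prod m n \<sigma>2 X2) *\<^sub>v ?z1 z"
  have z1: "?z1 z \<in> carrier_vec ?N" and z2: "?z2 z \<in> carrier_vec ?N" if "z \<in> carrier_vec ?N" for z
    using cc that by auto
  have Vz: "const_mat V *\<^sub>v z = const_mat ?Tr *\<^sub>v ?z2 z" if z: "z \<in> carrier_vec ?N" for z
    unfolding V_def
    using const_mat_mult_vec[OF c(6) mult_carrier_mat[OF c(3,4)] z] const_mat_mult_vec[OF c(3,4) z] by simp
  show ?thesis
    unfolding abs
  proof (rule transfer_equivalent_pencil[OF K.pencil_carrier U V])
    show "L \<in> carrier_mat ?N ?N" unfolding L using cc G by (intro mult_carrier_mat)
    show "matrix_poly m n A \<in> carrier_mat n n" by (simp add: matrix_poly_def)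
    show "block_row_selector m n (nat (int m - consecutions 0 (\<sigma> @ \<sigma>2))) \<in> carrier_mat n ?N"
      by (rule block_row_selector_carrier)
  next
    fix z :: "complex poly vec" assume z: "z \<in> carrier_vec ?N"
    have Gz: "?G *\<^sub>v ?z2 z \<in> carrier_vec ?N" using G z2[OF z] by simp
    have fz: "K.pencil *\<^sub>v (const_mat ?Tr *\<^sub>v ?z2 z) \<in> carrier_vec ?N"
      using K.pencil_carrier c(6) z2[OF z] by simp
    have "L *\<^sub>v z = const_mat (elem_prod_neg m n \<tau>1 Y1) *\<^sub>v (const_mat (elem_prod m n \<sigma>1 X1) *\<^sub>v (?G *\<^sub>v ?z2 z))"
      unfolding L using cc G z z1[OF z] z2[OF z] Gz
      by (simp add: assoc_mult_mat_vec[of _ ?N ?N _ ?N] mult_carrier_mat[of _ ?N ?N _ ?N])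
    also have "?G *\<^sub>v ?z2 z = const_mat ?Tl *\<^sub>v (K.pencil *\<^sub>v (const_mat ?Tr *\<^sub>v ?z2 z))"
      using fiedler_factorization[of m A n \<omega>l \<omega>r \<sigma> "?z2 z", OF A K.m l r s z2[OF z]]
      unfolding \<omega>(3) \<omega>lr(1) K.pencil_def .
    finally show "L *\<^sub>v z = const_mat U *\<^sub>v (K.pencil *\<^sub>v (const_mat V *\<^sub>v z))"
      unfolding Vz[OF z] U_def
      using const_mat_mult_vec[OF c(1) mult_carrier_mat[OF c(2,5)] fz] const_mat_mult_vec[OF c(2,5) fz] by simp
  next
    fix z :: "complex poly vec" assume z: "z \<in> carrier_vec ?N"
    obtain g where g: "run 0 \<sigma> = Suc g" using run_zero_pos[OF 0] gr0_conv_Suc by auto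
    obtain h where h: "run 0 (\<sigma> @ \<sigma>2) = Suc h" using run_zero_pos[of "\<sigma> @ \<sigma>2"] 0 gr0_conv_Suc by auto
    have g\<sigma>: "g \<in> set \<sigma>" using run_zero_split[OF g] by (metis in_set_conv_decomp)
    have "h \<in> set (\<sigma> @ \<sigma>2)" using run_zero_split[OF h] by (metis in_set_conv_decomp)
    then have h\<sigma>: "h \<in> set \<sigma>" using e(3) by auto
    then have hm: "h < m" using s by auto
    have h\<omega>: "h \<notin> set \<omega>" using h\<sigma> \<omega>(1) by auto
    \<comment> \<open>The scan of $\alpha$ finds nothing in $-\mathrm{rev}(\tau_l)$, which does not contain $0$.\<close>
    have "run 0 ?\<alpha> = run (Suc g) (rev \<omega>r)"
    proof -
      have "0 \<notin> set (rev \<omega>l)" using l by auto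
      then show ?thesis by (simp add: run_append run_skip g)
    qed
    moreover have "blocks m n (const_mat ?Tr *\<^sub>v ?z2 z) (run (Suc g) (rev \<omega>r) - 1) = blocks m n (?z2 z) g"
    proof -
      have "g \<notin> set (rev \<omega>r)" using g\<sigma> \<omega>(1) unfolding \<omega>lr(1) by auto
      moreover have "g < m" using g\<sigma> s by auto
      moreover have "distinct (rev \<omega>r)" using \<omega>(1) unfolding \<omega>lr(1) by auto
      ultimately show ?thesis
        using select_fiedler_prod_neg[of m A n "rev \<omega>r" g "?z2 z", OF A] r z2[OF z] by simp
    qed
    moreover have "blocks m n (?z2 z) g = blocks m n (?z1 z) h"
      using select_elem_prod[OF e(4) run_zero_pos[OF 0] sub(2) X2(1) z1[OF z]] g h by simp
    moreover have "blocks m n (?z1 z) h = blocks m n z h"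
    proof (rule select_elem_prod_neg[OF subn(2) _ _ Y2(1) z hm])
      show "Neg h \<notin> set \<tau>2" using h\<omega> e(6) unfolding \<omega>(3) by auto
      \<comment> \<open>$-(h+1)$ would occur in $\tau$ and in $\tau_2$, and by the SIP its successor $-h$ in between.\<close>
      show "Neg (Suc h) \<notin> set \<tau>2"
      proof
        assume n: "Neg (Suc h) \<in> set \<tau>2"
        then have "Neg (Suc h) \<in> set \<tau>" using e(6) by auto
        then obtain as bs where 1: "\<tau> = as @ Neg (Suc h) # bs" by (meson split_list)
        obtain cs ds where 2: "\<tau>2 = cs @ Neg (Suc h) # ds" using n by (meson split_list)
        let ?y = "\<lambda>t. m - neg_abs t"
        have "sip (map ?y (\<tau>1 @ as) @ (m - Suc h) # map ?y (bs @ cs) @ (m - Suc h) # map ?y ds)"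
          using e(7) unfolding sip_neg_def 1 2 by simp
        then have "Suc (m - Suc h) \<in> set (map ?y (bs @ cs))" by (rule sip_between)
        then obtain t where t: "t \<in> set (bs @ cs)" "Suc (m - Suc h) = m - neg_abs t" by auto
        then have "t \<in> set \<tau>" using 1 2 e(6) by auto
        then obtain i where i: "t = Neg i" "i \<in> set \<omega>" using \<omega>(3) by auto
        then have "i \<le> m" using \<omega>_range by auto
        then have "i = h" using t(2) i(1) hm by simp
        then show False using i(2) h\<omega> by simp
      qed
    qed
    moreover have "nat (int m - consecutions 0 (\<sigma> @ \<sigma>2)) = m - h"
      using consecutions_zero[of "\<sigma> @ \<sigma>2"] 0 h by simp
    ultimately show "block_row_selector m n (nat (int m - consecutions 0 (\<sigma> @ \<sigma>2))) *\<^sub>v z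
        = blocks m n (const_mat V *\<^sub>v z) (run 0 ?\<alpha> - 1)"
      unfolding Vz[OF z] using block_row_selector_mult[OF z hm] by simp
  next
    fix x :: "complex poly vec" assume "x \<in> carrier_vec n" "matrix_poly m n A *\<^sub>v x = 0\<^sub>v n"
    then show "\<exists>v\<in>carrier_vec ?N. K.pencil *\<^sub>v v = 0\<^sub>v ?N \<and> blocks m n v (run 0 ?\<alpha> - 1) = x"
      using K.null_vector_exists by metis
  qed (use K.null_vector_block K.null_vector_zero K.null_vector_degree in blast)+
qed

section \<open>Transposition\<close>

lemma transpose_diag_two: "A \<in> carrier_mat a a \<Longrightarrow> B \<in> carrier_mat b b \<Longrightarrow>
    transpose_mat (diag_block_mat [A, B]) = diag_block_mat [transpose_mat A, transpose_mat B]"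
  for A B :: "'a::zero mat"
  by (simp only: diag_two[of A a B b] diag_two[of "transpose_mat A" a "transpose_mat B" b] transpose_carrier_mat
      transpose_four_block_mat[of A a a _ b _ b] zero_carrier_mat zero_transpose_mat)

lemma transpose_diag_three: "A \<in> carrier_mat a a \<Longrightarrow> B \<in> carrier_mat b b \<Longrightarrow> C \<in> carrier_mat c c \<Longrightarrow>
    transpose_mat (diag_block_mat [A, B, C]) = diag_block_mat [transpose_mat A, transpose_mat B, transpose_mat C]"
  for A B C :: "'a::zero mat"
  by (simp only: diag_three[of A a B b C c] diag_three[of "transpose_mat A" a "transpose_mat B" b "transpose_mat C" c]
      transpose_carrier_mat transpose_four_block_mat[of A a a _ "b + c" _ "b + c"] zero_carrier_mat
      zero_transpose_mat transpose_diag_two diag_two_carrier)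

lemma transpose_elem_mat:
  assumes X: "X \<in> carrier_mat n n"
  shows "transpose_mat (elem_mat m n i X) = elem_mat m n i (transpose_mat X)"
proof (cases "i = 0")
  case True
  then show ?thesis by (simp only: elem_mat_def if_True refl transpose_diag_two[OF one_carrier_mat X] transpose_one)
next
  case False
  have X': "transpose_mat X \<in> carrier_mat n n" using X by simp
  have "transpose_mat (four_block_mat X (1\<^sub>m n) (1\<^sub>m n) (0\<^sub>m n n)) = four_block_mat (transpose_mat X) (1\<^sub>m n) (1\<^sub>m n) (0\<^sub>m n n)"
    by (simp only: transpose_four_block_mat[OF X one_carrier_mat one_carrier_mat zero_carrier_mat]
        transpose_one zero_transpose_mat)
  then show ?thesis using False
    by (simp only: elem_mat_def if_False transpose_one
        transpose_diag_three[OF one_carrier_mat four_block_carrier_mat[OF X zero_carrier_mat] one_carrier_mat])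
qed

lemma transpose_elem_mat_neg:
  assumes X: "X \<in> carrier_mat n n"
  shows "transpose_mat (elem_mat_neg m n t X) = elem_mat_neg m n t (transpose_mat X)"
proof (cases t)
  case (Neg i)
  show ?thesis
  proof (cases "i = m")
    case True
    then show ?thesis
      by (simp only: Neg elem_mat_neg.simps if_True refl transpose_diag_two[OF X one_carrier_mat] transpose_one)
  next
    case False
    have "transpose_mat (four_block_mat (0\<^sub>m n n) (1\<^sub>m n) (1\<^sub>m n) X) = four_block_mat (0\<^sub>m n n) (1\<^sub>m n) (1\<^sub>m n) (transpose_mat X)"
      by (simp only: transpose_four_block_mat[OF zero_carrier_mat one_carrier_mat one_carrier_mat X]
          transpose_one zero_transpose_mat)
    then show ?thesis using False
      by (simp only: Neg elem_mat_neg.simps if_False transpose_one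
          transpose_diag_three[OF one_carrier_mat four_block_carrier_mat[OF zero_carrier_mat X] one_carrier_mat])
  qed
qed

lemma transpose_mat_prod:
  assumes "set Ms \<subseteq> carrier_mat N N"
  shows "transpose_mat (mat_prod N Ms) = mat_prod N (rev (map transpose_mat Ms))"
  using assms
proof (induction Ms)
  case Nil
  then show ?case by (simp add: mat_prod_Nil)
next
  case (Cons M Ms)
  then have c: "M \<in> carrier_mat N N" "mat_prod N Ms \<in> carrier_mat N N" "transpose_mat M \<in> carrier_mat N N"
    "set (rev (map transpose_mat Ms)) \<subseteq> carrier_mat N N"
    using mat_prod_carrier[of Ms N] by auto
  have "transpose_mat (mat_prod N (M # Ms)) = transpose_mat (mat_prod N Ms) * transpose_mat M"
    unfolding mat_prod_Cons by (rule transpose_mult[OF c(1,2)])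
  also have "\<dots> = mat_prod N (rev (map transpose_mat Ms)) * mat_prod N [transpose_mat M]"
    using Cons by (simp add: mat_prod_Cons mat_prod_Nil right_mult_one_mat[OF c(3)])
  also have "\<dots> = mat_prod N (rev (map transpose_mat (M # Ms)))"
    using mat_prod_append[OF c(4), of "[transpose_mat M]"] c(3) by simp
  finally show ?case .
qed

lemma map2_carriers:
  assumes "matrix_assignment n t X" "\<And>i Y. i \<in> set t \<Longrightarrow> Y \<in> carrier_mat n n \<Longrightarrow> f i Y \<in> S"
  shows "set (map2 f t X) \<subseteq> S"
proof
  fix M assume "M \<in> set (map2 f t X)"
  then obtain i Y where "(i, Y) \<in> set (zip t X)" "M = f i Y" by auto
  then show "M \<in> S"
    using assms(1) assms(2)[of i Y] set_zip_leftD[of i Y t X] set_zip_rightD[of i Y t X]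
    unfolding matrix_assignment_def by auto
qed

lemma map2_transpose:
  assumes "matrix_assignment n t X" "\<And>i Y. i \<in> set t \<Longrightarrow> Y \<in> carrier_mat n n \<Longrightarrow> transpose_mat (f i Y) = f i (transpose_mat Y)"
  shows "rev (map transpose_mat (map2 f t X)) = map2 f (rev t) (rev (map transpose_mat X))"
proof -
  have len: "length t = length X" using assms(1) by (simp add: matrix_assignment_def)
  have "map transpose_mat (map2 f t X) = map2 f t (map transpose_mat X)"
    unfolding zip_map2 map_map
  proof (rule map_cong[OF refl])
    fix p assume "p \<in> set (zip t X)"
    then obtain i Y where p: "p = (i, Y)" "(i, Y) \<in> set (zip t X)" by (metis surj_pair)
    then show "(transpose_mat \<circ> (\<lambda>(x, y). f x y)) p = ((\<lambda>(x, y). f x y) \<circ> (\<lambda>(x, y). (x, transpose_mat y))) p"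
      using assms(2)[of i Y] assms(1) set_zip_leftD[of i Y t X] set_zip_rightD[of i Y t X]
      unfolding matrix_assignment_def by auto
  qed
  moreover have "rev (map2 f t Y) = map2 f (rev t) (rev Y)" if "length t = length Y" for Y
    using that by (simp add: rev_map zip_rev)
  ultimately show ?thesis using len by simp
qed

lemma transpose_elem_prod:
  assumes "set t \<subseteq> {..<m}" "matrix_assignment n t X"
  shows "transpose_mat (elem_prod m n t X) = elem_prod m n (rev t) (rev (map transpose_mat X))"
proof -
  have "set (map2 (elem_mat m n) t X) \<subseteq> carrier_mat (m * n) (m * n)"
    using assms(1) by (intro map2_carriers[OF assms(2)] elem_mat_carrier) auto
  moreover have eq: "rev (map transpose_mat (map2 (elem_mat m n) t X))
      = map2 (elem_mat m n) (rev t) (rev (map transpose_mat X))"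
    by (rule map2_transpose[OF assms(2)]) (rule transpose_elem_mat)
  ultimately show ?thesis
    using transpose_mat_prod[of "map2 (elem_mat m n) t X" "m * n"] by (simp only: elem_prod_def)
qed

lemma transpose_elem_prod_neg:
  assumes "set t \<subseteq> Neg ` {0<..m}" "matrix_assignment n t X"
  shows "transpose_mat (elem_prod_neg m n t X) = elem_prod_neg m n (rev t) (rev (map transpose_mat X))"
proof -
  have "set (map2 (elem_mat_neg m n) t X) \<subseteq> carrier_mat (m * n) (m * n)"
  proof (rule map2_carriers[OF assms(2)])
    fix t' Y assume "t' \<in> set t" and Y: "(Y :: complex mat) \<in> carrier_mat n n"
    then obtain i where "t' = Neg i" "0 < i" "i \<le> m" using assms(1) by auto
    then show "elem_mat_neg m n t' Y \<in> carrier_mat (m * n) (m * n)"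
      using elem_mat_neg_carrier[OF Y] by simp
  qed
  moreover have eq: "rev (map transpose_mat (map2 (elem_mat_neg m n) t X))
      = map2 (elem_mat_neg m n) (rev t) (rev (map transpose_mat X))"
    by (rule map2_transpose[OF assms(2)]) (rule transpose_elem_mat_neg)
  ultimately show ?thesis
    using transpose_mat_prod[of "map2 (elem_mat_neg m n) t X" "m * n"] by (simp only: elem_prod_neg_def)
qed

lemma transpose_fiedler_prod:
  assumes A: "\<And>i. i \<le> m \<Longrightarrow> A i \<in> carrier_mat n n" and t: "set t \<subseteq> {..<m}"
  shows "transpose_mat (fiedler_prod m n A t) = fiedler_prod m n (\<lambda>i. transpose_mat (A i)) (rev t)"
proof -
  have "set (map (fiedler_mat m n A) t) \<subseteq> carrier_mat (m * n) (m * n)"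
    using t fiedler_mat_carrier[of m A n, OF A] by auto
  moreover have "map transpose_mat (map (fiedler_mat m n A) t) = map (fiedler_mat m n (\<lambda>i. transpose_mat (A i))) t"
    unfolding map_map
  proof (rule map_cong[OF refl])
    fix i assume "i \<in> set t"
    then have i: "i < m" using t by auto
    then have "- A i \<in> carrier_mat n n" using A[of i] by simp
    then show "(transpose_mat \<circ> fiedler_mat m n A) i = fiedler_mat m n (\<lambda>i. transpose_mat (A i)) i"
      using i by (simp add: fiedler_mat_below transpose_elem_mat transpose_uminus)
  qed
  ultimately show ?thesis unfolding fiedler_prod_def by (simp only: transpose_mat_prod rev_map)
qed

lemma transpose_fiedler_prod_neg:
  assumes A: "\<And>i. i \<le> m \<Longrightarrow> A i \<in> carrier_mat n n" and t: "set t \<subseteq> {0<..m}"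
  shows "transpose_mat (fiedler_prod_neg m n A (map Neg t))
    = fiedler_prod_neg m n (\<lambda>i. transpose_mat (A i)) (map Neg (rev t))"
proof -
  have "map transpose_mat (map (fiedler_mat_neg m n A) (map Neg t))
      = map (fiedler_mat_neg m n (\<lambda>i. transpose_mat (A i))) (map Neg t)"
    unfolding map_map
  proof (rule map_cong[OF refl])
    fix i assume "i \<in> set t"
    then have "0 < i" "A i \<in> carrier_mat n n" using t A[of i] by auto
    then show "(transpose_mat \<circ> (fiedler_mat_neg m n A \<circ> Neg)) i
        = (fiedler_mat_neg m n (\<lambda>i. transpose_mat (A i)) \<circ> Neg) i"
      by (simp add: fiedler_mat_neg_pos transpose_elem_mat_neg)
  qed
  then show ?thesis
    using transpose_mat_prod[OF fiedler_neg_carriers[of m A n t, OF A t]]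
    unfolding fiedler_prod_neg_def by (simp only: rev_map)
qed

lemma invertible_transpose:
  fixes X :: "complex mat"
  assumes "invertible_mat X" "X \<in> carrier_mat n n"
  shows "invertible_mat (transpose_mat X)"
proof -
  obtain B where B: "B \<in> carrier_mat n n" "X * B = 1\<^sub>m n" "B * X = 1\<^sub>m n"
    by (rule invertible_matE[OF assms])
  have "transpose_mat X * transpose_mat B = 1\<^sub>m n" "transpose_mat B * transpose_mat X = 1\<^sub>m n"
    unfolding transpose_mult[OF B(1) assms(2), symmetric] transpose_mult[OF assms(2) B(1), symmetric]
    using B(2,3) by simp_all
  then show ?thesis
    unfolding invertible_mat_def inverts_mat_def using assms(2) B(1)
    by (intro conjI exI[of _ "transpose_mat B"]) auto
qed

lemma matrix_assignment_transpose:
  "matrix_assignment n t X \<Longrightarrow> matrix_assignment n (rev t) (rev (map transpose_mat X))"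
  unfolding matrix_assignment_def by auto

lemma nonsingular_transpose_aux:
  assumes X: "matrix_assignment n t X" and ns: "\<forall>k < length t. t ! k \<in> I \<longrightarrow> invertible_mat (X ! k)"
  shows "\<forall>k < length (rev t). rev t ! k \<in> I \<longrightarrow> invertible_mat (rev (map transpose_mat X) ! k)"
proof (intro allI impI)
  fix k assume k: "k < length (rev t)" "rev t ! k \<in> I"
  let ?j = "length t - Suc k"
  have len: "length X = length t" and j: "?j < length t" and c: "set X \<subseteq> carrier_mat n n"
    using X k(1) by (auto simp: matrix_assignment_def)
  have "t ! ?j \<in> I" using k by (simp add: rev_nth)
  then have "invertible_mat (X ! ?j)" using ns j by blast
  moreover have "X ! ?j \<in> carrier_mat n n" using c len j by (metis nth_mem subsetD)
  ultimately show "invertible_mat (rev (map transpose_mat X) ! k)"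
    using k(1) len by (simp add: rev_nth invertible_transpose)
qed

lemma transpose_five:
  fixes B C D E F :: "'a::comm_ring_1 mat"
  assumes "B \<in> carrier_mat N N" "C \<in> carrier_mat N N" "D \<in> carrier_mat N N" "E \<in> carrier_mat N N" "F \<in> carrier_mat N N"
  shows "transpose_mat (B * C * D * E * F) =
    transpose_mat F * transpose_mat E * transpose_mat D * transpose_mat C * transpose_mat B"
proof -
  have c: "B * C \<in> carrier_mat N N" "B * C * D \<in> carrier_mat N N" "B * C * D * E \<in> carrier_mat N N"
    using assms by (auto intro: mult_carrier_mat)
  have t: "transpose_mat B \<in> carrier_mat N N" "transpose_mat C \<in> carrier_mat N N" "transpose_mat D \<in> carrier_mat N N"
    "transpose_mat E \<in> carrier_mat N N" "transpose_mat F \<in> carrier_mat N N"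
    using assms by simp_all
  have a: "F' * (E' * G') = F' * E' * G'"
    if "F' \<in> carrier_mat N N" "E' \<in> carrier_mat N N" "G' \<in> carrier_mat N N" for F' E' G' :: "'a mat"
    using that by (rule assoc_mult_mat[symmetric])
  show ?thesis
    unfolding transpose_mult[OF c(3) assms(5)] transpose_mult[OF c(2) assms(4)]
      transpose_mult[OF c(1) assms(3)] transpose_mult[OF assms(1,2)]
    using t by (simp only: a mult_carrier_mat[of _ N N _ N])
qed

text \<open>
  The form of an EGFP is symmetric under reversal, the SIP included. The conditions on \<open>m\<close> and $-0$
  rule out the factors that are defined as inverses.
\<close>

theorem is_EGFP_transpose:
  assumes A: "\<And>i. i \<le> m \<Longrightarrow> A i \<in> carrier_mat n n"
    and egfp: "is_EGFP m n A \<tau>1 \<sigma>1 \<tau> \<sigma> \<sigma>2 \<tau>2 Y1 X1 X2 Y2 L"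
    and m\<tau>: "Neg m \<in> set \<tau>" and z\<tau>: "Neg 0 \<notin> set \<tau>"
  shows "is_EGFP m n (\<lambda>i. transpose_mat (A i)) (rev \<tau>2) (rev \<sigma>2) (rev \<tau>) (rev \<sigma>) (rev \<sigma>1) (rev \<tau>1)
    (rev (map transpose_mat Y2)) (rev (map transpose_mat X2)) (rev (map transpose_mat X1))
    (rev (map transpose_mat Y1)) (transpose_mat L)"
proof -
  let ?N = "m * n" and ?t = "\<lambda>X. rev (map transpose_mat X)"
  obtain \<omega> where \<omega>: "distinct (\<sigma> @ \<omega>)" "set (\<sigma> @ \<omega>) = {0..m}" "\<tau> = map Neg \<omega>"
    and \<omega>_range: "set \<omega> \<subseteq> {0<..m}" and s: "set \<sigma> \<subseteq> {..<m}"
    and sub: "set \<sigma>1 \<subseteq> {..<m}" "set \<sigma>2 \<subseteq> {..<m}"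
    and subn: "set \<tau>1 \<subseteq> Neg ` {0<..m}" "set \<tau>2 \<subseteq> Neg ` {0<..m}"
    using egfp_index_ranges[OF egfp m\<tau> z\<tau>] by blast
  have m\<sigma>: "m \<notin> set \<sigma>" using s by auto
  have e: "set \<sigma>1 \<subseteq> set \<sigma> - {m - 1, m}" "set \<sigma>2 \<subseteq> set \<sigma> - {m - 1, m}" "sip (\<sigma>1 @ \<sigma> @ \<sigma>2)"
    "set \<tau>1 \<subseteq> set \<tau> - {Neg 1, Neg 0}" "set \<tau>2 \<subseteq> set \<tau> - {Neg 1, Neg 0}" "sip_neg m (\<tau>1 @ \<tau> @ \<tau>2)"
    using egfp unfolding is_EGFP_def by blast+
  have X1: "matrix_assignment n \<sigma>1 X1" "nonsingular_assignment m \<sigma>1 X1"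
    and X2: "matrix_assignment n \<sigma>2 X2" "nonsingular_assignment m \<sigma>2 X2"
    and Y1: "matrix_assignment n \<tau>1 Y1" "nonsingular_assignment_neg m \<tau>1 Y1"
    and Y2: "matrix_assignment n \<tau>2 Y2" "nonsingular_assignment_neg m \<tau>2 Y2"
    using egfp unfolding is_EGFP_def by blast+
  have L: "L = const_mat (elem_prod_neg m n \<tau>1 Y1) * const_mat (elem_prod m n \<sigma>1 X1) *
         (indet \<cdot>\<^sub>m const_mat (fiedler_prod_neg m n A \<tau>) - const_mat (fiedler_prod m n A \<sigma>)) *
         const_mat (elem_prod m n \<sigma>2 X2) * const_mat (elem_prod_neg m n \<tau>2 Y2)"
    using egfp unfolding is_EGFP_def by blast
  note c = elem_prod_neg_carrier[OF subn(1) Y1(1)] elem_prod_carrier[OF sub(1) X1(1)]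
    fiedler_prod_neg_carrier[of m A n \<omega>, OF A \<omega>_range] fiedler_prod_carrier[of m A n \<sigma>, OF A s]
    elem_prod_carrier[OF sub(2) X2(1)] elem_prod_neg_carrier[OF subn(2) Y2(1)]
  let ?G = "indet \<cdot>\<^sub>m const_mat (fiedler_prod_neg m n A \<tau>) - const_mat (fiedler_prod m n A \<sigma>)"
  let ?G' = "indet \<cdot>\<^sub>m const_mat (fiedler_prod_neg m n (\<lambda>i. transpose_mat (A i)) (rev \<tau>))
      - const_mat (fiedler_prod m n (\<lambda>i. transpose_mat (A i)) (rev \<sigma>))"
  have G: "?G \<in> carrier_mat ?N ?N" using c(4) by (simp add: minus_carrier_mat)
  have tG: "transpose_mat ?G = ?G'"
  proof -
    have "?G' = indet \<cdot>\<^sub>m const_mat (transpose_mat (fiedler_prod_neg m n A \<tau>))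
        - const_mat (transpose_mat (fiedler_prod m n A \<sigma>))"
      using transpose_fiedler_prod[of m A n \<sigma>, OF A s] transpose_fiedler_prod_neg[of m A n \<omega>, OF A \<omega>_range]
      unfolding \<omega>(3) by (simp add: rev_map)
    also have "\<dots> = transpose_mat ?G" using c(3,4) unfolding \<omega>(3) by (intro eq_matI) auto
    finally show ?thesis ..
  qed
  have cc: "const_mat (elem_prod_neg m n \<tau>1 Y1) \<in> carrier_mat ?N ?N" "const_mat (elem_prod m n \<sigma>1 X1) \<in> carrier_mat ?N ?N"
    "const_mat (elem_prod m n \<sigma>2 X2) \<in> carrier_mat ?N ?N" "const_mat (elem_prod_neg m n \<tau>2 Y2) \<in> carrier_mat ?N ?N"
    using c by auto
  have tL: "transpose_mat L = const_mat (elem_prod_neg m n (rev \<tau>2) (?t Y2)) * const_mat (elem_prod m n (rev \<sigma>2) (?t X2)) *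
      ?G' * const_mat (elem_prod m n (rev \<sigma>1) (?t X1)) * const_mat (elem_prod_neg m n (rev \<tau>1) (?t Y1))"
    unfolding L transpose_five[OF cc(1,2) G cc(3,4)] tG
      transpose_elem_prod[OF sub(1) X1(1), symmetric] transpose_elem_prod[OF sub(2) X2(1), symmetric]
      transpose_elem_prod_neg[OF subn(1) Y1(1), symmetric] transpose_elem_prod_neg[OF subn(2) Y2(1), symmetric]
    by (simp only: map_mat_transpose)
  have sip': "sip (rev \<sigma>2 @ rev \<sigma> @ rev \<sigma>1)" "sip_neg m (rev \<tau>2 @ rev \<tau> @ rev \<tau>1)"
    using e(3,6) sip_rev[of "\<sigma>1 @ \<sigma> @ \<sigma>2"] sip_neg_rev[of m "\<tau>1 @ \<tau> @ \<tau>2"] by simp_all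
  have ns: "nonsingular_assignment m (rev \<sigma>1) (?t X1)" "nonsingular_assignment m (rev \<sigma>2) (?t X2)"
    "nonsingular_assignment_neg m (rev \<tau>1) (?t Y1)" "nonsingular_assignment_neg m (rev \<tau>2) (?t Y2)"
    using X1 X2 Y1 Y2 nonsingular_transpose_aux
    unfolding nonsingular_assignment_def nonsingular_assignment_neg_def by blast+
  have perm: "\<exists>\<omega>. distinct (rev \<sigma> @ \<omega>) \<and> set (rev \<sigma> @ \<omega>) = {0..m} \<and> rev \<tau> = map Neg \<omega>"
    using \<omega> by (intro exI[of _ "rev \<omega>"]) (auto simp: rev_map)
  show ?thesis
    unfolding is_EGFP_def
    using perm m\<sigma> z\<tau> e(1,2,4,5) sip' ns tL matrix_assignment_transpose[OF X1(1)]
      matrix_assignment_transpose[OF X2(1)] matrix_assignment_transpose[OF Y1(1)]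
      matrix_assignment_transpose[OF Y2(1)]
    by simp
qed

lemma matrix_poly_transpose:
  assumes "\<And>i. i \<le> m \<Longrightarrow> A i \<in> carrier_mat n n"
  shows "matrix_poly m n (\<lambda>i. transpose_mat (A i)) = transpose_mat (matrix_poly m n A)"
proof (rule eq_matI)
  fix i j assume "i < dim_row (transpose_mat (matrix_poly m n A))" "j < dim_col (transpose_mat (matrix_poly m n A))"
  then have "i < n" "j < n" by (simp_all add: matrix_poly_def)
  moreover have "(\<Sum>k\<le>m. monom (transpose_mat (A k) $$ (i, j)) k) = (\<Sum>k\<le>m. monom (A k $$ (j, i)) k)"
  proof (rule sum.cong[OF refl])
    fix k assume "k \<in> {..m}"
    then have "A k \<in> carrier_mat n n" using assms by simp
    then show "monom (transpose_mat (A k) $$ (i, j)) k = monom (A k $$ (j, i)) k"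
      using \<open>i < n\<close> \<open>j < n\<close> by simp
  qed
  ultimately show "matrix_poly m n (\<lambda>i. transpose_mat (A i)) $$ (i, j) = transpose_mat (matrix_poly m n A) $$ (i, j)"
    by (simp add: matrix_poly_def)
qed (simp_all add: matrix_poly_def)

lemma left_minimal_basis_transpose:
  "left_minimal_basis (rational_mat L) Z \<longleftrightarrow> right_minimal_basis (rational_mat (transpose_mat L)) Z"
  unfolding left_minimal_basis_def right_minimal_basis_def left_null_def right_null_def
    map_mat_transpose[symmetric] by simp

section \<open>Minimal bases and minimal indices of an EGFP\<close>

theorem theorem5p2:
  fixes m n p cL iL :: nat
    and A :: "nat \<Rightarrow> complex mat"
    and P L Z :: "complex poly mat"
    and \<sigma> \<sigma>1 \<sigma>2 :: "nat list"
    and \<tau> \<tau>l \<tau>r \<tau>1 \<tau>2 :: "neg_index list"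
    and X1 X2 Y1 Y2 :: "complex mat list"
  assumes "m \<ge> 2"
    and "\<And>i. i \<le> m \<Longrightarrow> A i \<in> carrier_mat n n"
    and "A m \<noteq> 0\<^sub>m n n"
    and "P = matrix_poly m n A"
    and "det P = 0"
    and "is_EGFP m n A \<tau>1 \<sigma>1 \<tau> \<sigma> \<sigma>2 \<tau>2 Y1 X1 X2 Y2 L"
    and "\<tau> = \<tau>l @ [Neg m] @ \<tau>r"
    and "cL = total_consecutions m (map neg_abs (rev \<tau>l) @ \<sigma> @ map neg_abs (rev \<tau>r))"
    and "iL = total_inversions m (map neg_abs (rev \<tau>l) @ \<sigma> @ map neg_abs (rev \<tau>r))"
    and "Z \<in> carrier_mat (m * n) p"
  shows
    "(right_minimal_basis (rational_mat L) Z \<longrightarrow>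
        right_minimal_basis (rational_mat P)
          (block_row_selector m n (nat (int m - consecutions 0 (\<sigma> @ \<sigma>2))) * Z)) \<and>
     (left_minimal_basis (rational_mat L) Z \<longrightarrow>
        left_minimal_basis (rational_mat P)
          (block_row_selector m n (nat (int m - inversions 0 (\<sigma>1 @ \<sigma>))) * Z)) \<and>
     (\<forall>\<epsilon>. right_minimal_indices (rational_mat L) \<epsilon> \<longrightarrow>
        right_minimal_indices (rational_mat P) (map (\<lambda>e. e - int iL) \<epsilon>)) \<and>
     (\<forall>\<epsilon>. left_minimal_indices (rational_mat L) \<epsilon> \<longrightarrow>
        left_minimal_indices (rational_mat P) (map (\<lambda>e. e - int cL) \<epsilon>))"
proof -
  let ?\<alpha> = "map neg_abs (rev \<tau>l) @ \<sigma> @ map neg_abs (rev \<tau>r)"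
  let ?A' = "\<lambda>i. transpose_mat (A i)"
  let ?S = "block_row_selector m n (nat (int m - consecutions 0 (\<sigma> @ \<sigma>2)))"
  let ?S' = "block_row_selector m n (nat (int m - inversions 0 (\<sigma>1 @ \<sigma>)))"
  have A: "A i \<in> carrier_mat n n" if "i \<le> m" for i using assms(2) that .
  have A': "?A' i \<in> carrier_mat n n" if "i \<le> m" for i using A[OF that] by simp
  have det: "det (matrix_poly m n A) = 0" using assms(4,5) by simp
  have P': "matrix_poly m n ?A' = transpose_mat P"
    using matrix_poly_transpose[of m A n, OF A] assms(4) by simp
  have "P \<in> carrier_mat n n" unfolding assms(4) by (simp add: matrix_poly_def)
  then have det': "det (matrix_poly m n ?A') = 0" unfolding P' using det_transpose assms(5) by metis
  have "Neg 0 \<in> set \<tau> \<longrightarrow> invertible_mat (A 0)" using assms(6) unfolding is_EGFP_def by blast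
  then have "Neg 0 \<notin> set \<tau>" using det_matrix_poly_nonzero[of A n m] A[of 0] det by auto
  then have egfp': "is_EGFP m n ?A' (rev \<tau>2) (rev \<sigma>2) (rev \<tau>) (rev \<sigma>) (rev \<sigma>1) (rev \<tau>1)
      (rev (map transpose_mat Y2)) (rev (map transpose_mat X2)) (rev (map transpose_mat X1))
      (rev (map transpose_mat Y1)) (transpose_mat L)"
    using assms(7) by (intro is_EGFP_transpose[OF A assms(6)]) auto
  have \<tau>': "rev \<tau> = rev \<tau>r @ [Neg m] @ rev \<tau>l" using assms(7) by simp
  interpret R: null_space_transfer L P ?S "m * n" "m * n" n n iL
    using egfp_null_space_transfer[of m A n, OF assms(1) A det assms(6,7)] assms(4,9) by simp
  interpret R': null_space_transfer "transpose_mat L" "transpose_mat P" ?S' "m * n" "m * n" n n cL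
  proof -
    have "inversions 0 (\<sigma>1 @ \<sigma>) = consecutions 0 (rev \<sigma> @ rev \<sigma>1)"
      by (simp add: inversions_zero)
    moreover have "map neg_abs (rev (rev \<tau>r)) @ rev \<sigma> @ map neg_abs (rev (rev \<tau>l)) = rev ?\<alpha>"
      by (simp add: rev_map)
    then have "total_inversions m (map neg_abs (rev (rev \<tau>r)) @ rev \<sigma> @ map neg_abs (rev (rev \<tau>l))) = cL"
      using total_inversions_rev[of m ?\<alpha>] assms(8) by simp
    ultimately show "null_space_transfer (transpose_mat L) (transpose_mat P) ?S' (m * n) (m * n) n n cL"
      using egfp_null_space_transfer[of m ?A' n, OF assms(1) A' det' egfp' \<tau>'] P' by simp
  qed
  have shift: "map (\<lambda>e. e - int d) (map (\<lambda>z. int (vec_degree z)) zs) = map (\<lambda>z. int (vec_degree z)) xs"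
    if "map vec_degree zs = map (\<lambda>x. vec_degree x + d) xs" for d zs xs
  proof -
    have "map (\<lambda>e. e - int d) (map (\<lambda>z. int (vec_degree z)) zs) = map (\<lambda>k. int k - int d) (map vec_degree zs)"
      by simp
    then show ?thesis unfolding that by simp
  qed
  show ?thesis
  proof (intro conjI allI impI)
    show "right_minimal_basis (rational_mat P) (?S * Z)" if "right_minimal_basis (rational_mat L) Z"
      by (rule R.right_minimal_basis_image(1)[OF that])
    show "left_minimal_basis (rational_mat P) (?S' * Z)" if "left_minimal_basis (rational_mat L) Z"
      using that unfolding left_minimal_basis_transpose by (rule R'.right_minimal_basis_image(1))
    show "right_minimal_indices (rational_mat P) (map (\<lambda>e. e - int iL) \<epsilon>)"
      if indices: "right_minimal_indices (rational_mat L) \<epsilon>" for \<epsilon>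
    proof -
      obtain B where B: "right_minimal_basis (rational_mat L) B" "\<epsilon> = map (\<lambda>z. int (vec_degree z)) (cols B)"
        using indices unfolding right_minimal_indices_def by blast
      then show ?thesis
        using R.right_minimal_basis_image[OF B(1)] shift unfolding right_minimal_indices_def by blast
    qed
    show "left_minimal_indices (rational_mat P) (map (\<lambda>e. e - int cL) \<epsilon>)"
      if indices: "left_minimal_indices (rational_mat L) \<epsilon>" for \<epsilon>
    proof -
      obtain B where B: "right_minimal_basis (rational_mat (transpose_mat L)) B"
          "\<epsilon> = map (\<lambda>z. int (vec_degree z)) (cols B)"
        using indices unfolding left_minimal_indices_def left_minimal_basis_transpose by blast
      then show ?thesis
        using R'.right_minimal_basis_image[OF B(1)] shift
        unfolding left_minimal_indices_def left_minimal_basis_transpose by blast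
    qed
  qed
qed

end
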